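(* Let $D$ be a Dedekind domain with finite residue fields and field of fractions $K$. Let $A$ be a $D$-algebra with standard assumptions which is finitely generated as a $D$-module, and let $n\geq 1$ be such that $A$ can be embedded (as a $D$-algebra) in $M_n(D)$. Then $\textnormal{Int}_K(A)=\textnormal{Int}_K(M_n(D))$ if and only if $A\cong M_n(D)$.
   Context: A $D$-algebra $A$ satisfies the standard assumptions if it is torsion-free as a $D$-module and $A\cap K = D$ inside $K\otimes_D A$; polynomials in $K[X]$ are evaluated in $K\otimes_D A$, and $\textnormal{Int}_K(A)=\{f\in K[X]\mid f(A)\subseteq A\}$. $M_n(D)$ is the algebra of $n\times n$ matrices over $D$. Isomorphisms are ring isomorphisms. *)

theory Defs
  imports "HOL-Computational_Algebra.Polynomial" "Jordan_Normal_Form.Matrix"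
begin

definition subring_of :: "'k::field set \<Rightarrow> bool" where
  "subring_of D \<longleftrightarrow> 0 \<in> D \<and> 1 \<in> D \<and>
     (\<forall>x\<in>D. \<forall>y\<in>D. x + y \<in> D \<and> x - y \<in> D \<and> x * y \<in> D)"

definition frac_field_of :: "'k::field set \<Rightarrow> bool" where
  "frac_field_of D \<longleftrightarrow> subring_of D \<and>
     (\<forall>x::'k. \<exists>a\<in>D. \<exists>b\<in>D. b \<noteq> 0 \<and> x = a / b)"

definition ideal_of :: "'k::field set \<Rightarrow> 'k set \<Rightarrow> bool" where
  "ideal_of D I \<longleftrightarrow> I \<subseteq> D \<and> 0 \<in> I \<and> (\<forall>x\<in>I. \<forall>y\<in>I. x + y \<in> I) \<and>
     (\<forall>r\<in>D. \<forall>x\<in>I. r * x \<in> I)"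

definition prime_ideal_of :: "'k::field set \<Rightarrow> 'k set \<Rightarrow> bool" where
  "prime_ideal_of D P \<longleftrightarrow> ideal_of D P \<and> P \<noteq> D \<and>
     (\<forall>x\<in>D. \<forall>y\<in>D. x * y \<in> P \<longrightarrow> x \<in> P \<or> y \<in> P)"

definition maximal_ideal_of :: "'k::field set \<Rightarrow> 'k set \<Rightarrow> bool" where
  "maximal_ideal_of D P \<longleftrightarrow> ideal_of D P \<and> P \<noteq> D \<and>
     (\<forall>J. ideal_of D J \<and> P \<subseteq> J \<longrightarrow> J = P \<or> J = D)"

definition fin_gen_ideal :: "'k::field set \<Rightarrow> 'k set \<Rightarrow> bool" where
  "fin_gen_ideal D I \<longleftrightarrow> (\<exists>S. finite S \<and> S \<subseteq> I \<and>
     I = {\<Sum>s\<in>S. c s * s | c. \<forall>s\<in>S. c s \<in> D})"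

definition noetherian_dom :: "'k::field set \<Rightarrow> bool" where
  "noetherian_dom D \<longleftrightarrow> (\<forall>I. ideal_of D I \<longrightarrow> fin_gen_ideal D I)"

definition integrally_closed_dom :: "'k::field set \<Rightarrow> bool" where
  "integrally_closed_dom D \<longleftrightarrow> (\<forall>p x. lead_coeff p = 1 \<and> (\<forall>i. coeff p i \<in> D) \<and> poly p x = 0 \<longrightarrow> x \<in> D)"

definition dedekind_dom :: "'k::field set \<Rightarrow> bool" where
  "dedekind_dom D \<longleftrightarrow> frac_field_of D \<and> noetherian_dom D \<and> integrally_closed_dom D \<and>
     (\<forall>P. prime_ideal_of D P \<and> P \<noteq> {0} \<longrightarrow> maximal_ideal_of D P) \<and>
     (\<exists>P. prime_ideal_of D P \<and> P \<noteq> {0})"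

definition finite_residue_fields :: "'k::field set \<Rightarrow> bool" where
  "finite_residue_fields D \<longleftrightarrow> (\<forall>P. maximal_ideal_of D P \<longrightarrow>
     finite ((\<lambda>x. {y\<in>D. x - y \<in> P}) ` D))"

definition D_algebra :: "'k::field set \<Rightarrow> ('k \<Rightarrow> 'a::ring_1) \<Rightarrow> bool" where
  "D_algebra D phi \<longleftrightarrow> phi 1 = 1 \<and>
     (\<forall>x\<in>D. \<forall>y\<in>D. phi (x + y) = phi x + phi y \<and> phi (x * y) = phi x * phi y) \<and>
     (\<forall>x\<in>D. \<forall>a. phi x * a = a * phi x)"

text \<open>Standard assumptions: torsion-free, and A \<inter> K = D inside K \<otimes>_D A
  (D embeds in A, and an element a with d a \<in> D for some nonzero d lies in D).\<close>
definition standard_assumptions :: "'k::field set \<Rightarrow> ('k \<Rightarrow> 'a::ring_1) \<Rightarrow> bool" where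
  "standard_assumptions D phi \<longleftrightarrow> D_algebra D phi \<and>
     (\<forall>d\<in>D. \<forall>a. d \<noteq> 0 \<and> phi d * a = 0 \<longrightarrow> a = 0) \<and>
     inj_on phi D \<and>
     (\<forall>a. (\<exists>c\<in>D. \<exists>d\<in>D. d \<noteq> 0 \<and> phi d * a = phi c) \<longrightarrow> (\<exists>e\<in>D. a = phi e))"

definition fin_gen_module :: "'k::field set \<Rightarrow> ('k \<Rightarrow> 'a::ring_1) \<Rightarrow> bool" where
  "fin_gen_module D phi \<longleftrightarrow> (\<exists>S. finite S \<and>
     (\<forall>a. \<exists>c. (\<forall>s\<in>S. c s \<in> D) \<and> a = (\<Sum>s\<in>S. phi (c s) * s)))"

definition alg_eval :: "('k::field \<Rightarrow> 'a::ring_1) \<Rightarrow> 'k poly \<Rightarrow> 'a \<Rightarrow> 'a" where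
  "alg_eval phi g a = (\<Sum>i\<le>degree g. phi (coeff g i) * a ^ i)"

text \<open>Int_K(A): f = g/d with g \<in> D[X], d \<in> D\{0}; f(a) \<in> A in K \<otimes>_D A
  means g(a) \<in> d A (well defined since A is torsion-free).\<close>
definition Int_K :: "'k::field set \<Rightarrow> ('k \<Rightarrow> 'a::ring_1) \<Rightarrow> 'k poly set" where
  "Int_K D phi = {f. \<exists>d\<in>D. d \<noteq> 0 \<and> (\<forall>i. d * coeff f i \<in> D) \<and>
       (\<forall>a. \<exists>b. alg_eval phi (Polynomial.smult d f) a = phi d * b)}"

definition Mn :: "'k::field set \<Rightarrow> nat \<Rightarrow> 'k mat set" where
  "Mn D n = {M \<in> carrier_mat n n. \<forall>i<n. \<forall>j<n. M $$ (i, j) \<in> D}"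

definition mat_eval :: "nat \<Rightarrow> 'k::field poly \<Rightarrow> 'k mat \<Rightarrow> 'k mat" where
  "mat_eval n f M = foldr (\<lambda>c acc. c \<cdot>\<^sub>m 1\<^sub>m n + M * acc) (coeffs f) (0\<^sub>m n n)"

definition Int_K_Mn :: "'k::field set \<Rightarrow> nat \<Rightarrow> 'k poly set" where
  "Int_K_Mn D n = {f. \<forall>M\<in>Mn D n. mat_eval n f M \<in> Mn D n}"

definition D_alg_embedding :: "'k::field set \<Rightarrow> ('k \<Rightarrow> 'a::ring_1) \<Rightarrow> nat \<Rightarrow> ('a \<Rightarrow> 'k mat) \<Rightarrow> bool" where
  "D_alg_embedding D phi n e \<longleftrightarrow> inj e \<and> (\<forall>a. e a \<in> Mn D n) \<and>
     (\<forall>a b. e (a + b) = e a + e b \<and> e (a * b) = e a * e b) \<and> e 1 = 1\<^sub>m n \<and>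
     (\<forall>d\<in>D. \<forall>a. e (phi d * a) = d \<cdot>\<^sub>m e a)"

definition ring_iso_Mn :: "'k::field set \<Rightarrow> nat \<Rightarrow> ('a::ring_1 \<Rightarrow> 'k mat) \<Rightarrow> bool" where
  "ring_iso_Mn D n h \<longleftrightarrow> bij_betw h UNIV (Mn D n) \<and>
     (\<forall>a b. h (a + b) = h a + h b \<and> h (a * b) = h a * h b) \<and> h 1 = 1\<^sub>m n"

end

theory Submission
  imports Defs "Jordan_Normal_Form.Char_Poly"
begin

text \<open>
  Let \<open>B\<close> be the image of \<open>A\<close> in \<open>M\<^sub>n(D)\<close> and suppose that every polynomial that is integer-valued
  on \<open>B\<close> is integer-valued on \<open>M\<^sub>n(D)\<close>. It suffices to show that \<open>B\<close> is everything modulo each maximal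
  ideal \<open>P\<close>, by elimination with a determinant outside \<open>P\<close>. Choose \<open>t \<notin> D\<close> with \<open>t P \<subseteq> D\<close>. If
  \<open>G \<in> D[X]\<close> maps \<open>B\<close> into \<open>M\<^sub>n(P)\<close>, then for a fixed \<open>c \<noteq> 0\<close> all \<open>c t\<^sup>N G\<^sup>N\<close> are integer-valued on
  \<open>B\<close>, hence on \<open>M\<^sub>n(D)\<close>, and taking determinants shows that \<open>t\<^sup>n det G(M)\<close> is almost integral, so lies
  in \<open>D\<close>, for every \<open>M \<in> M\<^sub>n(D)\<close>. With \<open>M\<close> the companion matrix of a polynomial \<open>h\<close> of degree \<open>n\<close>
  irreducible modulo \<open>P\<close>, and of \<open>X\<^sup>n - p\<close> with \<open>p \<in> P\<close> and \<open>t p \<notin> P\<close>, this yields an element of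
  \<open>B\<close> whose characteristic polynomial is \<open>h\<close> modulo \<open>P\<close> and one that is nilpotent modulo \<open>P\<close> of exact
  index \<open>n\<close>. The \<open>(n - 1)\<close>-st power of the latter has rank one modulo \<open>P\<close>; the former acts irreducibly,
  and moves this rank one matrix to all matrix units.

  Conversely, a ring isomorphism of \<open>A\<close> with \<open>M\<^sub>n(D)\<close> can be made \<open>D\<close>-linear by an automorphism of
  \<open>D\<close>, because the centre of \<open>A\<close> is exactly \<open>D\<close>.
\<close>

subsection \<open>Ideals of subrings\<close>

text \<open>Being integer-valued on \<open>B\<close> demands values in \<open>B\<close>, not merely
  in \<open>M_n(D)\<close>. So a \<open>G\<close> that maps \<open>B\<close> into
  \<open>M_n(P)\<close> need not make \<open>t G\<close> integer-valued on \<open>B\<close>: the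
  values of \<open>t^N G^N\<close> are matrices over \<open>D\<close> that reach \<open>B\<close>
  only after multiplication by a denominator which a priori grows with \<open>N\<close>. The
  constant \<open>c\<close> is a denominator that serves all \<open>N\<close> at once, and almost
  integrality then discards it; determinants turn the matrices into scalars to which almost
  integrality applies. Since \<open>t\<close> behaves like the inverse of a uniformizer at
  \<open>P\<close>, the outcome is that \<open>det G(M)\<close> has valuation at least
  \<open>n\<close> at \<open>P\<close>. The two companion matrices yield the valuations
  \<open>0\<close> and \<open>n - 1\<close>, the second one missing the bound by exactly one. The
  polynomials \<open>G\<close> are products over finitely many reduced polynomials modulo
  \<open>P\<close>, which exist because the residue field is finite. Quotient rings are not formed
  as types. All arguments are congruences \<open>x - y \<in> I\<close> inside an ambient ring, so
  that one locale serves \<open>D\<close> with its ideals as well as polynomials over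
  \<open>D\<close> with theirs.\<close>

locale subring_ideal =
  fixes S I :: "'r::comm_ring_1 set"
  assumes S_zero: "0 \<in> S" and S_one: "1 \<in> S"
    and S_add: "x \<in> S \<Longrightarrow> y \<in> S \<Longrightarrow> x + y \<in> S"
    and S_uminus: "x \<in> S \<Longrightarrow> - x \<in> S"
    and S_mult: "x \<in> S \<Longrightarrow> y \<in> S \<Longrightarrow> x * y \<in> S"
    and I_subset: "I \<subseteq> S" and I_zero: "0 \<in> I"
    and I_add: "x \<in> I \<Longrightarrow> y \<in> I \<Longrightarrow> x + y \<in> I"
    and I_mult: "x \<in> S \<Longrightarrow> y \<in> I \<Longrightarrow> x * y \<in> I"
begin

lemma I_mult2: "x \<in> I \<Longrightarrow> y \<in> S \<Longrightarrow> x * y \<in> I"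
  using I_mult[of y x] by (simp add: mult.commute)

lemma S_diff: "x \<in> S \<Longrightarrow> y \<in> S \<Longrightarrow> x - y \<in> S"
  using S_add[of x "- y"] S_uminus by simp

lemma I_uminus: "x \<in> I \<Longrightarrow> - x \<in> I"
  using I_mult[of "-1" x] S_uminus[OF S_one] by simp

lemma I_diff: "x \<in> I \<Longrightarrow> y \<in> I \<Longrightarrow> x - y \<in> I"
  using I_add[of x "- y"] I_uminus by simp

lemma I_in_S: "x \<in> I \<Longrightarrow> x \<in> S"
  using I_subset by blast

lemma S_power: "x \<in> S \<Longrightarrow> x ^ k \<in> S"
  by (induction k) (auto simp: S_one S_mult)

lemma S_sum: "(\<And>x. x \<in> A \<Longrightarrow> f x \<in> S) \<Longrightarrow> sum f A \<in> S"
  by (induction A rule: infinite_finite_induct) (auto simp: S_zero S_add)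

lemma S_prod: "(\<And>x. x \<in> A \<Longrightarrow> f x \<in> S) \<Longrightarrow> prod f A \<in> S"
  by (induction A rule: infinite_finite_induct) (auto simp: S_one S_mult)

lemma I_sum: "(\<And>x. x \<in> A \<Longrightarrow> f x \<in> I) \<Longrightarrow> sum f A \<in> I"
  by (induction A rule: infinite_finite_induct) (auto simp: I_zero I_add)

lemma cong_sym: "x - y \<in> I \<Longrightarrow> y - x \<in> I"
  using I_uminus[of "x - y"] by simp

lemma cong_trans: "x - y \<in> I \<Longrightarrow> y - z \<in> I \<Longrightarrow> x - z \<in> I"
  using I_add[of "x - y" "y - z"] by simp

lemma cong_add: "x - x' \<in> I \<Longrightarrow> y - y' \<in> I \<Longrightarrow> (x + y) - (x' + y') \<in> I"
  using I_add[of "x - x'" "y - y'"] by (simp add: algebra_simps)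

lemma cong_mult:
  assumes "x - x' \<in> I" "y - y' \<in> I" "x \<in> S" "y' \<in> S"
  shows "x * y - x' * y' \<in> I"
proof -
  have "x * y - x' * y' = x * (y - y') + (x - x') * y'"
    by (simp add: algebra_simps)
  then show ?thesis
    using assms I_add I_mult I_mult2 by metis
qed

lemma cong_mem: "x - y \<in> I \<Longrightarrow> y \<in> I \<Longrightarrow> x \<in> I"
  using I_add[of "x - y" y] by simp

lemma cong_prod:
  assumes "\<And>x. x \<in> A \<Longrightarrow> f x \<in> S" "\<And>x. x \<in> A \<Longrightarrow> g x \<in> S"
    "\<And>x. x \<in> A \<Longrightarrow> f x - g x \<in> I"
  shows "prod f A - prod g A \<in> I"
  using assms
  by (induction A rule: infinite_finite_induct)
    (auto simp: I_zero intro!: cong_mult S_prod)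

lemma cong_power: "x - y \<in> I \<Longrightarrow> x \<in> S \<Longrightarrow> y \<in> S \<Longrightarrow> x ^ k - y ^ k \<in> I"
  using cong_prod[of "{..<k}" "\<lambda>_. x" "\<lambda>_. y"] by simp

text \<open>The assumption on binomial coefficients stands in for \<open>q\<close> being a power of
  the residue characteristic; it is all that the binomial expansion needs. For the order of the
  residue field, \<open>binomial_in_I\<close> supplies it.\<close>

lemma frobenius_add:
  assumes bin: "\<And>i. 0 < i \<Longrightarrow> i < q \<Longrightarrow> of_nat (q choose i) \<in> I" and q: "q > 0"
    and ab: "a \<in> S" "b \<in> S"
  shows "(a + b) ^ q - (a ^ q + b ^ q) \<in> I"
proof -
  have "{..q} = insert 0 (insert q {0<..<q})"
    using q by auto
  then have "(a + b) ^ q = a ^ q + b ^ q + (\<Sum>i\<in>{0<..<q}. of_nat (q choose i) * a ^ i * b ^ (q - i))"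
    using q by (simp add: binomial_ring algebra_simps)
  moreover have "(\<Sum>i\<in>{0<..<q}. of_nat (q choose i) * a ^ i * b ^ (q - i)) \<in> I"
    by (intro I_sum I_mult2 bin S_power ab) auto
  ultimately show ?thesis
    by simp
qed

lemma frobenius_power_add:
  assumes bin: "\<And>i. 0 < i \<Longrightarrow> i < q \<Longrightarrow> of_nat (q choose i) \<in> I" and q: "q > 0"
    and ab: "a \<in> S" "b \<in> S"
  shows "(a + b) ^ (q ^ k) - (a ^ (q ^ k) + b ^ (q ^ k)) \<in> I"
proof (induction k)
  case 0
  then show ?case by (simp add: I_zero)
next
  case (Suc k)
  have "((a + b) ^ (q ^ k)) ^ q - (a ^ (q ^ k) + b ^ (q ^ k)) ^ q \<in> I"
    by (intro cong_power Suc S_add S_power ab)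
  moreover have "(a ^ (q ^ k) + b ^ (q ^ k)) ^ q - ((a ^ (q ^ k)) ^ q + (b ^ (q ^ k)) ^ q) \<in> I"
    by (intro frobenius_add bin q S_power ab)
  ultimately show ?case
    using cong_trans by (simp add: power_mult[symmetric] mult.commute)
qed

lemma subring_ideal_change:
  assumes "J \<subseteq> S" "0 \<in> J" "\<And>x y. x \<in> J \<Longrightarrow> y \<in> J \<Longrightarrow> x + y \<in> J"
    "\<And>x y. x \<in> S \<Longrightarrow> y \<in> J \<Longrightarrow> x * y \<in> J"
  shows "subring_ideal S J"
  by (rule subring_ideal.intro) (fact S_zero S_one S_add S_uminus S_mult assms)+

lemma ideal_adjoin:
  fixes x
  defines "J \<equiv> {u * x + m | u m. u \<in> S \<and> m \<in> I}"
  assumes x: "x \<in> S"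
  shows "subring_ideal S J" "I \<subseteq> J" "x \<in> J"
proof -
  have Jadd: "a + b \<in> J" if ab: "a \<in> J" "b \<in> J" for a b
  proof -
    obtain u m u' m' where "a = u * x + m" "u \<in> S" "m \<in> I" "b = u' * x + m'" "u' \<in> S" "m' \<in> I"
      using ab by (auto simp: J_def)
    then have "a + b = (u + u') * x + (m + m')" "u + u' \<in> S" "m + m' \<in> I"
      by (auto simp: algebra_simps S_add I_add)
    then show ?thesis
      unfolding J_def by blast
  qed
  have Jmult: "s * a \<in> J" if sa: "s \<in> S" "a \<in> J" for s a
  proof -
    obtain u m where "a = u * x + m" "u \<in> S" "m \<in> I"
      using sa by (auto simp: J_def)
    then have "s * a = (s * u) * x + s * m" "s * u \<in> S" "s * m \<in> I"
      using sa I_mult by (auto simp: distrib_left mult.assoc S_mult)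
    then show ?thesis
      unfolding J_def by blast
  qed
  show IJ: "I \<subseteq> J"
  proof
    fix m assume "m \<in> I"
    then have "m = 0 * x + m \<and> 0 \<in> S \<and> m \<in> I"
      by (simp add: S_zero)
    then show "m \<in> J"
      unfolding J_def by blast
  qed
  have "x = 1 * x + 0"
    by simp
  then show "x \<in> J"
    unfolding J_def using S_one I_zero by blast
  have "J \<subseteq> S"
    using S_add[OF S_mult[OF _ x] I_in_S] by (auto simp: J_def)
  then show "subring_ideal S J"
    using IJ I_zero by (intro subring_ideal_change Jadd Jmult) auto
qed

text \<open>Zorn's lemma on the ideals above \<open>I\<close> that avoid 1. Maximality is delivered
  in the form in which it is used: adjoining an element outside \<open>M\<close> must bring in 1, so
  this element is invertible modulo \<open>M\<close>.\<close>

lemma ex_maximal_ideal: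
  assumes "1 \<notin> I"
  obtains M where "subring_ideal S M" "I \<subseteq> M" "1 \<notin> M"
    "\<And>x. x \<in> S \<Longrightarrow> x \<notin> M \<Longrightarrow> \<exists>u\<in>S. u * x - 1 \<in> M"
proof -
  define \<F> where "\<F> = {J. subring_ideal S J \<and> I \<subseteq> J \<and> 1 \<notin> J}"
  have "I \<in> \<F>"
    using assms subring_ideal_axioms by (simp add: \<F>_def)
  moreover have "\<Union>\<C> \<in> \<F>" if ne: "\<C> \<noteq> {}" and ch: "subset.chain \<F> \<C>" for \<C>
  proof -
    have sub: "\<And>J. J \<in> \<C> \<Longrightarrow> J \<in> \<F>" and lin: "\<And>J J'. J \<in> \<C> \<Longrightarrow> J' \<in> \<C> \<Longrightarrow> J \<subseteq> J' \<or> J' \<subseteq> J"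
      using ch by (auto simp: subset_chain_def)
    have id: "subring_ideal S J" if "J \<in> \<C>" for J
      using sub[OF that] by (simp add: \<F>_def)
    have add: "x + y \<in> \<Union>\<C>" if xy: "x \<in> \<Union>\<C>" "y \<in> \<Union>\<C>" for x y
    proof -
      obtain J J' where J: "J \<in> \<C>" "x \<in> J" "J' \<in> \<C>" "y \<in> J'"
        using xy by blast
      then obtain J'' where "J'' \<in> \<C>" "x \<in> J''" "y \<in> J''"
        using lin by blast
      then show ?thesis
        using subring_ideal.I_add[OF id] by blast
    qed
    have "subring_ideal S (\<Union>\<C>)"
    proof (rule subring_ideal_change)
      show "\<Union>\<C> \<subseteq> S"
        using subring_ideal.I_subset[OF id] by blast
      show "0 \<in> \<Union>\<C>"
        using subring_ideal.I_zero[OF id] ne by blast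
      show "x * y \<in> \<Union>\<C>" if "x \<in> S" "y \<in> \<Union>\<C>" for x y
        using subring_ideal.I_mult[OF id] that by blast
    qed (rule add)
    then show ?thesis
      using sub ne by (auto simp: \<F>_def)
  qed
  ultimately obtain M where M: "M \<in> \<F>" and max: "\<And>J. J \<in> \<F> \<Longrightarrow> M \<subseteq> J \<Longrightarrow> J = M"
    using subset_Zorn_nonempty[of \<F>] by blast
  interpret M: subring_ideal S M
    using M by (simp add: \<F>_def)
  show ?thesis
  proof
    show "\<exists>u\<in>S. u * x - 1 \<in> M" if x: "x \<in> S" "x \<notin> M" for x
    proof -
      define J where "J = {u * x + m | u m. u \<in> S \<and> m \<in> M}"
      have "subring_ideal S J" "M \<subseteq> J" "x \<in> J"
        unfolding J_def using M.ideal_adjoin[OF x(1)] by auto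
      then have "1 \<in> J"
        using max[of J] M x by (auto simp: \<F>_def)
      then obtain u m where "1 = u * x + m" "u \<in> S" "m \<in> M"
        by (auto simp: J_def)
      then have "u * x - 1 = - m" "u \<in> S"
        by (auto simp: algebra_simps)
      then show ?thesis
        using M.I_uminus[OF \<open>m \<in> M\<close>] by metis
    qed
  qed (use M in \<open>auto simp: \<F>_def\<close>)
qed

end

text \<open>\<open>T\<close> is a complete system of representatives, so \<open>card T\<close> is
  the order of the finite domain \<open>S/I\<close>. Besides the residue field of \<open>D\<close>,
  polynomials over \<open>D\<close> modulo a maximal ideal are an instance.\<close>

locale fin_prime_quotient = subring_ideal S I for S I :: "'r::idom set" +
  fixes T :: "'r set"
  assumes one_notin: "1 \<notin> I"
    and prime: "x \<in> S \<Longrightarrow> y \<in> S \<Longrightarrow> x * y \<in> I \<Longrightarrow> x \<in> I \<or> y \<in> I"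
    and T_finite: "finite T" and T_subset: "T \<subseteq> S"
    and T_ex: "x \<in> S \<Longrightarrow> \<exists>r\<in>T. x - r \<in> I"
    and T_unique: "r \<in> T \<Longrightarrow> r' \<in> T \<Longrightarrow> r - r' \<in> I \<Longrightarrow> r = r'"
begin

definition rep :: "'r \<Rightarrow> 'r" where
  "rep x = (SOME r. r \<in> T \<and> x - r \<in> I)"

lemma rep: "x \<in> S \<Longrightarrow> rep x \<in> T \<and> x - rep x \<in> I"
  using someI_ex[of "\<lambda>r. r \<in> T \<and> x - r \<in> I"] T_ex[of x] unfolding rep_def by blast

lemma power_in_I: "x \<in> S \<Longrightarrow> x ^ k \<in> I \<Longrightarrow> x \<in> I"
proof (induction k)
  case (Suc k)
  then show ?case
    using prime[of x "x ^ k"] S_power[of x k] by auto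
qed (simp add: one_notin)

lemma prod_notin:
  "(\<And>x. x \<in> A \<Longrightarrow> f x \<in> S \<and> f x \<notin> I) \<Longrightarrow> prod f A \<notin> I"
proof (induction A rule: infinite_finite_induct)
  case (insert x A)
  then have "f x \<in> S" "f x \<notin> I" "prod f A \<in> S" "prod f A \<notin> I"
    by (auto intro!: S_prod)
  then show ?case
    using insert prime[of "f x" "prod f A"] by auto
qed (auto simp: one_notin)

text \<open>For \<open>c\<close> outside \<open>I\<close>, multiplication by \<open>c\<close>
  permutes the nonzero residue classes. Comparing the product of all of them before and after gives
  \<open>c ^ card U = 1\<close> modulo \<open>I\<close>, where \<open>U\<close> omits the one
  representative of the zero class.\<close>

lemma fermat:
  assumes c: "c \<in> S"
  shows "c ^ card T - c \<in> I"
proof (cases "c \<in> I")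
  case True
  have "card T > 0"
    using T_finite T_ex[OF S_zero] by (auto simp: card_gt_0_iff)
  then have "c ^ card T = c * c ^ (card T - 1)"
    by (metis power_eq_if not_gr_zero)
  then show ?thesis
    using True I_diff[OF I_mult2[OF True S_power[OF c]] True] by simp
next
  case False
  define U where "U = {r \<in> T. r \<notin> I}"
  define \<sigma> where "\<sigma> r = rep (c * r)" for r
  have US: "r \<in> S" if "r \<in> U" for r
    using that T_subset by (auto simp: U_def)
  have rep_cr: "rep (c * r) \<in> T \<and> c * r - rep (c * r) \<in> I" if "r \<in> U" for r
    using rep[of "c * r"] c US[OF that] S_mult by blast
  have "\<sigma> ` U \<subseteq> U"
  proof (safe)
    fix r assume r: "r \<in> U"
    have "\<sigma> r \<notin> I"
    proof
      assume "\<sigma> r \<in> I"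
      then have "c * r \<in> I"
        using rep_cr[OF r] cong_mem by (auto simp: \<sigma>_def)
      then show False
        using prime[OF c US[OF r]] r False by (auto simp: U_def)
    qed
    then show "\<sigma> r \<in> U"
      using rep_cr[OF r] by (auto simp: U_def \<sigma>_def)
  qed
  moreover have "inj_on \<sigma> U"
  proof
    fix r r' assume r: "r \<in> U" "r' \<in> U" "\<sigma> r = \<sigma> r'"
    then have "c * r - c * r' \<in> I"
      using rep_cr[OF r(1)] rep_cr[OF r(2)] cong_trans cong_sym unfolding \<sigma>_def by metis
    then have "c * (r - r') \<in> I"
      by (simp add: algebra_simps)
    then have "r - r' \<in> I"
      using prime[OF c] S_diff US r False by blast
    then show "r = r'"
      using T_unique r by (auto simp: U_def)
  qed
  moreover have fU: "finite U"
    using T_finite by (simp add: U_def)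
  ultimately have "\<sigma> ` U = U"
    using endo_inj_surj by blast
  then have "(\<Prod>r\<in>U. r) = (\<Prod>r\<in>U. \<sigma> r)"
    using prod.reindex[OF \<open>inj_on \<sigma> U\<close>, of "\<lambda>x. x"] by simp
  moreover have "(\<Prod>r\<in>U. c * r) - (\<Prod>r\<in>U. \<sigma> r) \<in> I"
    using rep_cr T_subset c US S_mult by (intro cong_prod) (auto simp: \<sigma>_def)
  ultimately have "c ^ card U * \<Prod>U - \<Prod>U \<in> I"
    by (simp add: prod.distrib)
  then have "(c ^ card U - 1) * \<Prod>U \<in> I"
    by (simp add: algebra_simps)
  moreover have "\<Prod>U \<notin> I"
    by (rule prod_notin) (use US in \<open>auto simp: U_def\<close>)
  ultimately have "c ^ card U - 1 \<in> I"
    using prime[of "c ^ card U - 1" "\<Prod>U"] S_diff[OF S_power[OF c] S_one]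
      S_prod[of U "\<lambda>x. x", OF US] by blast
  then have "c * (c ^ card U - 1) \<in> I"
    using I_mult c by blast
  moreover have "card T = Suc (card U)"
  proof -
    obtain r0 where r0: "r0 \<in> T" "0 - r0 \<in> I"
      using T_ex[OF S_zero] by blast
    then have "r0 \<in> I"
      using I_uminus by fastforce
    then have "T = insert r0 U" "r0 \<notin> U"
      using r0 T_unique I_diff by (auto simp: U_def)
    then show ?thesis
      using fU by simp
  qed
  ultimately show ?thesis
    by (simp add: algebra_simps)
qed

lemma card_T_ge_2: "card T \<ge> 2"
proof -
  obtain r s where rs: "r \<in> T" "s \<in> T" "0 - r \<in> I" "1 - s \<in> I"
    using T_ex[OF S_zero] T_ex[OF S_one] by blast
  have "r \<noteq> s"
  proof
    assume "r = s"
    then have "1 - 0 \<in> I"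
      using rs cong_trans cong_sym by metis
    then show False using one_notin by simp
  qed
  then have "card {r, s} \<le> card T"
    using rs T_finite by (intro card_mono) auto
  then show ?thesis
    using \<open>r \<noteq> s\<close> by simp
qed

text \<open>By Fermat's congruence \<open>c ^ (card T - 2)\<close> is an inverse; the subtraction is
  not truncated, because the quotient has at least two elements.\<close>

lemma inverse_ex:
  assumes c: "c \<in> S" "c \<notin> I"
  shows "\<exists>u\<in>S. u * c - 1 \<in> I"
proof -
  have "card T = Suc (Suc (card T - 2))"
    using card_T_ge_2 by simp
  then have "c ^ card T = c * (c ^ (card T - 2) * c)"
    by (metis power_Suc power_Suc2)
  then have "c * (c ^ (card T - 2) * c - 1) \<in> I"
    using fermat[OF c(1)] by (simp add: algebra_simps)
  then have "c ^ (card T - 2) * c - 1 \<in> I"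
    using prime[OF c(1)] c(2) S_diff[OF S_mult[OF S_power[OF c(1)] c(1)] S_one] by blast
  then show ?thesis
    using S_power[OF c(1)] by blast
qed

end

subsection \<open>Polynomials with coefficients in a subring\<close>

definition poly_over :: "'r::comm_ring_1 set \<Rightarrow> 'r poly set" where
  "poly_over S = {f. \<forall>i. coeff f i \<in> S}"

lemma poly_over_coeff: "f \<in> poly_over S \<Longrightarrow> coeff f i \<in> S"
  by (simp add: poly_over_def)

context subring_ideal
begin

lemma poly_over_0: "0 \<in> poly_over S" and poly_over_1: "1 \<in> poly_over S"
  using S_zero S_one by (auto simp: poly_over_def)

lemma poly_over_add: "f \<in> poly_over S \<Longrightarrow> g \<in> poly_over S \<Longrightarrow> f + g \<in> poly_over S"
  by (auto simp: poly_over_def S_add)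

lemma poly_over_diff: "f \<in> poly_over S \<Longrightarrow> g \<in> poly_over S \<Longrightarrow> f - g \<in> poly_over S"
  by (auto simp: poly_over_def S_diff)

lemma poly_over_mult: "f \<in> poly_over S \<Longrightarrow> g \<in> poly_over S \<Longrightarrow> f * g \<in> poly_over S"
  by (auto simp: poly_over_def coeff_mult intro!: S_sum S_mult)

lemma poly_over_monom: "c \<in> S \<Longrightarrow> monom c k \<in> poly_over S"
  by (auto simp: poly_over_def S_zero)

lemma poly_over_pCons: "pCons c f \<in> poly_over S \<longleftrightarrow> c \<in> S \<and> f \<in> poly_over S"
proof
  assume *: "pCons c f \<in> poly_over S"
  show "c \<in> S \<and> f \<in> poly_over S"
    using poly_over_coeff[OF *, of 0] poly_over_coeff[OF *, of "Suc _"]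
    by (auto simp: poly_over_def)
qed (auto simp: poly_over_def coeff_pCons split: nat.split)

lemma poly_over_smult: "c \<in> S \<Longrightarrow> f \<in> poly_over S \<Longrightarrow> Polynomial.smult c f \<in> poly_over S"
  by (auto simp: poly_over_def S_mult)

lemma poly_eval_in: "f \<in> poly_over S \<Longrightarrow> x \<in> S \<Longrightarrow> poly f x \<in> S"
  by (auto simp: poly_altdef intro!: S_sum S_mult S_power poly_over_coeff)

lemma subring_ideal_poly_over: "subring_ideal (poly_over S) (poly_over I)"
proof unfold_locales
  show "x * y \<in> poly_over I" if "x \<in> poly_over S" "y \<in> poly_over I" for x y
    using that by (auto simp: poly_over_def coeff_mult intro!: I_sum I_mult)
qed (auto simp: poly_over_0 poly_over_1 poly_over_add poly_over_mult,
    auto simp: poly_over_def S_uminus I_in_S I_zero I_add)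

text \<open>Bounding the remainder by vanishing coefficients rather than by its degree covers
  constant \<open>h\<close>, where the remainder has to be zero.\<close>

lemma monic_division:
  assumes h: "h \<in> poly_over S" "lead_coeff h = 1" and f: "f \<in> poly_over S"
  obtains w r where "w \<in> poly_over S" "r \<in> poly_over S" "f = w * h + r"
    "\<And>i. i \<ge> degree h \<Longrightarrow> coeff r i = 0"
proof -
  have "\<exists>w\<in>poly_over S. \<exists>r\<in>poly_over S. f = w * h + r \<and> (\<forall>i\<ge>degree h. coeff r i = 0)"
    if "\<forall>i\<ge>k. coeff f i = 0" for k
    using that f
  proof (induction k arbitrary: f)
    case 0
    then have "f = 0"
      by (intro poly_eqI) simp
    then show ?case
      using poly_over_0 by (intro bexI[of _ 0]) auto
  next
    case (Suc k)
    show ?case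
    proof (cases "k < degree h")
      case True
      then show ?thesis
        using Suc.prems poly_over_0 by (intro bexI[of _ 0] bexI[of _ f]) auto
    next
      case False
      define m where "m = monom (coeff f k) (k - degree h)"
      have m: "m \<in> poly_over S"
        using Suc.prems by (auto simp: m_def intro!: poly_over_monom poly_over_coeff)
      have co: "coeff (m * h) i = (if i < k - degree h then 0 else coeff f k * coeff h (i - (k - degree h)))" for i
        by (simp add: m_def coeff_monom_mult)
      have "coeff (f - m * h) i = 0" if "i \<ge> k" for i
      proof (cases "i = k")
        case True
        then show ?thesis using False h by (simp add: co)
      next
        case neq: False
        then have "i \<ge> Suc k" "i - (k - degree h) > degree h"
          using that False by auto
        then show ?thesis
          using Suc.prems by (simp add: co coeff_eq_0)
      qed
      then obtain w r where wr: "w \<in> poly_over S" "r \<in> poly_over S" "f - m * h = w * h + r"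
        "\<forall>i\<ge>degree h. coeff r i = 0"
        using Suc.IH[of "f - m * h"] poly_over_diff[OF Suc.prems(2) poly_over_mult[OF m h(1)]] by blast
      then have "f = (w + m) * h + r"
        by (simp add: algebra_simps)
      then show ?thesis
        using wr poly_over_add[OF wr(1) m] by blast
    qed
  qed
  then show ?thesis
    using that coeff_eq_0 by (metis Suc_le_lessD)
qed

text \<open>A nonzero leading term of \<open>u\<close> modulo \<open>I\<close> would be carried by
  the monic \<open>h\<close> into a degree that is at least \<open>degree h\<close>. The induction
  runs downwards through \<open>u\<close>, with \<open>k\<close> counting the top coefficients
  already known to lie in \<open>I\<close>.\<close>

lemma mult_monic_cong:
  assumes h: "h \<in> poly_over S" "lead_coeff h = 1" and u: "u \<in> poly_over S"
    and c: "\<And>i. i \<ge> degree h \<Longrightarrow> coeff (u * h) i \<in> I"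
  shows "u \<in> poly_over I"
proof -
  have "coeff u i \<in> I" if "i \<ge> Suc (degree u) - k" for i k
    using that
  proof (induction k arbitrary: i)
    case 0
    then show ?case by (simp add: coeff_eq_0 I_zero)
  next
    case (Suc k)
    have "(\<Sum>j\<in>{..i + degree h} - {i}. coeff u j * coeff h (i + degree h - j)) \<in> I"
    proof (rule I_sum)
      fix j assume j: "j \<in> {..i + degree h} - {i}"
      show "coeff u j * coeff h (i + degree h - j) \<in> I"
      proof (cases "j < i")
        case True
        then show ?thesis by (simp add: coeff_eq_0 I_zero)
      next
        case False
        then have "coeff u j \<in> I"
          using j Suc by auto
        then show ?thesis
          using I_mult2 h poly_over_coeff by blast
      qed
    qed
    moreover have "coeff (u * h) (i + degree h) =
        coeff u i + (\<Sum>j\<in>{..i + degree h} - {i}. coeff u j * coeff h (i + degree h - j))"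
      using h by (simp add: coeff_mult sum.remove[of _ i])
    ultimately have "coeff u i = coeff (u * h) (i + degree h) - (\<Sum>j\<in>{..i + degree h} - {i}. coeff u j * coeff h (i + degree h - j))"
      by simp
    then show ?case
      using I_diff c[of "i + degree h"] \<open>(\<Sum>j\<in>{..i + degree h} - {i}. _) \<in> I\<close> by simp
  qed
  from this[where k = "Suc (degree u)"] show ?thesis
    by (simp add: poly_over_def)
qed

end

subsection \<open>Irreducible polynomials over a finite residue field\<close>

lemma (in subring_ideal) synthetic_div_over:
  "f \<in> poly_over S \<Longrightarrow> c \<in> S \<Longrightarrow> synthetic_div f c \<in> poly_over S"
  by (induction f) (auto simp: poly_over_0 poly_over_pCons poly_eval_in)

section \<open>Roots and the Frobenius map over a finite residue ring\<close>

context fin_prime_quotient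
begin

text \<open>Synthetic division at \<open>a\<close> leaves a quotient \<open>g\<close> of smaller
  degree that still vanishes modulo \<open>I\<close> on the other elements of \<open>A\<close>,
  because \<open>x - a\<close> can be cancelled modulo the prime ideal.\<close>

lemma root_count:
  assumes "finite A" "A \<subseteq> S" "\<And>x y. x \<in> A \<Longrightarrow> y \<in> A \<Longrightarrow> x - y \<in> I \<Longrightarrow> x = y"
    "f \<in> poly_over S" "\<And>x. x \<in> A \<Longrightarrow> poly f x \<in> I" "degree f < card A"
  shows "f \<in> poly_over I"
  using assms
proof (induction A arbitrary: f rule: finite_induct)
  case empty
  then show ?case by simp
next
  case (insert a A)
  define g where "g = synthetic_div f a"
  have a: "a \<in> S"
    using insert.prems by simp
  have f: "f = [:-a, 1:] * g + [:poly f a:]"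
    using synthetic_div_correct'[of a f] by (simp add: g_def)
  have g: "g \<in> poly_over S"
    using synthetic_div_over[OF insert.prems(3) a] by (simp add: g_def)
  have fa: "poly f a \<in> I"
    using insert.prems by simp
  have "g \<in> poly_over I"
  proof (cases "degree f = 0")
    case True
    then have "g = 0"
      by (simp add: g_def synthetic_div_eq_0_iff)
    then show ?thesis
      by (simp add: poly_over_def I_zero)
  next
    case False
    have "poly g x \<in> I" if x: "x \<in> A" for x
    proof -
      have "poly f x = (x - a) * poly g x + poly f a"
        by (subst f) (simp add: algebra_simps)
      moreover have "poly f x \<in> I"
        using insert.prems x by simp
      ultimately have "(x - a) * poly g x \<in> I"
        using I_diff[OF _ fa] by fastforce
      moreover have "x - a \<notin> I"
        using insert.prems(2)[of x a] insert.hyps x by auto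
      moreover have "x \<in> S"
        using insert.prems x by auto
      ultimately show ?thesis
        using prime[OF S_diff[OF _ a] poly_eval_in[OF g]] by blast
    qed
    moreover have "degree g < card A"
      using False insert.prems insert.hyps by (simp add: g_def degree_synthetic_div)
    ultimately show ?thesis
      using insert.IH[of g] insert.prems g by auto
  qed
  moreover have "coeff f i = (if i = 0 then poly f a else coeff g (i - 1)) - a * coeff g i" for i
    by (subst f) (simp add: coeff_pCons algebra_simps split: nat.split)
  ultimately show ?case
    using fa a by (auto simp: poly_over_def intro!: I_diff I_mult)
qed

text \<open>The polynomial \<open>(X + 1)^q - X^q - 1\<close> has degree below \<open>q\<close>, but
  by Fermat it vanishes at all \<open>q\<close> residue classes. Hence its coefficients lie in
  \<open>I\<close>, with no appeal to the characteristic or to \<open>q\<close> being a prime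
  power.\<close>

lemma binomial_in_I:
  assumes i: "0 < i" "i < card T"
  shows "of_nat (card T choose i) \<in> I"
proof -
  define q where "q = card T"
  define f :: "'r poly" where "f = (\<Sum>i\<in>{0<..<q}. monom (of_nat (q choose i)) i)"
  have q: "q \<ge> 2"
    using card_T_ge_2 by (simp add: q_def)
  have of_nat_S: "of_nat k \<in> S" for k
    by (induction k) (auto simp: S_zero S_one S_add)
  have cf: "coeff f i = (if 0 < i \<and> i < q then of_nat (q choose i) else 0)" for i
    by (auto simp: f_def coeff_sum)
  have "degree f < q"
    using q by (intro order.strict_trans1[OF degree_le[of "q - 1"]]) (auto simp: cf)
  moreover have "f \<in> poly_over S"
    by (auto simp: poly_over_def cf of_nat_S S_zero)
  moreover have "poly f x \<in> I" if x: "x \<in> T" for x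
  proof -
    have xS: "x \<in> S"
      using x T_subset by auto
    have "{..q} = insert 0 (insert q {0<..<q})"
      using q by auto
    then have "(\<Sum>i\<le>q. of_nat (q choose i) * x ^ i) = x ^ q + 1 + poly f x"
      using q by (simp add: f_def poly_sum poly_monom algebra_simps)
    then have "(x + 1) ^ q = x ^ q + 1 + poly f x"
      using binomial_ring[of x 1 q] by simp
    then have "poly f x = ((x + 1) ^ q - (x + 1)) - (x ^ q - x)"
      by simp
    moreover have "((x + 1) ^ q - (x + 1)) - (x ^ q - x) \<in> I"
      unfolding q_def by (intro I_diff fermat S_add S_one xS)
    ultimately show ?thesis
      by (simp only:)
  qed
  ultimately have "f \<in> poly_over I"
    using T_finite T_subset T_unique by (intro root_count[of T]) (auto simp: q_def)
  then show ?thesis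
    using i poly_over_coeff[of f I i] by (simp add: cf q_def)
qed

lemma fermat_power: "c \<in> S \<Longrightarrow> c ^ (card T ^ k) - c \<in> I"
proof (induction k)
  case 0
  then show ?case by (simp add: I_zero)
next
  case (Suc k)
  have "(c ^ (card T ^ k)) ^ card T - c ^ card T \<in> I"
    using Suc by (intro cong_power S_power) auto
  then show ?case
    using cong_trans[OF _ fermat[OF Suc.prems]] by (simp add: power_mult[symmetric] mult.commute)
qed

end

text \<open>Representatives of the polynomials of degree below \<open>m\<close> over the residue
  field. Bounding by coefficients admits 0 for every \<open>m\<close>, so that their number is
  exactly \<open>card T ^ m\<close>.\<close>

definition polys_below :: "'r::zero set \<Rightarrow> nat \<Rightarrow> 'r poly set" where
  "polys_below T m = {f. (\<forall>i. coeff f i \<in> T) \<and> (\<forall>i\<ge>m. coeff f i = 0)}"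

lemma polys_below_card:
  assumes T: "finite T" "0 \<in> T"
  shows "finite (polys_below T m) \<and> card (polys_below T m) = card T ^ m"
proof (induction m)
  case 0
  have "polys_below T 0 = {0}"
    using T by (auto simp: polys_below_def intro: poly_eqI)
  then show ?case by simp
next
  case (Suc m)
  have "polys_below T (Suc m) = (\<lambda>(c, f). pCons c f) ` (T \<times> polys_below T m)"
  proof (intro Set.set_eqI iffI)
    fix f assume f: "f \<in> polys_below T (Suc m)"
    obtain c g where fg: "f = pCons c g"
      by (cases f) auto
    have "c \<in> T" "g \<in> polys_below T m"
    proof -
      have *: "coeff f 0 \<in> T" "coeff f (Suc i) \<in> T" "i \<ge> m \<Longrightarrow> coeff f (Suc i) = 0" for i
        using f by (auto simp: polys_below_def)
      show "c \<in> T" "g \<in> polys_below T m"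
        using * by (auto simp: fg polys_below_def)
    qed
    then show "f \<in> (\<lambda>(c, f). pCons c f) ` (T \<times> polys_below T m)"
      using fg by force
  qed (auto simp: polys_below_def coeff_pCons split: nat.split)
  moreover have "inj_on (\<lambda>(c, f). pCons c f) (T \<times> polys_below T m)"
    by (auto simp: inj_on_def)
  ultimately show ?case
    using Suc T by (simp add: card_image card_cartesian_product)
qed

text \<open>Requiring 0 and 1 themselves to be representatives makes reduction of coefficients
  preserve zero coefficients and monic leading coefficients, hence the degree of a monic
  polynomial.\<close>

locale residue_field = fin_prime_quotient D P T for D P T :: "'k::field set" +
  assumes T_zero: "0 \<in> T" and T_one: "1 \<in> T"
begin

sublocale X: subring_ideal "poly_over D" "poly_over P"
  by (rule subring_ideal_poly_over)

lemma rep_in_I: "x \<in> T \<Longrightarrow> x \<in> P \<Longrightarrow> x = 0"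
  using T_unique[OF _ T_zero, of x] by simp

lemma ex_reduced_poly:
  assumes f: "f \<in> poly_over D"
  obtains g where "f - g \<in> poly_over P" "\<And>i. coeff g i \<in> T" "\<And>i. coeff f i = 0 \<Longrightarrow> coeff g i = 0"
    "\<And>i. coeff f i = 1 \<Longrightarrow> coeff g i = 1"
proof
  have rep0: "rep 0 = 0"
    using rep[OF S_zero] rep_in_I I_uminus[of "0 - rep 0"] by auto
  have rep1: "rep 1 = 1"
    using rep[OF S_one] T_unique[OF T_one] by auto
  have c: "coeff (map_poly rep f) i = rep (coeff f i)" for i
    by (simp add: coeff_map_poly rep0)
  show "f - map_poly rep f \<in> poly_over P"
    using rep f by (auto simp: poly_over_def c)
  show "coeff (map_poly rep f) i \<in> T" for i
    using rep f by (auto simp: poly_over_def c)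
  show "coeff (map_poly rep f) i = 0" if "coeff f i = 0" for i
    using that by (simp add: c rep0)
  show "coeff (map_poly rep f) i = 1" if "coeff f i = 1" for i
    using that by (simp add: c rep1)
qed

lemma const_in: "c \<in> P \<Longrightarrow> [:c:] \<in> poly_over P"
  by (auto simp: poly_over_def coeff_pCons I_zero split: nat.split)

lemma X_in: "monom 1 k \<in> poly_over D"
  by (rule poly_over_monom[OF S_one])

text \<open>Modulo \<open>J\<close>, raising to the power \<open>card T ^ k\<close> is additive and
  multiplicative, fixes constants by Fermat and fixes \<open>X\<close> by assumption. So it fixes
  every polynomial.\<close>

lemma frobenius_fixes:
  assumes J: "subring_ideal (poly_over D) J" "poly_over P \<subseteq> J"
    and X: "monom 1 (card T ^ k) - monom 1 1 \<in> J" and f: "f \<in> poly_over D"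
  shows "f ^ (card T ^ k) - f \<in> J"
  using f
proof (induction f)
  case 0
  have "card T ^ k > 0"
    using card_T_ge_2 by simp
  then show ?case
    using subring_ideal.I_zero[OF J(1)] card_T_ge_2 by (auto simp: power_0_left)
next
  case (pCons c f)
  define q where "q = card T"
  interpret J: subring_ideal "poly_over D" J
    by (rule J(1))
  have c: "c \<in> D" and f: "f \<in> poly_over D"
    using pCons.prems by (auto simp: poly_over_pCons)
  have cX: "[:c:] \<in> poly_over D" and Xf: "monom 1 1 * f \<in> poly_over D"
    using c f by (auto simp: poly_over_pCons poly_over_0 intro!: poly_over_mult X_in)
  have eq: "pCons c f = [:c:] + monom 1 1 * f"
    by (simp add: monom_Suc one_pCons[symmetric])
  have 1: "pCons c f ^ (q ^ k) - ([:c:] ^ (q ^ k) + (monom 1 1 * f) ^ (q ^ k)) \<in> J"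
    unfolding eq
  proof (rule J.frobenius_power_add[OF _ _ cX Xf])
    show "of_nat (q choose i) \<in> J" if "0 < i" "i < q" for i
      using binomial_in_I[of i] that J(2) const_in by (auto simp: q_def of_nat_poly)
    show "0 < q"
      using card_T_ge_2 by (simp add: q_def)
  qed
  have "[:c:] ^ (q ^ k) - [:c:] = [:c ^ (q ^ k) - c:]"
    by (simp add: poly_const_pow)
  then have 2: "[:c:] ^ (q ^ k) - [:c:] \<in> J"
    using fermat_power[OF c, of k] const_in J(2) by (auto simp: q_def)
  have "(monom 1 1 * f) ^ (q ^ k) = monom 1 (q ^ k) * f ^ (q ^ k)"
    by (simp add: power_mult_distrib monom_power)
  moreover have "monom 1 (q ^ k) * f ^ (q ^ k) - monom 1 1 * f \<in> J"
    using X pCons.IH[OF f] by (intro J.cong_mult X_in f) (auto simp: q_def)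
  ultimately have 3: "(monom 1 1 * f) ^ (q ^ k) - monom 1 1 * f \<in> J"
    by simp
  have "[:c:] ^ (q ^ k) + (monom 1 1 * f) ^ (q ^ k) - pCons c f \<in> J"
    unfolding eq by (rule J.cong_add[OF 2 3])
  then show ?case
    using J.cong_trans[OF 1] by (simp add: q_def)
qed

text \<open>\<open>h\<close> is a monic element of least degree in a maximal ideal \<open>M\<close>
  of the polynomial ring, with \<open>M\<close> chosen such that the quotient has exactly
  \<open>q ^ n\<close> elements. The degree of \<open>h\<close> is then read off by
  counting.\<close>

lemma ex_irreducible_mod:
  assumes n: "n \<ge> 1"
  obtains h where "h \<in> poly_over D" "degree h = n" "lead_coeff h = 1"
    "\<And>g. g \<in> poly_over D \<Longrightarrow> (\<And>i. i \<ge> n \<Longrightarrow> coeff g i = 0) \<Longrightarrow> g \<notin> poly_over P \<Longrightarrow>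
      \<exists>u\<in>poly_over D. \<exists>w\<in>poly_over D. u * g - 1 - w * h \<in> poly_over P"
proof -
  define q where "q = card T"
  define N where "N = q ^ n"
  \<comment> \<open>The field to be found is one in which \<open>X\<close> is a root of
    \<open>w n\<close> but of no \<open>w d\<close> with \<open>1 \<le> d < n\<close>. The product
    \<open>y\<close> collects the latter; its degree stays below \<open>N\<close>, the degree of
    \<open>w n\<close>.\<close>
  define w where "w d = (monom 1 (q ^ d) - monom 1 1 :: 'k poly)" for d
  define y where "y = (\<Prod>d\<in>{1..<n}. w d)"
  define e where "e = y ^ (N - 1)"
  have q: "q \<ge> 2"
    using card_T_ge_2 by (simp add: q_def)
  have qd: "q ^ d \<ge> 2" if "d \<ge> 1" for d
    using that q by (metis Suc_1 One_nat_def less_eq_Suc_le one_less_power not_less_eq_eq order.strict_trans2 zero_less_iff_neq_zero not_one_le_zero)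
  have wD: "w d \<in> poly_over D" for d
    by (auto simp: w_def intro!: poly_over_diff X_in)
  have wdeg: "degree (w d) = q ^ d" "lead_coeff (w d) = 1" if "d \<ge> 1" for d
  proof -
    have c: "coeff (w d) i = (if i = q ^ d then 1 else if i = 1 then - 1 else 0)" for i
      using qd[OF that] by (auto simp: w_def)
    show "degree (w d) = q ^ d"
      using qd[OF that] by (intro antisym degree_le le_degree) (auto simp: c)
    then show "lead_coeff (w d) = 1"
      by (simp add: c)
  qed
  have yD: "y \<in> poly_over D"
    unfolding y_def by (intro X.S_prod wD)
  have ylc: "lead_coeff y = 1"
    unfolding y_def lead_coeff_prod by (intro prod.neutral ballI wdeg(2)) auto
  have ydeg: "degree y < N"
  proof -
    have "degree y = (\<Sum>d\<in>{1..<n}. q ^ d)"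
      unfolding y_def
    proof (subst degree_prod_eq_sum_degree)
      have "w d \<noteq> 0" if "d \<ge> 1" for d
        using wdeg(2)[OF that] by auto
      then show "\<forall>d\<in>{1..<n}. w d \<noteq> 0"
        by simp
    qed (simp add: wdeg)
    also have "\<dots> \<le> (\<Sum>d<n. q ^ d)"
      by (intro sum_mono2) auto
    also have "\<dots> < q ^ n"
    proof (induction n)
      case (Suc n)
      then have "(\<Sum>d<Suc n. q ^ d) < 2 * q ^ n"
        by simp
      also have "\<dots> \<le> q ^ Suc n"
        using q by simp
      finally show ?case .
    qed simp
    finally show ?thesis
      by (simp add: N_def)
  qed
  define J0 where "J0 = {u * w n + m | u m. u \<in> poly_over D \<and> m \<in> poly_over P}"
  have J0: "subring_ideal (poly_over D) J0" "poly_over P \<subseteq> J0" "w n \<in> J0"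
    unfolding J0_def by (rule X.ideal_adjoin[OF wD])+
  interpret J0: subring_ideal "poly_over D" J0
    by (rule J0(1))
  \<comment> \<open>Modulo \<open>J0\<close> the power map with exponent \<open>N\<close> is the
    identity, so \<open>e\<close> is an idempotent with \<open>y * e = y\<close>. Adjoining
    \<open>1 - e\<close> forces any proper ideal above to avoid \<open>y\<close>, and thereby all
    the factors \<open>w d\<close>.\<close>
  define J1 where "J1 = {u * (1 - e) + m | u m. u \<in> poly_over D \<and> m \<in> J0}"
  have eD: "1 - e \<in> poly_over D"
    by (auto simp: e_def intro!: X.S_diff X.S_power yD poly_over_1)
  have J1: "subring_ideal (poly_over D) J1" "J0 \<subseteq> J1" "1 - e \<in> J1"
    unfolding J1_def by (rule J0.ideal_adjoin[OF eD])+
  \<comment> \<open>Otherwise, multiplying by \<open>y\<close> would put \<open>y\<close> into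
    \<open>J0\<close>, that is, make it a multiple of \<open>w n\<close> modulo \<open>P\<close>. A
    monic polynomial of smaller degree cannot be one.\<close>
  have "1 \<notin> J1"
  proof
    assume "1 \<in> J1"
    then obtain v m where vm: "1 = v * (1 - e) + m" "v \<in> poly_over D" "m \<in> J0"
      by (auto simp: J1_def)
    have "N > 0"
      using q by (simp add: N_def)
    then have "y * e = y ^ N"
      unfolding e_def by (metis power_eq_if not_gr_zero)
    moreover have "y ^ N - y \<in> J0"
      unfolding N_def q_def using J0 by (intro frobenius_fixes yD) (auto simp: w_def q_def)
    ultimately have "y * (1 - e) \<in> J0"
      using J0.I_uminus by (fastforce simp: algebra_simps)
    then have "v * (y * (1 - e)) + y * m \<in> J0"
      using J0.I_add[OF J0.I_mult[OF vm(2)] J0.I_mult[OF yD vm(3)]] by blast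
    moreover have "y * (v * (1 - e) + m) = v * (y * (1 - e)) + y * m"
      by (simp only: algebra_simps)
    ultimately have "y \<in> J0"
      using vm(1) by (metis mult.right_neutral)
    then obtain u p where up: "y = u * w n + p" "u \<in> poly_over D" "p \<in> poly_over P"
      by (auto simp: J0_def)
    have "u \<in> poly_over P"
    proof (rule mult_monic_cong[OF wD[of n] wdeg(2)[OF n] up(2)])
      fix i assume "i \<ge> degree (w n)"
      then have "coeff y i = 0"
        using ydeg wdeg(1)[OF n] by (intro coeff_eq_0) (simp add: N_def)
      then have "coeff (u * w n) i = - coeff p i"
        by (simp add: up(1) eq_neg_iff_add_eq_0)
      then show "coeff (u * w n) i \<in> P"
        using I_uminus[OF poly_over_coeff[OF up(3)]] by simp
    qed
    then have "y \<in> poly_over P"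
      unfolding up(1) by (intro X.I_add X.I_mult2 up wD)
    then have "lead_coeff y \<in> P"
      by (rule poly_over_coeff)
    then show False
      using one_notin ylc by simp
  qed
  then obtain M where M: "subring_ideal (poly_over D) M" "J1 \<subseteq> M" "1 \<notin> M"
    and Minv: "\<And>x. x \<in> poly_over D \<Longrightarrow> x \<notin> M \<Longrightarrow> \<exists>u\<in>poly_over D. u * x - 1 \<in> M"
    using subring_ideal.ex_maximal_ideal[OF J1(1)] by metis
  interpret M: subring_ideal "poly_over D" M
    by (rule M(1))
  have PM: "poly_over P \<subseteq> M" and wM: "w n \<in> M" and eM: "1 - e \<in> M"
    using J0 J1 M by auto
  have wdM: "w d \<notin> M" if d: "1 \<le> d" "d < n" for d
  proof
    assume "w d \<in> M"
    then have "y \<in> M"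
      unfolding y_def using d by (subst prod.remove[of _ d]) (auto intro!: M.I_mult2 X.S_prod wD)
    have "N \<ge> 2"
      using qd[OF n] by (simp add: N_def)
    then have "e = y * y ^ (N - 2)"
      unfolding e_def by (metis Suc_1 Suc_diff_Suc Suc_le_lessD diff_Suc_1 plus_1_eq_Suc power_Suc One_nat_def)
    then have "e \<in> M"
      using M.I_mult2[OF \<open>y \<in> M\<close> X.S_power[OF yD]] by simp
    then show False
      using M.I_add[OF eM] M(3) by fastforce
  qed
  define Q where "Q m \<longleftrightarrow> (\<exists>h\<in>M. degree h = m \<and> lead_coeff h = 1)" for m
  define m where "m = (LEAST m. Q m)"
  have "Q N"
    using wM wdeg[OF n] by (auto simp: Q_def N_def)
  then have "Q m" and least: "\<And>k. k < m \<Longrightarrow> \<not> Q k"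
    unfolding m_def by (auto intro: LeastI dest: not_less_Least)
  then obtain h where h: "h \<in> M" "degree h = m" "lead_coeff h = 1"
    by (auto simp: Q_def)
  have hD: "h \<in> poly_over D"
    using h M.I_in_S by auto
  \<comment> \<open>Dropping the coefficients above the last one outside \<open>P\<close> and
    scaling that one to 1 changes \<open>g\<close> only within \<open>M\<close>, and would produce a
    monic element of degree \<open>i < m\<close>.\<close>
  have below: "g \<in> poly_over P" if gM: "g \<in> M" and gm: "\<And>i. i \<ge> m \<Longrightarrow> coeff g i = 0" for g
  proof (rule ccontr)
    assume "g \<notin> poly_over P"
    then have ex: "\<exists>i. coeff g i \<notin> P"
      by (auto simp: poly_over_def)
    have bd: "i < m" if "coeff g i \<notin> P" for i
      using that gm[of i] I_zero by (cases "i < m") auto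
    define i where "i = (GREATEST i. coeff g i \<notin> P)"
    have i: "coeff g i \<notin> P"
      unfolding i_def using ex less_imp_le[OF bd]
      by (rule GreatestI_ex_nat[of "\<lambda>i. coeff g i \<notin> P" m])
    have imax: "j \<le> i" if "coeff g j \<notin> P" for j
      unfolding i_def using that less_imp_le[OF bd]
      by (rule Greatest_le_nat[of "\<lambda>i. coeff g i \<notin> P" _ m])
    have gD: "g \<in> poly_over D"
      using gM M.I_in_S by auto
    then obtain u where u: "u \<in> D" "u * coeff g i - 1 \<in> P"
      using inverse_ex[OF poly_over_coeff i] by blast
    define r where "r = Abs_poly (\<lambda>j. if j < i then 0 else if j = i then u * coeff g i - 1 else u * coeff g j)"
    have cr: "coeff r j = (if j < i then 0 else if j = i then u * coeff g i - 1 else u * coeff g j)" for j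
      unfolding r_def by (subst coeff_Abs_poly[of "max i m"]) (auto simp: gm)
    have "coeff r j \<in> P" for j
      using u imax[of j] I_mult[of u "coeff g j"] by (cases "coeff g j \<in> P") (auto simp: cr I_zero)
    then have "r \<in> poly_over P"
      by (simp add: poly_over_def)
    define g' where "g' = [:u:] * g - r"
    have "g' \<in> M"
      unfolding g'_def using \<open>r \<in> poly_over P\<close> PM u gM
      by (intro M.I_diff M.I_mult) (auto simp: poly_over_pCons poly_over_0)
    have cg': "coeff g' j = (if j < i then u * coeff g j else if j = i then 1 else 0)" for j
      by (simp add: g'_def cr)
    have "degree g' = i"
      by (intro antisym degree_le le_degree) (auto simp: cg')
    then have "Q i"
      using \<open>g' \<in> M\<close> by (auto simp: Q_def cg' intro!: bexI[of _ g'])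
    then show False
      using least bd[OF i] by blast
  qed
  have m0: "m > 0"
  proof (rule ccontr)
    assume "\<not> m > 0"
    then have "h = 1"
      using h by (metis degree_0_id gr0I lead_coeff_pCons(2) of_int_1 one_pCons coeff_0 degree_eq_zeroE pCons_0_0 lead_coeff_pCons(1) zero_neq_one)
    then show False
      using h M by simp
  qed
  define R where "R = polys_below T m"
  have R: "finite R" "card R = q ^ m"
    using polys_below_card[OF T_finite T_zero] by (auto simp: R_def q_def)
  have RD: "R \<subseteq> poly_over D"
    using T_subset by (auto simp: R_def polys_below_def poly_over_def)
  \<comment> \<open>Reduced remainders after division by \<open>h\<close> represent all classes, so
    the quotient by \<open>M\<close> has \<open>q ^ m\<close> elements.\<close>
  interpret F: fin_prime_quotient "poly_over D" M R
  proof unfold_locales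
    show "x \<in> M \<or> y \<in> M" if xy: "x \<in> poly_over D" "y \<in> poly_over D" "x * y \<in> M" for x y
    proof (cases "x \<in> M")
      case False
      then obtain u where u: "u \<in> poly_over D" "u * x - 1 \<in> M"
        using Minv xy by blast
      have "u * (x * y) - (u * x - 1) * y \<in> M"
        by (rule M.I_diff[OF M.I_mult[OF u(1) xy(3)] M.I_mult2[OF u(2) xy(2)]])
      then show ?thesis
        by (simp add: algebra_simps)
    qed simp
    show "\<exists>r\<in>R. f - r \<in> M" if f: "f \<in> poly_over D" for f
    proof -
      obtain w r where wr: "w \<in> poly_over D" "r \<in> poly_over D" "f = w * h + r"
        "\<And>i. i \<ge> degree h \<Longrightarrow> coeff r i = 0"
        using monic_division[OF hD h(3) f] by metis
      obtain r' where r': "r - r' \<in> poly_over P" "\<And>i. coeff r' i \<in> T" "\<And>i. coeff r i = 0 \<Longrightarrow> coeff r' i = 0"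
        using ex_reduced_poly[OF wr(2)] by metis
      have "f - r' = w * h + (r - r')"
        using wr by simp
      also have "\<dots> \<in> M"
        using wr h r' PM by (intro M.I_add M.I_mult) auto
      finally show ?thesis
        using r' wr h by (intro bexI[of _ r']) (auto simp: R_def polys_below_def)
    qed
    show "r = r'" if r: "r \<in> R" "r' \<in> R" "r - r' \<in> M" for r r'
    proof -
      have "r - r' \<in> poly_over P"
        using r by (intro below) (auto simp: R_def polys_below_def)
      then have "coeff r i = coeff r' i" for i
        using r T_unique[of "coeff r i" "coeff r' i"] by (auto simp: R_def polys_below_def poly_over_def)
      then show ?thesis
        by (rule poly_eqI)
    qed
  qed (use M R RD in auto)
  \<comment> \<open>Fermat in the field with \<open>q ^ m\<close> elements puts \<open>w m\<close>
    into \<open>M\<close>, which the choice of \<open>M\<close> forbids for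
    \<open>m < n\<close>.\<close>
  have "\<not> m < n"
  proof
    assume "m < n"
    have "monom 1 1 ^ (q ^ m) - monom 1 1 \<in> M"
      using F.fermat[OF X_in[of 1]] R by simp
    then have "w m \<in> M"
      by (simp add: w_def monom_power)
    then show False
      using wdM m0 \<open>m < n\<close> by auto
  qed
  \<comment> \<open>Every class is a root of \<open>Y^N - Y\<close>, a polynomial in a new variable
    over the quotient; its degree \<open>q ^ n\<close> would be less than the number
    \<open>q ^ m\<close> of classes.\<close>
  moreover have "\<not> n < m"
  proof
    assume "n < m"
    define g :: "'k poly poly" where "g = monom 1 N - monom 1 1"
    have N2: "N \<ge> 2"
      using qd[OF n] by (simp add: N_def)
    have cg: "coeff g i = (if i = N then 1 else if i = 1 then - 1 else 0)" for i
      using N2 by (auto simp: g_def)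
    have "degree g \<le> N"
      by (intro degree_le) (use N2 in \<open>auto simp: cg\<close>)
    also have "N < card R"
      using \<open>n < m\<close> q by (simp add: N_def R)
    finally have dg: "degree g < card R" .
    have "g \<in> poly_over M"
    proof (rule F.root_count[OF R(1) RD F.T_unique _ _ dg])
      show "g \<in> poly_over (poly_over D)"
        using poly_over_1 poly_over_0 X.S_uminus[OF poly_over_1] by (auto simp: poly_over_def[of "poly_over D"] cg)
      show "poly g x \<in> M" if "x \<in> R" for x
      proof -
        have "x ^ (card T ^ n) - x \<in> M"
          using that RD M PM wM by (intro frobenius_fixes) (auto simp: w_def q_def)
        then show ?thesis
          by (simp add: g_def poly_monom N_def q_def)
      qed
    qed
    then show False
      using poly_over_coeff[of g M N] M by (simp add: cg)
  qed
  ultimately have mn: "m = n"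
    by simp
  show ?thesis
  proof (rule that[OF hD])
    show "degree h = n" "lead_coeff h = 1"
      using h mn by auto
    show "\<exists>u\<in>poly_over D. \<exists>w\<in>poly_over D. u * g - 1 - w * h \<in> poly_over P"
      if g: "g \<in> poly_over D" "\<And>i. i \<ge> n \<Longrightarrow> coeff g i = 0" "g \<notin> poly_over P" for g
    proof -
      have "g \<notin> M"
        using below[of g] g mn by auto
      then obtain u where u: "u \<in> poly_over D" "u * g - 1 \<in> M"
        using Minv g by blast
      have "u * g - 1 \<in> poly_over D"
        using u M.I_in_S by blast
      then obtain w r where wr: "w \<in> poly_over D" "r \<in> poly_over D" "u * g - 1 = w * h + r"
        "\<And>i. i \<ge> degree h \<Longrightarrow> coeff r i = 0"
        using monic_division[OF hD h(3)] by metis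
      have "r = (u * g - 1) - w * h"
        using wr by simp
      then have "r \<in> M"
        using M.I_diff[OF u(2) M.I_mult[OF wr(1) h(1)]] by simp
      then have "r \<in> poly_over P"
        using below wr h by auto
      then show ?thesis
        using u wr by (intro bexI[of _ u] bexI[of _ w]) auto
    qed
  qed
qed

end

subsection \<open>Evaluating polynomials at matrices\<close>

lemma mat_mult_entry:
  "A \<in> carrier_mat n n \<Longrightarrow> B \<in> carrier_mat n n \<Longrightarrow> i < n \<Longrightarrow> j < n \<Longrightarrow>
    (A * B) $$ (i, j) = (\<Sum>k<n. A $$ (i, k) * B $$ (k, j))"
  by (auto simp: scalar_prod_def atLeast0LessThan)

lemma mat_eval_0 [simp]: "mat_eval n 0 M = 0\<^sub>m n n"
  by (simp add: mat_eval_def)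

lemma mat_eval_pCons:
  "M \<in> carrier_mat n n \<Longrightarrow> mat_eval n (pCons c f) M = c \<cdot>\<^sub>m 1\<^sub>m n + M * mat_eval n f M"
  by (cases "c = 0 \<and> f = 0") (auto simp: mat_eval_def cCons_def)

lemma mat_eval_carrier [simp]: "M \<in> carrier_mat n n \<Longrightarrow> mat_eval n f M \<in> carrier_mat n n"
  by (induction f) (simp_all add: mat_eval_pCons)

lemma mat_eval_const: "M \<in> carrier_mat n n \<Longrightarrow> mat_eval n [:c:] M = c \<cdot>\<^sub>m 1\<^sub>m n"
  by (auto simp: mat_eval_pCons)

lemma mat_eval_1: "M \<in> carrier_mat n n \<Longrightarrow> mat_eval n 1 M = 1\<^sub>m n"
  unfolding one_pCons by (subst mat_eval_const) auto

context
  fixes n :: nat and M :: "'k::field mat"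
  assumes M [simp]: "M \<in> carrier_mat n n"
begin

private abbreviation "ev f \<equiv> mat_eval n f M"

lemma mat_eval_add: "mat_eval n (f + g) M = mat_eval n f M + mat_eval n g M"
proof (induction f g rule: poly_induct2)
  case (pCons a p b q)
  have "M * (ev p + ev q) = M * ev p + M * ev q"
    by (rule mult_add_distrib_mat[OF M mat_eval_carrier mat_eval_carrier]) auto
  then have "ev (pCons a p + pCons b q) = (a + b) \<cdot>\<^sub>m 1\<^sub>m n + (M * ev p + M * ev q)"
    by (simp add: mat_eval_pCons pCons.IH)
  also have "\<dots> = (a \<cdot>\<^sub>m 1\<^sub>m n + M * ev p) + (b \<cdot>\<^sub>m 1\<^sub>m n + M * ev q)"
    using carrier_matD[OF mult_carrier_mat[OF M mat_eval_carrier[OF M]]]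
    by (intro eq_matI) (auto simp: algebra_simps simp del: index_mult_mat)
  finally show ?case
    by (simp add: mat_eval_pCons)
qed simp

lemma mat_eval_smult: "mat_eval n (Polynomial.smult c f) M = c \<cdot>\<^sub>m mat_eval n f M"
proof (induction f)
  case (pCons a f)
  have "M * (c \<cdot>\<^sub>m ev f) = c \<cdot>\<^sub>m (M * ev f)"
    by (rule mult_smult_distrib[OF M mat_eval_carrier]) auto
  then have "ev (Polynomial.smult c (pCons a f)) = (c * a) \<cdot>\<^sub>m 1\<^sub>m n + c \<cdot>\<^sub>m (M * ev f)"
    by (simp add: mat_eval_pCons pCons.IH)
  also have "\<dots> = c \<cdot>\<^sub>m (a \<cdot>\<^sub>m 1\<^sub>m n + M * ev f)"
    using carrier_matD[OF mult_carrier_mat[OF M mat_eval_carrier[OF M]]]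
    by (intro eq_matI) (auto simp: algebra_simps simp del: index_mult_mat)
  finally show ?case
    by (simp add: mat_eval_pCons)
qed auto

lemma mat_eval_pCons_0: "mat_eval n (pCons 0 f) M = M * mat_eval n f M"
proof -
  have "M * ev f \<in> carrier_mat n n"
    using mult_carrier_mat[OF M mat_eval_carrier[OF M]] .
  then have "0 \<cdot>\<^sub>m 1\<^sub>m n + M * ev f = M * ev f"
    by (intro eq_matI) (auto simp del: index_mult_mat)
  then show ?thesis
    by (simp add: mat_eval_pCons)
qed

lemma mat_eval_X: "mat_eval n [:0, 1:] M = M"
  using mat_eval_pCons_0[of 1] mat_eval_1[OF M] right_mult_one_mat[OF M] by (simp add: one_pCons)

lemma mat_eval_mult: "mat_eval n (f * g) M = mat_eval n f M * mat_eval n g M"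
proof (induction f)
  case (pCons a f)
  have "ev (pCons a f * g) = a \<cdot>\<^sub>m ev g + M * (ev f * ev g)"
    by (simp add: mat_eval_add mat_eval_smult mat_eval_pCons_0 pCons.IH)
  also have "M * (ev f * ev g) = (M * ev f) * ev g"
    by (rule assoc_mult_mat[OF M mat_eval_carrier mat_eval_carrier, symmetric]) auto
  also have "a \<cdot>\<^sub>m ev g = (a \<cdot>\<^sub>m 1\<^sub>m n) * ev g"
    using mult_smult_assoc_mat[OF one_carrier_mat mat_eval_carrier[OF M], of a]
      left_mult_one_mat[OF mat_eval_carrier[OF M]] by simp
  also have "\<dots> + (M * ev f) * ev g = (a \<cdot>\<^sub>m 1\<^sub>m n + M * ev f) * ev g"
    by (rule add_mult_distrib_mat[symmetric, OF _ mult_carrier_mat[OF M mat_eval_carrier] mat_eval_carrier]) auto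
  finally show ?case
    by (simp add: mat_eval_pCons)
qed (simp add: left_mult_zero_mat[of _ n n])

lemma mat_eval_commute: "mat_eval n f M * mat_eval n g M = mat_eval n g M * mat_eval n f M"
  by (metis mat_eval_mult mult.commute)

lemma mat_eval_sum_entry:
  "i < n \<Longrightarrow> j < n \<Longrightarrow> mat_eval n (\<Sum>a\<in>A. f a) M $$ (i, j) = (\<Sum>a\<in>A. mat_eval n (f a) M $$ (i, j))"
  by (induction A rule: infinite_finite_induct)
    (auto simp: mat_eval_add carrier_matD[OF mat_eval_carrier[OF M]])

lemma mat_eval_diff_entry:
  "i < n \<Longrightarrow> j < n \<Longrightarrow>
    mat_eval n (f - g) M $$ (i, j) = mat_eval n f M $$ (i, j) - mat_eval n g M $$ (i, j)"
  using mat_eval_add[of f "- g"] mat_eval_smult[of "-1" g] carrier_matD[OF mat_eval_carrier[OF M]]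
  by simp

end

text \<open>Writing \<open>ev f\<close> for the matrix \<open>f(A)\<close>, the characteristic matrix \<open>C\<close> satisfies
  \<open>\<Sum>\<^sub>k ev C\<^sub>k\<^sub>i e\<^sub>k = 0\<close> for each \<open>i\<close>, and multiplying by the adjugate gives \<open>ev \<chi> e\<^sub>j = 0\<close>.\<close>
lemma cayley_hamilton:
  fixes A :: "'k::field mat"
  assumes A [simp]: "A \<in> carrier_mat n n"
  shows "mat_eval n (char_poly A) A = 0\<^sub>m n n"
proof -
  define C where "C = char_poly_matrix A"
  define B where "B = adj_mat C"
  define ev where "ev f = mat_eval n f A" for f
  have C: "C \<in> carrier_mat n n"
    by (simp add: C_def)
  have B: "B \<in> carrier_mat n n" and CB: "C * B = char_poly A \<cdot>\<^sub>m 1\<^sub>m n"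
    using adj_mat(1,2)[OF C] by (auto simp: B_def C_def char_poly_def)
  have evc: "ev f \<in> carrier_mat n n" for f
    by (simp add: ev_def)
  have Cki: "C $$ (k, i) = (if k = i then [:0, 1:] else 0) - [:A $$ (k, i):]" if "k < n" "i < n" for k i
    using that carrier_matD[OF A] by (auto simp: C_def char_poly_matrix_def)
  have evX: "ev [:0, 1:] = A"
    by (simp add: ev_def mat_eval_X)
  have col: "(\<Sum>k<n. ev (C $$ (k, i)) $$ (s, k)) = 0" if s: "s < n" and i: "i < n" for s i
  proof -
    have "ev (C $$ (k, i)) $$ (s, k) =
        (if k = i then A $$ (s, i) else 0) - (if k = s then A $$ (s, i) else 0)" if k: "k < n" for k
      using k s i evX by (auto simp: Cki ev_def mat_eval_diff_entry mat_eval_const)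
    then show ?thesis
      using s i by (simp add: sum_subtractf)
  qed
  have "ev (char_poly A) $$ (r, j) = 0" if r: "r < n" and j: "j < n" for r j
  proof -
    have CBe: "(\<Sum>i<n. C $$ (k, i) * B $$ (i, j)) = (if k = j then char_poly A else 0)" if "k < n" for k
      using mat_mult_entry[OF C B that j] that j by (simp add: CB split: if_splits)
    have "ev (char_poly A) $$ (r, j) = (\<Sum>k<n. if k = j then ev (char_poly A) $$ (r, k) else 0)"
      using j by simp
    also have "\<dots> = (\<Sum>k<n. ev (\<Sum>i<n. C $$ (k, i) * B $$ (i, j)) $$ (r, k))"
      using r by (intro sum.cong) (auto simp: CBe ev_def)
    also have "\<dots> = (\<Sum>k<n. \<Sum>i<n. ev (B $$ (i, j) * C $$ (k, i)) $$ (r, k))"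
      using r by (intro sum.cong refl) (simp add: ev_def mat_eval_sum_entry mult.commute)
    also have "\<dots> = (\<Sum>k<n. \<Sum>i<n. \<Sum>s<n. ev (B $$ (i, j)) $$ (r, s) * ev (C $$ (k, i)) $$ (s, k))"
      using r by (intro sum.cong refl) (simp add: ev_def mat_eval_mult mat_mult_entry[of _ n])
    also have "\<dots> = (\<Sum>i<n. \<Sum>s<n. \<Sum>k<n. ev (B $$ (i, j)) $$ (r, s) * ev (C $$ (k, i)) $$ (s, k))"
      by (subst sum.swap) (intro sum.cong refl sum.swap)
    also have "\<dots> = (\<Sum>i<n. \<Sum>s<n. ev (B $$ (i, j)) $$ (r, s) * (\<Sum>k<n. ev (C $$ (k, i)) $$ (s, k)))"
      by (simp add: sum_distrib_left)
    also have "\<dots> = 0"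
      by (intro sum.neutral ballI) (simp add: col)
    finally show ?thesis .
  qed
  then show ?thesis
    using carrier_matD[OF evc[of "char_poly A"]] by (intro eq_matI) (auto simp: ev_def)
qed

text \<open>For monic \<open>h\<close> of degree \<open>n\<close> this is multiplication by
  \<open>X\<close> on polynomials modulo \<open>h\<close> in the basis
  \<open>1, X, ..., X^(n-1)\<close>, acting on column vectors.\<close>

definition companion :: "nat \<Rightarrow> 'k::field poly \<Rightarrow> 'k mat" where
  "companion n h =
    mat n n (\<lambda>(i, j). if Suc j < n then (if i = Suc j then 1 else 0) else - coeff h i)"

text \<open>The initial column of \<open>f(C)\<close> is the coefficient vector of \<open>f\<close>
  as long as \<open>f\<close> has degree below \<open>n\<close>, and the last column of
  \<open>C\<close> makes the initial column of \<open>h(C)\<close> vanish. Each other basis vector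
  is a power of \<open>C\<close> applied to the initial one, and powers of \<open>C\<close> commute
  with \<open>h(C)\<close>.\<close>

lemma mat_eval_companion:
  assumes n: "n \<ge> 1" and h: "degree h = n" "lead_coeff h = 1"
  shows "mat_eval n h (companion n h) = 0\<^sub>m n n"
proof -
  define C where "C = companion n h"
  define ev where "ev f = mat_eval n f C" for f
  have C [simp]: "C \<in> carrier_mat n n"
    by (simp add: C_def companion_def)
  have evc: "ev f \<in> carrier_mat n n" for f
    by (simp add: ev_def)
  have Ce: "C $$ (i, j) = (if Suc j < n then (if i = Suc j then 1 else 0) else - coeff h i)"
    if "i < n" "j < n" for i j
    using that by (simp add: C_def companion_def)
  have pC: "ev (pCons c f) $$ (r, 0) = (if r = 0 then c else 0) + (\<Sum>s<n. C $$ (r, s) * ev f $$ (s, 0))"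
    if "r < n" for c f r
    using that n mult_carrier_mat[OF C evc[of f]] mat_mult_entry[OF C evc[of f], of r 0]
    by (auto simp: ev_def mat_eval_pCons simp del: index_mult_mat)
  have low: "ev f $$ (r, 0) = coeff f r" if "\<And>i. i \<ge> n \<Longrightarrow> coeff f i = 0" "r < n" for f r
    using that
  proof (induction f arbitrary: r)
    case 0
    then show ?case by (simp add: ev_def)
  next
    case (pCons c f)
    have f0: "coeff f i = 0" if "Suc i \<ge> n" for i
      using pCons.prems(1)[of "Suc i"] that by simp
    have IH: "ev f $$ (s, 0) = coeff f s" if "s < n" for s
      using pCons.IH[of s] that f0 by auto
    have "(\<Sum>s<n. C $$ (r, s) * ev f $$ (s, 0)) = (\<Sum>s<n. if r = Suc s then coeff f s else 0)"
      using pCons.prems(2) f0 by (intro sum.cong) (auto simp: Ce IH)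
    also have "\<dots> = (case r of 0 \<Rightarrow> 0 | Suc s \<Rightarrow> coeff f s)"
      using pCons.prems(2) by (cases r) auto
    finally show ?case
      using pC[OF pCons.prems(2), of c f] by (auto split: nat.split)
  qed
  obtain m where m: "n = Suc m"
    using n by (cases n) auto
  have Xn: "ev (monom 1 n) $$ (r, 0) = - coeff h r" if r: "r < n" for r
  proof -
    have "ev (monom 1 n) $$ (r, 0) = (\<Sum>s<n. C $$ (r, s) * ev (monom 1 m) $$ (s, 0))"
      using pC[OF r, of 0 "monom 1 m"] by (simp add: m monom_Suc)
    also have "\<dots> = (\<Sum>s<n. if s = m then - coeff h r else 0)"
      using r low[of "monom 1 m"] by (intro sum.cong) (auto simp: Ce m)
    finally show ?thesis
      by (simp add: m)
  qed
  have h0: "ev h $$ (r, 0) = 0" if r: "r < n" for r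
  proof -
    have "coeff (h - monom 1 n) i = 0" if "i \<ge> n" for i
      using that h by (cases "i = n") (auto simp: coeff_eq_0)
    then have "ev (h - monom 1 n) $$ (r, 0) = coeff h r"
      using low[of "h - monom 1 n" r] r by simp
    then show ?thesis
      using Xn[OF r] n r by (simp add: ev_def mat_eval_diff_entry)
  qed
  have "ev h $$ (r, j) = 0" if r: "r < n" and j: "j < n" for r j
  proof -
    have "ev h $$ (r, j) = (\<Sum>s<n. ev h $$ (r, s) * ev (monom 1 j) $$ (s, 0))"
      using j by (subst sum.cong[OF refl, of _ _ "\<lambda>s. if s = j then ev h $$ (r, s) else 0"])
        (auto simp: low)
    also have "\<dots> = (ev h * ev (monom 1 j)) $$ (r, 0)"
      using n r by (simp add: mat_mult_entry[OF evc evc])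
    also have "\<dots> = (ev (monom 1 j) * ev h) $$ (r, 0)"
      unfolding ev_def by (subst mat_eval_commute) auto
    also have "\<dots> = (\<Sum>s<n. ev (monom 1 j) $$ (r, s) * ev h $$ (s, 0))"
      using n r by (simp add: mat_mult_entry[OF evc evc])
    also have "\<dots> = 0"
      by (simp add: h0)
    finally show ?thesis .
  qed
  then show ?thesis
    using carrier_matD[OF evc[of h]] by (intro eq_matI) (auto simp: ev_def C_def)
qed

section \<open>Determinants over a subring and modulo an ideal\<close>

context subring_ideal
begin

lemma signof_in: "(signof p :: 'r) \<in> S"
  using S_one S_uminus[OF S_one] by (auto simp: sign_def)

lemma det_in:
  assumes "A \<in> carrier_mat n n" "\<And>i j. i < n \<Longrightarrow> j < n \<Longrightarrow> A $$ (i, j) \<in> S"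
  shows "det A \<in> S"
  unfolding det_def'[OF assms(1)]
  by (intro S_sum S_mult signof_in S_prod assms) (auto dest: permutes_in_image)

lemma det_cong_mod:
  assumes A: "A \<in> carrier_mat n n" "\<And>i j. i < n \<Longrightarrow> j < n \<Longrightarrow> A $$ (i, j) \<in> S"
    and B: "B \<in> carrier_mat n n" "\<And>i j. i < n \<Longrightarrow> j < n \<Longrightarrow> B $$ (i, j) \<in> S"
    and AB: "\<And>i j. i < n \<Longrightarrow> j < n \<Longrightarrow> A $$ (i, j) - B $$ (i, j) \<in> I"
  shows "det A - det B \<in> I"
proof -
  have "det A - det B = (\<Sum>p\<in>{p. p permutes {0..<n}}. signof p *
      ((\<Prod>i = 0..<n. A $$ (i, p i)) - (\<Prod>i = 0..<n. B $$ (i, p i))))"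
    unfolding det_def'[OF A(1)] det_def'[OF B(1)] by (simp add: sum_subtractf right_diff_distrib)
  also have "\<dots> \<in> I"
    by (intro I_sum I_mult signof_in cong_prod A(2) B(2) AB) (auto dest: permutes_in_image)
  finally show ?thesis .
qed

end


subsection \<open>Matrices modulo a prime with finite residue field\<close>

lemma Mn_carrier: "A \<in> Mn R n \<Longrightarrow> A \<in> carrier_mat n n"
  by (simp add: Mn_def)

lemma Mn_entry: "A \<in> Mn R n \<Longrightarrow> i < n \<Longrightarrow> j < n \<Longrightarrow> A $$ (i, j) \<in> R"
  by (simp add: Mn_def)

lemma Mn_I: "A \<in> carrier_mat n n \<Longrightarrow> (\<And>i j. i < n \<Longrightarrow> j < n \<Longrightarrow> A $$ (i, j) \<in> R) \<Longrightarrow> A \<in> Mn R n"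
  by (simp add: Mn_def)

lemma (in subring_ideal) adj_mat_in:
  assumes A: "A \<in> carrier_mat n n" "\<And>i j. i < n \<Longrightarrow> j < n \<Longrightarrow> A $$ (i, j) \<in> S"
    and ij: "i < n" "j < n"
  shows "adj_mat A $$ (i, j) \<in> S"
proof -
  have "det (mat_delete A j i) \<in> S"
    using A ij by (intro det_in[of _ "n - 1"]) (auto simp: mat_delete_def)
  moreover have "(-1) ^ (j + i) \<in> S"
    by (intro S_power S_uminus S_one)
  ultimately have "cofactor A j i \<in> S"
    unfolding cofactor_def by (rule S_mult[rotated])
  then show ?thesis
    using A ij by (simp add: adj_mat_def carrier_matD[OF A(1)])
qed

text \<open>Transposition lets results on column vectors be applied to the row factor of a rank one
  matrix.\<close>

lemma mat_eval_transpose: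
  assumes M [simp]: "M \<in> carrier_mat n n"
  shows "mat_eval n f (transpose_mat M) = transpose_mat (mat_eval n f M)"
proof (induction f)
  case 0
  then show ?case by (intro eq_matI) auto
next
  case (pCons c f)
  have Mt: "transpose_mat M \<in> carrier_mat n n"
    by simp
  have ef: "mat_eval n f M \<in> carrier_mat n n"
    by simp
  have com: "M * mat_eval n f M = mat_eval n f M * M"
    using mat_eval_commute[OF M, of "[:0, 1:]" f] by (simp add: mat_eval_X[OF M])
  have "transpose_mat M * transpose_mat (mat_eval n f M) = transpose_mat (mat_eval n f M * M)"
    by (rule transpose_mult[OF ef M, symmetric])
  then have "mat_eval n (pCons c f) (transpose_mat M) =
      c \<cdot>\<^sub>m 1\<^sub>m n + transpose_mat (M * mat_eval n f M)"
    by (simp add: mat_eval_pCons[OF Mt] pCons.IH com)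
  also have "\<dots> = transpose_mat (c \<cdot>\<^sub>m 1\<^sub>m n + M * mat_eval n f M)"
    using carrier_matD[OF mult_carrier_mat[OF M ef]]
    by (intro eq_matI) (auto simp del: index_mult_mat)
  finally show ?case
    by (simp add: mat_eval_pCons)
qed

context residue_field
begin

lemma Mn_one: "1\<^sub>m n \<in> Mn D n"
  using S_one S_zero by (auto simp: Mn_def)

lemma Mn_smult: "c \<in> D \<Longrightarrow> A \<in> Mn D n \<Longrightarrow> c \<cdot>\<^sub>m A \<in> Mn D n"
  by (auto simp: Mn_def S_mult)

lemma Mn_mult: "A \<in> Mn D n \<Longrightarrow> B \<in> Mn D n \<Longrightarrow> A * B \<in> Mn D n"
  by (intro Mn_I) (auto simp: mat_mult_entry[OF Mn_carrier Mn_carrier] Mn_entry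
      intro!: S_sum S_mult intro: Mn_carrier mult_carrier_mat simp del: index_mult_mat(1))

lemma Mn_mult_ideal: "A \<in> Mn D n \<Longrightarrow> B \<in> Mn P n \<Longrightarrow> A * B \<in> Mn P n"
  by (intro Mn_I) (auto simp: mat_mult_entry[OF Mn_carrier Mn_carrier] Mn_entry
      intro!: I_sum I_mult intro: Mn_carrier mult_carrier_mat simp del: index_mult_mat(1))

lemma mat_eval_Mn: "f \<in> poly_over D \<Longrightarrow> M \<in> Mn D n \<Longrightarrow> mat_eval n f M \<in> Mn D n"
proof (induction f)
  case 0
  then show ?case
    using S_zero by (auto simp: Mn_def)
next
  case (pCons c f)
  then have "c \<cdot>\<^sub>m 1\<^sub>m n \<in> Mn D n" "M * mat_eval n f M \<in> Mn D n"
    by (auto simp: poly_over_pCons intro!: Mn_smult Mn_one Mn_mult)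
  then have "c \<cdot>\<^sub>m 1\<^sub>m n + M * mat_eval n f M \<in> Mn D n"
    by (auto simp: Mn_def S_add simp del: index_mult_mat index_one_mat index_smult_mat)
  then show ?case
    using pCons by (simp add: mat_eval_pCons Mn_carrier)
qed

lemma mat_eval_MnP: "f \<in> poly_over P \<Longrightarrow> M \<in> Mn D n \<Longrightarrow> mat_eval n f M \<in> Mn P n"
proof (induction f)
  case 0
  then show ?case
    using I_zero by (auto simp: Mn_def)
next
  case (pCons c f)
  then have "c \<in> P" "f \<in> poly_over P"
    using poly_over_coeff[OF pCons.prems(1), of 0] poly_over_coeff[OF pCons.prems(1), of "Suc _"]
    by (auto simp: poly_over_def)
  then have "c \<cdot>\<^sub>m 1\<^sub>m n \<in> Mn P n" "M * mat_eval n f M \<in> Mn P n"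
    using pCons I_zero by (auto simp: Mn_def[of P] intro!: Mn_mult_ideal[unfolded Mn_def[of P], simplified])
  then have "c \<cdot>\<^sub>m 1\<^sub>m n + M * mat_eval n f M \<in> Mn P n"
    by (auto simp: Mn_def I_add simp del: index_mult_mat index_one_mat index_smult_mat)
  then show ?case
    using pCons by (simp add: mat_eval_pCons Mn_carrier)
qed

lemma mat_eval_cong:
  assumes "f - g \<in> poly_over P" "M \<in> Mn D n" "i < n" "j < n"
  shows "mat_eval n f M $$ (i, j) - mat_eval n g M $$ (i, j) \<in> P"
  using Mn_entry[OF mat_eval_MnP[OF assms(1,2)] assms(3,4)] assms
  by (simp add: mat_eval_diff_entry Mn_carrier)

lemma mat_eval_cong_MnP:
  assumes "f - g \<in> poly_over P" "M \<in> Mn D n" "mat_eval n g M \<in> Mn P n"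
  shows "mat_eval n f M \<in> Mn P n"
proof (rule Mn_I)
  show "mat_eval n f M $$ (i, j) \<in> P" if "i < n" "j < n" for i j
    using cong_mem[OF mat_eval_cong[OF assms(1,2) that]] Mn_entry[OF assms(3) that] by blast
qed (use assms in \<open>simp add: Mn_carrier\<close>)

lemma mat_eval_dvd_MnP:
  assumes "f \<in> poly_over D" "M \<in> Mn D n" "mat_eval n g M \<in> Mn P n"
  shows "mat_eval n (f * g) M \<in> Mn P n"
  using assms by (simp add: mat_eval_mult Mn_carrier Mn_mult_ideal mat_eval_Mn)

lemma char_poly_over:
  assumes M: "M \<in> Mn D n"
  shows "char_poly M \<in> poly_over D"
  unfolding char_poly_def
proof (rule X.det_in)
  show "char_poly_matrix M \<in> carrier_mat n n"
    using Mn_carrier[OF M] by simp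
  show "char_poly_matrix M $$ (i, j) \<in> poly_over D" if "i < n" "j < n" for i j
    using that carrier_matD[OF Mn_carrier[OF M]] Mn_entry[OF M that]
    by (auto simp: char_poly_matrix_def poly_over_pCons poly_over_0 poly_over_1 S_zero S_one S_uminus)
qed

text \<open>Reduction leaves finitely many candidates for the characteristic polynomial modulo
  \<open>P\<close>, so that one product can involve all of them; by Cayley-Hamilton the reduced
  polynomial still annihilates \<open>M\<close> modulo \<open>P\<close>.\<close>

lemma char_poly_reduced:
  assumes M: "M \<in> Mn D n"
  obtains f where "f \<in> polys_below T (Suc n)" "coeff f n = 1" "char_poly M - f \<in> poly_over P"
    "mat_eval n f M \<in> Mn P n"
proof -
  have cp: "degree (char_poly M) = n" "coeff (char_poly M) n = 1"
    using degree_monic_char_poly[OF Mn_carrier[OF M]] by auto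
  obtain f where f: "char_poly M - f \<in> poly_over P" "\<And>i. coeff f i \<in> T"
    "\<And>i. coeff (char_poly M) i = 0 \<Longrightarrow> coeff f i = 0" "\<And>i. coeff (char_poly M) i = 1 \<Longrightarrow> coeff f i = 1"
    using ex_reduced_poly[OF char_poly_over[OF M]] by metis
  have "f - char_poly M \<in> poly_over P"
    using X.cong_sym[OF f(1)] .
  then have "mat_eval n f M \<in> Mn P n"
    by (rule mat_eval_cong_MnP[OF _ M])
      (use I_zero in \<open>simp add: cayley_hamilton[OF Mn_carrier[OF M]] Mn_def\<close>)
  moreover have "coeff f i = 0" if "i \<ge> Suc n" for i
    using that cp by (intro f(3) coeff_eq_0) simp
  ultimately show ?thesis
    using f cp by (intro that[of f]) (auto simp: polys_below_def)
qed

text \<open>Invertibility of \<open>g\<close> in the ring of polynomials over \<open>D\<close>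
  modulo the ideal generated by \<open>h\<close> and \<open>P\<close>.\<close>

definition unit_mod :: "'k poly \<Rightarrow> 'k poly \<Rightarrow> bool" where
  "unit_mod h g \<longleftrightarrow> g \<in> poly_over D \<and>
    (\<exists>u\<in>poly_over D. \<exists>w\<in>poly_over D. u * g - 1 - w * h \<in> poly_over P)"

lemma unit_mod_mult:
  assumes h: "h \<in> poly_over D" and "unit_mod h f" "unit_mod h g"
  shows "unit_mod h (f * g)"
proof -
  obtain u w where u: "u \<in> poly_over D" "w \<in> poly_over D" "u * f - 1 - w * h \<in> poly_over P"
    using assms by (auto simp: unit_mod_def)
  obtain u' w' where u': "u' \<in> poly_over D" "w' \<in> poly_over D" "u' * g - 1 - w' * h \<in> poly_over P"
    using assms by (auto simp: unit_mod_def)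
  have fg: "f \<in> poly_over D" "g \<in> poly_over D"
    using assms by (auto simp: unit_mod_def)
  have "(u * u') * (f * g) - 1 - (w * (u' * g) + w') * h =
      (u * f - 1 - w * h) * (u' * g) + (u' * g - 1 - w' * h)"
    by (simp add: algebra_simps)
  also have "\<dots> \<in> poly_over P"
    by (rule X.I_add[OF X.I_mult2[OF u(3) poly_over_mult[OF u'(1) fg(2)]] u'(3)])
  finally show ?thesis
    unfolding unit_mod_def using u u' fg h
    by (intro conjI poly_over_mult bexI[of _ "u * u'"] bexI[of _ "w * (u' * g) + w'"] poly_over_add)
qed

lemma unit_mod_prod:
  assumes h: "h \<in> poly_over D" and "\<And>x. x \<in> A \<Longrightarrow> unit_mod h (f x)"
  shows "unit_mod h (prod f A)"
proof -
  have "(1 * 1 - 1 - 0 * h :: 'k poly) \<in> poly_over P"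
    using X.I_zero by simp
  then have "unit_mod h 1"
    unfolding unit_mod_def using poly_over_0 poly_over_1 by blast
  then show ?thesis
    using assms(2)
    by (induction A rule: infinite_finite_induct) (auto intro: unit_mod_mult[OF h])
qed

lemma unit_mod_cong:
  assumes h: "h \<in> poly_over D" and k: "k \<in> poly_over D" and f: "unit_mod h f"
    and g: "g \<in> poly_over D" "g - f - k * h \<in> poly_over P"
  shows "unit_mod h g"
proof -
  obtain u w where u: "u \<in> poly_over D" "w \<in> poly_over D" "u * f - 1 - w * h \<in> poly_over P"
    using f by (auto simp: unit_mod_def)
  have "u * g - 1 - (w + u * k) * h = u * (g - f - k * h) + (u * f - 1 - w * h)"
    by (simp add: algebra_simps)
  also have "\<dots> \<in> poly_over P"
    by (rule X.I_add[OF X.I_mult[OF u(1) g(2)] u(3)])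
  finally show ?thesis
    unfolding unit_mod_def using u k g
    by (intro conjI bexI[of _ u] bexI[of _ "w + u * k"] poly_over_add poly_over_mult)
qed

text \<open>As \<open>h(M)\<close> vanishes modulo \<open>P\<close>, the inverse \<open>u\<close>
  satisfies \<open>u(M) g(M) = 1\<close> modulo \<open>P\<close>; determinants turn this into
  invertibility of \<open>det g(M)\<close>.\<close>

lemma det_unit_mod:
  assumes g: "unit_mod h g" and M: "M \<in> Mn D n" and h: "mat_eval n h M \<in> Mn P n"
  shows "det (mat_eval n g M) \<notin> P"
proof
  assume G: "det (mat_eval n g M) \<in> P"
  obtain u w where u: "u \<in> poly_over D" "w \<in> poly_over D" "u * g - 1 - w * h \<in> poly_over P"
    and gD: "g \<in> poly_over D"
    using g by (auto simp: unit_mod_def)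
  note Mc = Mn_carrier[OF M]
  have "mat_eval n (u * g) M $$ (i, j) - 1\<^sub>m n $$ (i, j) \<in> P" if ij: "i < n" "j < n" for i j
  proof -
    have "mat_eval n (u * g - 1 - w * h) M $$ (i, j) \<in> P" "mat_eval n (w * h) M $$ (i, j) \<in> P"
      using Mn_entry[OF mat_eval_MnP[OF u(3) M] ij] Mn_entry[OF mat_eval_dvd_MnP[OF u(2) M h] ij]
      by auto
    then show ?thesis
      using I_add ij by (fastforce simp: mat_eval_diff_entry[OF Mc] mat_eval_1[OF Mc])
  qed
  then have "det (mat_eval n (u * g) M) - det (1\<^sub>m n) \<in> P"
    using Mn_entry[OF mat_eval_Mn[OF poly_over_mult[OF u(1) gD] M]] Mn_entry[OF Mn_one]
    by (intro det_cong_mod[of _ n]) (auto simp: Mc)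
  moreover have "det (mat_eval n (u * g) M) = det (mat_eval n u M) * det (mat_eval n g M)"
    by (simp add: mat_eval_mult[OF Mc] det_mult[OF mat_eval_carrier[OF Mc] mat_eval_carrier[OF Mc]])
  moreover have "det (mat_eval n u M) \<in> D"
    using Mn_entry[OF mat_eval_Mn[OF u(1) M]] by (intro det_in[of _ n]) (auto simp: Mc)
  ultimately have "det (mat_eval n (u * g) M) \<in> P" "det (mat_eval n (u * g) M) - 1 \<in> P"
    using I_mult[OF _ G] by auto
  then have "1 \<in> P"
    using I_diff by fastforce
  then show False
    using one_notin by simp
qed

text \<open>Irreducibility over the residue field is encoded by the property that is applied later:
  nonzero polynomials of degree below \<open>n\<close> are invertible modulo \<open>h\<close> and
  \<open>P\<close>.\<close>

definition irreducible_mod :: "nat \<Rightarrow> 'k poly \<Rightarrow> bool" where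
  "irreducible_mod n h \<longleftrightarrow> h \<in> poly_over D \<and> degree h = n \<and> lead_coeff h = 1 \<and>
    (\<forall>g\<in>poly_over D. (\<forall>i\<ge>n. coeff g i = 0) \<and> g \<notin> poly_over P \<longrightarrow> unit_mod h g)"

lemma ex_irreducible: "n \<ge> 1 \<Longrightarrow> \<exists>h. irreducible_mod n h"
  using ex_irreducible_mod[of n] unfolding irreducible_mod_def unit_mod_def by metis

lemma companion_Mn:
  assumes "h \<in> poly_over D"
  shows "companion n h \<in> Mn D n"
  using poly_over_coeff[OF assms] S_zero S_one S_uminus
  by (auto simp: companion_def Mn_def)

lemma poly_over_reduced: "f \<in> polys_below T m \<Longrightarrow> f \<in> poly_over D"
  using T_subset by (auto simp: polys_below_def poly_over_def)

text \<open>\<open>G\<close> is the product of all reduced monic polynomials of degree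
  \<open>n\<close> that differ from \<open>h\<close> modulo \<open>P\<close>. It contains the
  reduced characteristic polynomial of every \<open>b\<close>, so it annihilates \<open>B\<close>
  modulo \<open>P\<close>. Each factor \<open>f\<close> is congruent to \<open>f - h\<close> modulo
  \<open>h\<close>, which has lower degree and is therefore a unit there.\<close>

lemma separate_irreducible:
  assumes n: "n \<ge> 1" and h: "irreducible_mod n h" and B: "B \<subseteq> Mn D n"
    and none: "\<And>b. b \<in> B \<Longrightarrow> char_poly b - h \<notin> poly_over P"
  obtains G M where "G \<in> poly_over D" "\<And>b. b \<in> B \<Longrightarrow> mat_eval n G b \<in> Mn P n"
    "M \<in> Mn D n" "det (mat_eval n G M) \<notin> P"
proof
  define Y where "Y = {f \<in> polys_below T (Suc n). coeff f n = 1 \<and> f - h \<notin> poly_over P}"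
  define G where "G = \<Prod>Y"
  have hD: "h \<in> poly_over D" and hdeg: "degree h = n" "lead_coeff h = 1"
    using h by (auto simp: irreducible_mod_def)
  have Yfin: "finite Y"
    using polys_below_card[OF T_finite T_zero, of "Suc n"] by (simp add: Y_def)
  have unit: "unit_mod h f" if f: "f \<in> Y" for f
  proof -
    have fD: "f \<in> poly_over D"
      using f poly_over_reduced by (auto simp: Y_def)
    have "coeff (f - h) i = 0" if "i \<ge> n" for i
      using that f hdeg by (cases "i = n") (auto simp: Y_def polys_below_def coeff_eq_0)
    then have "unit_mod h (f - h)"
      using h f poly_over_diff[OF fD hD] by (auto simp: irreducible_mod_def Y_def)
    then show ?thesis
      by (rule unit_mod_cong[OF hD poly_over_1 _ fD]) (use X.I_zero in simp)
  qed
  have YD: "f \<in> poly_over D" if "f \<in> Y" for f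
    using unit[OF that] by (simp add: unit_mod_def)
  show "G \<in> poly_over D"
    unfolding G_def using YD by (intro X.S_prod)
  show "mat_eval n G b \<in> Mn P n" if b: "b \<in> B" for b
  proof -
    have bM: "b \<in> Mn D n"
      using b B by auto
    obtain f where f: "f \<in> polys_below T (Suc n)" "coeff f n = 1" "char_poly b - f \<in> poly_over P"
      "mat_eval n f b \<in> Mn P n"
      using char_poly_reduced[OF bM] by metis
    have "f - h \<notin> poly_over P"
      using none[OF b] X.cong_trans[OF f(3)] by blast
    then have "f \<in> Y"
      using f by (simp add: Y_def)
    then have "G = \<Prod>(Y - {f}) * f"
      unfolding G_def using Yfin by (simp add: prod.remove[of Y f] mult.commute)
    moreover have "\<Prod>(Y - {f}) \<in> poly_over D"
      using YD by (intro X.S_prod) auto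
    ultimately show ?thesis
      using mat_eval_dvd_MnP[OF _ bM f(4)] by simp
  qed
  show cM: "companion n h \<in> Mn D n"
    by (rule companion_Mn[OF hD])
  show "det (mat_eval n G (companion n h)) \<notin> P"
  proof (rule det_unit_mod[OF _ cM])
    show "unit_mod h G"
      unfolding G_def using unit by (intro unit_mod_prod[OF hD])
    show "mat_eval n h (companion n h) \<in> Mn P n"
      using I_zero by (simp add: mat_eval_companion[OF n hdeg] Mn_def)
  qed
qed

text \<open>A geometric series: after scaling by an inverse \<open>c\<close> of the constant term,
  \<open>f\<close> becomes \<open>1 - x\<close> modulo \<open>P\<close> with \<open>x\<close>
  divisible by \<open>X\<close>, and \<open>x ^ n\<close> is a multiple of
  \<open>X^n\<close>.\<close>

lemma unit_mod_monom:
  assumes f: "f \<in> poly_over D" and f0: "coeff f 0 \<notin> P"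
  shows "unit_mod (monom 1 n) f"
proof -
  obtain c where c: "c \<in> D" "c * coeff f 0 - 1 \<in> P"
    using inverse_ex[OF poly_over_coeff[OF f] f0] by blast
  obtain a k where fk: "f = pCons a k"
    by (cases f) auto
  have kD: "k \<in> poly_over D"
    using f by (simp add: fk poly_over_pCons)
  define x where "x = - (monom 1 1 * Polynomial.smult c k)"
  have xD: "x \<in> poly_over D"
    unfolding x_def using c kD by (intro X.S_uminus poly_over_mult X_in poly_over_smult)
  define v where "v = (\<Sum>i<n. x ^ i)"
  have vD: "v \<in> poly_over D"
    unfolding v_def using xD by (intro X.S_sum X.S_power)
  have cf: "[:c:] * f - (1 - x) = [:c * coeff f 0 - 1:]"
    by (simp add: x_def fk monom_Suc one_pCons)
  have "(v * [:c:]) * f - 1 - (- ((- Polynomial.smult c k) ^ n)) * monom 1 n =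
      v * ([:c:] * f - (1 - x)) + ((1 - x) * v - (1 - x ^ n)) +
      ((- Polynomial.smult c k) ^ n * monom 1 n - x ^ n)"
    by (simp add: algebra_simps)
  also have "(1 - x) * v - (1 - x ^ n) = 0"
    by (simp add: v_def one_diff_power_eq)
  also have "(- Polynomial.smult c k) ^ n * monom 1 n - x ^ n = 0"
  proof -
    have "x = monom 1 1 * (- Polynomial.smult c k)"
      by (simp add: x_def)
    then have "x ^ n = monom 1 n * (- Polynomial.smult c k) ^ n"
      by (metis power_mult_distrib monom_power power_one mult_1)
    then show ?thesis
      by (simp add: mult.commute)
  qed
  also have "v * ([:c:] * f - (1 - x)) + 0 + 0 \<in> poly_over P"
    unfolding cf using X.I_mult[OF vD const_in[OF c(2)]] by (simp only: add_0_right)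
  finally have "(v * [:c:]) * f - 1 - (- ((- Polynomial.smult c k) ^ n)) * monom 1 n \<in> poly_over P" .
  moreover have "v * [:c:] \<in> poly_over D"
    using vD c by (intro poly_over_mult) (auto simp: poly_over_pCons poly_over_0)
  moreover have "- ((- Polynomial.smult c k) ^ n) \<in> poly_over D"
    using c kD by (intro X.S_uminus X.S_power poly_over_smult)
  ultimately show ?thesis
    unfolding unit_mod_def using f by blast
qed

lemma ex_monom_factor:
  fixes f :: "'k poly"
  assumes "f \<noteq> 0"
  shows "\<exists>k g. f = monom 1 k * g \<and> coeff g 0 \<noteq> 0"
  using assms
proof (induction f)
  case (pCons a f)
  show ?case
  proof (cases "a = 0")
    case True
    then obtain k g where "f = monom 1 k * g" "coeff g 0 \<noteq> 0"
      using pCons by auto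
    then show ?thesis
      using True by (intro exI[of _ "Suc k"] exI[of _ g]) (auto simp: monom_Suc)
  next
    case False
    then show ?thesis
      by (intro exI[of _ 0] exI[of _ "pCons a f"]) auto
  qed
qed simp

text \<open>\<open>Y\<close> holds every possible cofactor of a power of \<open>X\<close> in a
  reduced characteristic polynomial. These cofactors are units modulo \<open>X^n\<close> and
  contribute only a factor outside \<open>P\<close> to the determinant, so all divisibility by
  \<open>P\<close> in \<open>det G(M)\<close> comes from \<open>M^(n-1)\<close>, where
  \<open>M^n = p\<close>.\<close>

lemma separate_nilpotent:
  assumes n: "n \<ge> 1" and p: "p \<in> P" and B: "B \<subseteq> Mn D n"
    and none: "\<And>b. b \<in> B \<Longrightarrow> mat_eval n (monom 1 n) b \<in> Mn P n \<Longrightarrow>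
      mat_eval n (monom 1 (n - 1)) b \<in> Mn P n"
  obtains G M s where "G \<in> poly_over D" "\<And>b. b \<in> B \<Longrightarrow> mat_eval n G b \<in> Mn P n"
    "M \<in> Mn D n" "s \<in> D" "s \<notin> P" "det (mat_eval n G M) ^ n = p ^ (n * (n - 1)) * s"
proof
  define Y where "Y = {f \<in> polys_below T (Suc n). coeff f 0 \<noteq> 0}"
  define G where "G = monom 1 (n - 1) * \<Prod>Y"
  define h where "h = monom 1 n - [:p:]"
  define M where "M = companion n h"
  have Yfin: "finite Y"
    using polys_below_card[OF T_finite T_zero, of "Suc n"] by (simp add: Y_def)
  have YD: "f \<in> poly_over D" if "f \<in> Y" for f
    using that poly_over_reduced by (auto simp: Y_def)
  have unit: "unit_mod (monom 1 n) f" if f: "f \<in> Y" for f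
  proof (rule unit_mod_monom[OF YD[OF f]])
    show "coeff f 0 \<notin> P"
      using f rep_in_I[of "coeff f 0"] by (auto simp: Y_def polys_below_def)
  qed
  have pD: "p \<in> D"
    using p I_in_S by auto
  have hD: "h \<in> poly_over D"
    using pD by (auto simp: h_def poly_over_pCons poly_over_0 intro!: poly_over_diff X_in)
  have hc: "coeff h i = (if i = n then 1 else if i = 0 then - p else 0)" for i
    using n by (auto simp: h_def coeff_pCons split: nat.split)
  have hdeg: "degree h = n"
    by (intro antisym degree_le le_degree) (auto simp: hc)
  show MM: "M \<in> Mn D n"
    unfolding M_def by (rule companion_Mn[OF hD])
  note Mc = Mn_carrier[OF MM]
  have "mat_eval n h M = 0\<^sub>m n n"
    unfolding M_def by (rule mat_eval_companion[OF n hdeg]) (simp add: hdeg hc)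
  moreover have "monom 1 n = h + [:p:]"
    by (simp add: h_def)
  ultimately have Mn: "mat_eval n (monom 1 n) M = p \<cdot>\<^sub>m 1\<^sub>m n"
    by (simp add: mat_eval_add[OF Mc] mat_eval_const[OF Mc])
  show "G \<in> poly_over D"
    unfolding G_def using YD by (intro X.S_prod poly_over_mult X_in)
  show "mat_eval n G b \<in> Mn P n" if b: "b \<in> B" for b
  proof -
    have bM: "b \<in> Mn D n"
      using b B by auto
    obtain f where f: "f \<in> polys_below T (Suc n)" "coeff f n = 1"
      "mat_eval n f b \<in> Mn P n"
      using char_poly_reduced[OF bM] by metis
    have "f \<noteq> 0"
      using f by auto
    then obtain k g where g: "f = monom 1 k * g" "coeff g 0 \<noteq> 0"
      using ex_monom_factor by blast
    have gf: "coeff g i = coeff f (i + k)" for i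
      by (simp add: g(1) coeff_monom_mult)
    have kn: "k \<le> n"
      using f(2) by (auto simp: g(1) coeff_monom_mult split: if_splits)
    \<comment> \<open>Here \<open>k\<close> is the multiplicity of the root 0. For
      \<open>k < n\<close> the factor \<open>X^(n-1)\<close> of \<open>G\<close> absorbs
      \<open>X^k\<close>; for \<open>k = n\<close> the matrix is nilpotent modulo \<open>P\<close>,
      and \<open>none\<close> lowers the exponent by one.\<close>
    show ?thesis
    proof (cases "k = n")
      case True
      have "g = 1"
      proof (rule poly_eqI)
        show "coeff g i = coeff 1 i" for i
          using f by (cases "i = 0") (auto simp: gf True polys_below_def)
      qed
      then have "mat_eval n (monom 1 n) b \<in> Mn P n"
        using f True by (simp add: g)
      then have "mat_eval n (monom 1 (n - 1)) b \<in> Mn P n"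
        by (rule none[OF b])
      then have "mat_eval n (\<Prod>Y * monom 1 (n - 1)) b \<in> Mn P n"
        using YD by (intro mat_eval_dvd_MnP[OF _ bM] X.S_prod)
      then show ?thesis
        by (simp add: G_def mult.commute)
    next
      case False
      have "g \<in> Y"
        using f g by (auto simp: Y_def polys_below_def gf)
      then have "\<Prod>Y = g * \<Prod>(Y - {g})"
        using Yfin by (simp add: prod.remove[of Y g])
      moreover have "monom (1::'k) (n - 1) = monom 1 (n - 1 - k) * monom 1 k"
        using False kn by (simp add: mult_monom)
      ultimately have "G = (monom 1 (n - 1 - k) * \<Prod>(Y - {g})) * f"
        by (simp add: G_def g(1) mult_ac)
      moreover have "monom 1 (n - 1 - k) * \<Prod>(Y - {g}) \<in> poly_over D"
        using YD by (intro X.S_prod poly_over_mult X_in) auto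
      ultimately show ?thesis
        using mat_eval_dvd_MnP[OF _ bM f(3)] by simp
    qed
  qed
  define s where "s = det (mat_eval n (\<Prod>Y) M)"
  have YpD: "\<Prod>Y \<in> poly_over D"
    using YD by (intro X.S_prod)
  have "s \<in> D"
    unfolding s_def using Mn_entry[OF mat_eval_Mn[OF YpD MM]] by (intro det_in[of _ n]) (auto simp: Mc)
  then show "s ^ n \<in> D"
    by (rule S_power)
  have "s \<notin> P"
    unfolding s_def
  proof (rule det_unit_mod[OF _ MM])
    show "unit_mod (monom 1 n) (\<Prod>Y)"
      using unit by (intro unit_mod_prod X_in)
    show "mat_eval n (monom 1 n) M \<in> Mn P n"
      using p I_zero by (auto simp: Mn Mn_def)
  qed
  then show "s ^ n \<notin> P"
    using power_in_I[OF \<open>s \<in> D\<close>] by blast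
  define d where "d = det (mat_eval n (monom 1 (n - 1)) M)"
  have "det (mat_eval n G M) = d * s"
    by (simp add: G_def d_def s_def mat_eval_mult[OF Mc]
        det_mult[OF mat_eval_carrier[OF Mc] mat_eval_carrier[OF Mc]])
  \<comment> \<open>Passing to \<open>n\<close>-th powers uses only \<open>M^n = p\<close> and
    avoids the sign in \<open>det M\<close>.\<close>
  moreover have "d ^ n = p ^ (n * (n - 1))"
  proof -
    have pw: "det (mat_eval n (monom 1 k) M) = det M ^ k" for k
    proof (induction k)
      case (Suc k)
      have "monom 1 (Suc k) = [:0, 1:] * monom (1::'k) k"
        by (simp add: monom_Suc)
      then have "mat_eval n (monom 1 (Suc k)) M = M * mat_eval n (monom 1 k) M"
        by (metis mat_eval_mult[OF Mc] mat_eval_X[OF Mc])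
      then show ?case
        using det_mult[OF Mc mat_eval_carrier[OF Mc]] Suc by simp
    qed (simp add: mat_eval_1[OF Mc])
    have "det M ^ n = p ^ n"
      using pw[of n] by (simp add: Mn)
    then have "(det M ^ n) ^ (n - 1) = p ^ (n * (n - 1))"
      by (simp add: power_mult)
    then show ?thesis
      unfolding d_def pw by (simp add: power_mult[symmetric] mult.commute)
  qed
  ultimately show "det (mat_eval n G M) ^ n = p ^ (n * (n - 1)) * s ^ n"
    by (simp add: power_mult_distrib)
qed

end

section \<open>Cyclic vectors, rank one matrices and matrix units modulo P\<close>

context residue_field
begin

text \<open>The condition says that \<open>v\<close> and its images under the first \<open>n - 1\<close> powers of \<open>C\<close> are linearly
  independent modulo \<open>P\<close>; that they span is a counting argument.\<close>
lemma cyclic_vector_spans: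
  assumes C: "C \<in> Mn D n" and v: "\<And>i. i < n \<Longrightarrow> v i \<in> D" and x: "\<And>i. i < n \<Longrightarrow> x i \<in> D"
    and ind: "\<And>g. g \<in> poly_over D \<Longrightarrow> (\<And>i. i \<ge> n \<Longrightarrow> coeff g i = 0) \<Longrightarrow>
      (\<And>r. r < n \<Longrightarrow> (\<Sum>s<n. mat_eval n g C $$ (r, s) * v s) \<in> P) \<Longrightarrow> g \<in> poly_over P"
  obtains g where "g \<in> poly_over D" "\<And>r. r < n \<Longrightarrow> (\<Sum>s<n. mat_eval n g C $$ (r, s) * v s) - x r \<in> P"
proof -
  define act where "act g r = (\<Sum>s<n. mat_eval n g C $$ (r, s) * v s)" for g r
  define F where "F g = restrict (\<lambda>r. rep (act g r)) {..<n}" for g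
  define R where "R = polys_below T n"
  define V where "V = (PiE {..<n} (\<lambda>_. T))"
  note Cc = Mn_carrier[OF C]
  have actD: "act g r \<in> D" if "g \<in> poly_over D" "r < n" for g r
    unfolding act_def using that v Mn_entry[OF mat_eval_Mn[OF that(1) C]] by (intro S_sum S_mult) auto
  have RD: "g \<in> poly_over D" if "g \<in> R" for g
    using that poly_over_reduced by (auto simp: R_def)
  have "inj_on F R"
  proof
    fix g g' assume g: "g \<in> R" "g' \<in> R" "F g = F g'"
    have "act (g - g') r \<in> P" if r: "r < n" for r
    proof -
      have "rep (act g r) = rep (act g' r)"
        using g(3) r by (metis F_def lessThan_iff restrict_apply')
      then have "act g r - act g' r \<in> P"
        using rep[OF actD[OF RD[OF g(1)] r]] rep[OF actD[OF RD[OF g(2)] r]] cong_trans[OF _ cong_sym]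
        by metis
      moreover have "act (g - g') r = act g r - act g' r"
        using r by (simp add: act_def mat_eval_diff_entry[OF Cc] left_diff_distrib sum_subtractf)
      ultimately show ?thesis
        by simp
    qed
    then have "g - g' \<in> poly_over P"
      using g poly_over_diff[OF RD RD] by (intro ind) (auto simp: act_def R_def polys_below_def)
    then have "coeff g i = coeff g' i" for i
      using g T_unique[of "coeff g i" "coeff g' i"] by (auto simp: R_def polys_below_def poly_over_def)
    then show "g = g'"
      by (rule poly_eqI)
  qed
  moreover have "F g \<in> V" if "g \<in> R" for g
    using rep actD[OF RD[OF that]] by (simp add: F_def V_def restrict_PiE_iff)
  then have "F ` R \<subseteq> V"
    by blast
  moreover have "finite V" "card V = card R"
    using T_finite polys_below_card[OF T_finite T_zero, of n]
    by (auto simp: V_def R_def card_PiE intro!: finite_PiE)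
  ultimately have "F ` R = V"
    by (metis card_image card_subset_eq)
  moreover have "restrict (\<lambda>r. rep (x r)) {..<n} \<in> V"
    using rep x by (simp add: V_def restrict_PiE_iff)
  ultimately obtain g where g: "g \<in> R" "F g = restrict (\<lambda>r. rep (x r)) {..<n}"
    by (metis imageE)
  show ?thesis
  proof (rule that[of g])
    show "g \<in> poly_over D"
      using RD g by blast
    fix r assume r: "r < n"
    have "rep (act g r) = rep (x r)"
      using g(2) r by (metis F_def lessThan_iff restrict_apply')
    then show "(\<Sum>s<n. mat_eval n g C $$ (r, s) * v s) - x r \<in> P"
      using rep[OF actD[OF RD[OF g(1)] r]] rep[OF x[OF r]] cong_trans[OF _ cong_sym]
      unfolding act_def by metis
  qed
qed

text \<open>Every vector that is nonzero modulo \<open>P\<close> is cyclic for \<open>C\<close>: if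
  \<open>g(C) v\<close> vanishes modulo \<open>P\<close> and \<open>g\<close> does not, then
  applying the inverse \<open>u\<close> of \<open>g\<close> modulo \<open>h\<close> makes
  \<open>v\<close> vanish, because \<open>h(C)\<close> does.\<close>

lemma irreducible_spans:
  assumes h: "irreducible_mod n h" and C: "C \<in> Mn D n" and cp: "char_poly C - h \<in> poly_over P"
    and v: "\<And>i. i < n \<Longrightarrow> v i \<in> D" and k: "k < n" "v k \<notin> P" and x: "\<And>i. i < n \<Longrightarrow> x i \<in> D"
  obtains g where "g \<in> poly_over D" "\<And>r. r < n \<Longrightarrow> (\<Sum>s<n. mat_eval n g C $$ (r, s) * v s) - x r \<in> P"
proof (rule cyclic_vector_spans[OF C v x _ that])
  fix g assume g: "g \<in> poly_over D" "\<And>i. i \<ge> n \<Longrightarrow> coeff g i = 0"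
    and gv: "\<And>r. r < n \<Longrightarrow> (\<Sum>s<n. mat_eval n g C $$ (r, s) * v s) \<in> P"
  note Cc = Mn_carrier[OF C]
  show "g \<in> poly_over P"
  proof (rule ccontr)
    assume "g \<notin> poly_over P"
    then obtain u w where u: "u \<in> poly_over D" "w \<in> poly_over D" "u * g - 1 - w * h \<in> poly_over P"
      using h g by (auto simp: irreducible_mod_def unit_mod_def)
    have "mat_eval n h C \<in> Mn P n"
      by (rule mat_eval_cong_MnP[OF X.cong_sym[OF cp] C])
        (use I_zero in \<open>simp add: cayley_hamilton[OF Cc] Mn_def\<close>)
    then have wh: "mat_eval n (w * h) C \<in> Mn P n"
      by (rule mat_eval_dvd_MnP[OF u(2) C])
    have "(\<Sum>s<n. mat_eval n (u * g) C $$ (k, s) * v s) =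
        (\<Sum>s<n. \<Sum>t<n. mat_eval n u C $$ (k, t) * mat_eval n g C $$ (t, s) * v s)"
      using k by (simp add: mat_eval_mult[OF Cc] mat_mult_entry[OF mat_eval_carrier[OF Cc] mat_eval_carrier[OF Cc]]
          sum_distrib_right)
    also have "\<dots> = (\<Sum>t<n. mat_eval n u C $$ (k, t) * (\<Sum>s<n. mat_eval n g C $$ (t, s) * v s))"
      by (subst sum.swap) (simp add: sum_distrib_left mult.assoc)
    also have "\<dots> \<in> P"
      by (rule I_sum, rule I_mult) (use k gv Mn_entry[OF mat_eval_Mn[OF u(1) C]] in auto)
    finally have 1: "(\<Sum>s<n. mat_eval n (u * g) C $$ (k, s) * v s) \<in> P" .
    have 2: "(\<Sum>s<n. (mat_eval n (u * g - 1 - w * h) C $$ (k, s) + mat_eval n (w * h) C $$ (k, s)) * v s) \<in> P"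
      using k v Mn_entry[OF mat_eval_MnP[OF u(3) C]] Mn_entry[OF wh] by (intro I_sum I_mult2 I_add) auto
    have "(\<Sum>s<n. (mat_eval n (u * g - 1 - w * h) C $$ (k, s) + mat_eval n (w * h) C $$ (k, s)) * v s) =
        (\<Sum>s<n. mat_eval n (u * g) C $$ (k, s) * v s - (if s = k then v s else 0))"
      using k by (intro sum.cong refl)
        (auto simp: mat_eval_diff_entry[OF Cc] mat_eval_1[OF Cc] left_diff_distrib)
    also have "\<dots> = (\<Sum>s<n. mat_eval n (u * g) C $$ (k, s) * v s) - v k"
      using k by (simp add: sum_subtractf)
    finally have "v k = (\<Sum>s<n. mat_eval n (u * g) C $$ (k, s) * v s) -
        (\<Sum>s<n. (mat_eval n (u * g - 1 - w * h) C $$ (k, s) + mat_eval n (w * h) C $$ (k, s)) * v s)"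
      by simp
    then have "v k \<in> P"
      using I_diff[OF 1 2] by simp
    then show False
      using k by simp
  qed
qed

lemma mat_eval_nilpotent:
  assumes b: "b \<in> Mn D n" and bn: "mat_eval n (monom 1 n) b \<in> Mn P n"
    and f: "f \<in> poly_over D" "\<And>i. i < n \<Longrightarrow> coeff f i \<in> P"
  shows "mat_eval n f b \<in> Mn P n"
proof -
  have deg: "degree (monom (1::'k) n) = n" "lead_coeff (monom (1::'k) n) = 1"
    by (auto simp: degree_monom_eq)
  obtain w r where wr: "w \<in> poly_over D" "r \<in> poly_over D" "f = w * monom 1 n + r"
    "\<And>i. i \<ge> n \<Longrightarrow> coeff r i = 0"
    using monic_division[OF X_in deg(2) f(1)] deg(1) by metis
  have "coeff r i \<in> P" for i
  proof (cases "i < n")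
    case True
    then have "coeff f i = coeff r i"
      by (simp add: wr(3) mult.commute[of w] coeff_monom_mult)
    then show ?thesis
      using f True by metis
  qed (use wr I_zero in auto)
  then have "f - w * monom 1 n \<in> poly_over P"
    by (simp add: wr(3) poly_over_def)
  then show ?thesis
    by (rule mat_eval_cong_MnP[OF _ b mat_eval_dvd_MnP[OF wr(1) b bn]])
qed

text \<open>Write \<open>N\<close> for the power \<open>b^(n-1)\<close>. The basis vector with index
  \<open>l\<close> is cyclic for \<open>b\<close>, since \<open>N\<close> does not annihilate it;
  thus every basis vector is \<open>g j\<close> evaluated at \<open>b\<close> and applied to it. As
  \<open>b^n\<close> vanishes modulo \<open>P\<close>, the product of \<open>N\<close> and
  \<open>g j\<close> at \<open>b\<close> retains only the constant coefficient, so all columns of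
  \<open>N\<close> are multiples of its column \<open>l\<close>.\<close>

lemma nilpotent_rank_one:
  assumes n: "n \<ge> 1" and b: "b \<in> Mn D n" and bn: "mat_eval n (monom 1 n) b \<in> Mn P n"
    and kl: "k < n" "l < n" "mat_eval n (monom 1 (n - 1)) b $$ (k, l) \<notin> P"
  obtains z y where "\<And>i. i < n \<Longrightarrow> z i \<in> D" "\<And>i. i < n \<Longrightarrow> y i \<in> D" "z k \<notin> P" "y l \<notin> P"
    "\<And>i j. i < n \<Longrightarrow> j < n \<Longrightarrow> mat_eval n (monom 1 (n - 1)) b $$ (i, j) - z i * y j \<in> P"
proof -
  note bc = Mn_carrier[OF b]
  define v where "v s = (if s = l then 1 else 0 :: 'k)" for s
  define z where "z i = mat_eval n (monom 1 (n - 1)) b $$ (i, l)" for i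
  have act: "(\<Sum>s<n. A $$ (r, s) * v s) = A $$ (r, l)" for A :: "'k mat" and r
  proof -
    have "(\<Sum>s<n. A $$ (r, s) * v s) = (\<Sum>s<n. if s = l then A $$ (r, s) else 0)"
      by (intro sum.cong) (auto simp: v_def)
    then show ?thesis
      using kl by simp
  qed
  have ind: "g \<in> poly_over P"
    if g: "g \<in> poly_over D" "\<And>i. i \<ge> n \<Longrightarrow> coeff g i = 0"
      and gl: "\<And>r. r < n \<Longrightarrow> mat_eval n g b $$ (r, l) \<in> P" for g
  proof (rule ccontr)
    assume "g \<notin> poly_over P"
    then have "\<exists>i. coeff g i \<notin> P"
      by (auto simp: poly_over_def)
    define i where "i = (LEAST i. coeff g i \<notin> P)"
    have i: "coeff g i \<notin> P"
      unfolding i_def using \<open>\<exists>i. _\<close> by (rule LeastI_ex)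
    have imin: "coeff g j \<in> P" if "j < i" for j
      using that not_less_Least unfolding i_def by blast
    have iN: "i < n"
      using i g(2)[of i] I_zero by (cases "i < n") auto
    \<comment> \<open>The shift by \<open>X^(n-1-i)\<close> moves the lowest coefficient outside
      \<open>P\<close> to position \<open>n - 1\<close> and all later ones to where \<open>b\<close>
      annihilates them. What remains is \<open>coeff g i\<close> times column \<open>l\<close>,
      which is nonzero modulo \<open>P\<close> in row \<open>k\<close>.\<close>
    define f where "f = monom 1 (n - 1 - i) * g - Polynomial.smult (coeff g i) (monom 1 (n - 1))"
    have ci: "coeff g i \<in> D"
      using g poly_over_coeff by blast
    have "f \<in> poly_over D"
      unfolding f_def using g ci by (intro poly_over_diff poly_over_mult X_in poly_over_smult)
    moreover have "coeff f j \<in> P" if "j < n" for j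
    proof (cases "j = n - 1")
      case True
      then show ?thesis
        using iN I_zero diff_le_self[of "n - 1" i] by (simp add: f_def coeff_monom_mult)
    next
      case False
      then show ?thesis
        using that iN imin I_zero by (auto simp: f_def coeff_monom_mult)
    qed
    ultimately have "mat_eval n f b \<in> Mn P n"
      by (rule mat_eval_nilpotent[OF b bn])
    then have "mat_eval n (monom 1 (n - 1 - i) * g) b $$ (k, l) - coeff g i * z k \<in> P"
      using Mn_entry[of "mat_eval n f b" P n k l] kl carrier_matD[OF mat_eval_carrier[OF bc]]
      by (simp add: f_def mat_eval_diff_entry[OF bc] mat_eval_smult[OF bc] z_def)
    moreover have "mat_eval n (monom 1 (n - 1 - i) * g) b $$ (k, l) \<in> P"
    proof -
      have "mat_eval n (monom 1 (n - 1 - i) * g) b $$ (k, l) =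
          (\<Sum>s<n. mat_eval n (monom 1 (n - 1 - i)) b $$ (k, s) * mat_eval n g b $$ (s, l))"
        using kl by (simp add: mat_eval_mult[OF bc] mat_mult_entry[OF mat_eval_carrier[OF bc] mat_eval_carrier[OF bc]])
      also have "\<dots> \<in> P"
        using kl gl Mn_entry[OF mat_eval_Mn[OF X_in b]] by (intro I_sum I_mult) auto
      finally show ?thesis .
    qed
    ultimately have "coeff g i * z k \<in> P"
      using cong_mem[OF cong_sym] by blast
    moreover have "z k \<in> D" "z k \<notin> P"
      using kl Mn_entry[OF mat_eval_Mn[OF X_in b]] by (auto simp: z_def)
    ultimately show False
      using prime[OF ci] i by blast
  qed
  have "\<exists>g\<in>poly_over D. \<forall>r<n. mat_eval n g b $$ (r, l) - (if r = j then 1 else 0) \<in> P" for j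
  proof -
    obtain g where "g \<in> poly_over D"
      "\<And>r. r < n \<Longrightarrow> (\<Sum>s<n. mat_eval n g b $$ (r, s) * v s) - (if r = j then 1 else 0) \<in> P"
      by (rule cyclic_vector_spans[OF b, of v "\<lambda>r. if r = j then 1 else 0"])
        (use S_zero S_one ind in \<open>auto simp: v_def act[unfolded v_def]\<close>)
    then show ?thesis
      unfolding act by blast
  qed
  then obtain g where g: "\<And>j. g j \<in> poly_over D"
    "\<And>j r. r < n \<Longrightarrow> mat_eval n (g j) b $$ (r, l) - (if r = j then 1 else 0) \<in> P"
    by metis
  define y where "y j = coeff (g j) 0" for j
  have yD: "y j \<in> D" for j
    unfolding y_def using g poly_over_coeff by blast
  have zD: "z i \<in> D" if "i < n" for i
    using that kl Mn_entry[OF mat_eval_Mn[OF X_in b]] by (auto simp: z_def)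
  have main: "mat_eval n (monom 1 (n - 1)) b $$ (i, j) - z i * y j \<in> P" if ij: "i < n" "j < n" for i j
  proof -
    define f where "f = monom 1 (n - 1) * g j - Polynomial.smult (y j) (monom 1 (n - 1))"
    have "f \<in> poly_over D"
      unfolding f_def using g yD by (intro poly_over_diff poly_over_mult X_in poly_over_smult)
    moreover have "coeff f t \<in> P" if "t < n" for t
      using that I_zero by (auto simp: f_def coeff_monom_mult y_def)
    ultimately have "mat_eval n f b \<in> Mn P n"
      by (rule mat_eval_nilpotent[OF b bn])
    then have 1: "mat_eval n (monom 1 (n - 1) * g j) b $$ (i, l) - z i * y j \<in> P"
      using Mn_entry[of "mat_eval n f b" P n i l] ij kl carrier_matD[OF mat_eval_carrier[OF bc]]
      by (simp add: f_def mat_eval_diff_entry[OF bc] mat_eval_smult[OF bc] z_def mult.commute)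
    have "mat_eval n (monom 1 (n - 1) * g j) b $$ (i, l) - mat_eval n (monom 1 (n - 1)) b $$ (i, j) =
        (\<Sum>s<n. mat_eval n (monom 1 (n - 1)) b $$ (i, s) * mat_eval n (g j) b $$ (s, l)) -
        (\<Sum>s<n. if s = j then mat_eval n (monom 1 (n - 1)) b $$ (i, s) else 0)"
      using ij kl by (simp add: mat_eval_mult[OF bc] mat_mult_entry[OF mat_eval_carrier[OF bc] mat_eval_carrier[OF bc]])
    also have "\<dots> = (\<Sum>s<n. mat_eval n (monom 1 (n - 1)) b $$ (i, s) *
        (mat_eval n (g j) b $$ (s, l) - (if s = j then 1 else 0)))"
      unfolding sum_subtractf[symmetric] by (intro sum.cong) (auto simp: algebra_simps)
    also have "\<dots> \<in> P"
      using ij g Mn_entry[OF mat_eval_Mn[OF X_in b]] by (intro I_sum I_mult) auto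
    finally have "mat_eval n (monom 1 (n - 1) * g j) b $$ (i, l) - mat_eval n (monom 1 (n - 1)) b $$ (i, j) \<in> P" .
    from cong_trans[OF cong_sym[OF this] 1] show ?thesis .
  qed
  have yl: "y l \<notin> P"
  proof
    assume "y l \<in> P"
    then have "z k * y l \<in> P"
      using I_mult zD kl by blast
    then show False
      using cong_mem[OF main[OF kl(1,2)]] kl by blast
  qed
  show ?thesis
    by (rule that[of z y, OF zD yD _ yl main]) (use kl in \<open>simp_all add: z_def\<close>)
qed

text \<open>Modulo \<open>P\<close> the matrix in the middle is a column \<open>z\<close> times a
  row \<open>y\<close>. A polynomial in \<open>C\<close> carries \<open>z\<close> to the basis
  vector of index \<open>p\<close>, and one in the transpose of \<open>C\<close>, which has the same
  characteristic polynomial, carries \<open>y\<close> to that of index \<open>q\<close>.\<close>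

lemma matrix_unit_mod:
  assumes n: "n \<ge> 1" and h: "irreducible_mod n h"
    and C: "C \<in> Mn D n" "char_poly C - h \<in> poly_over P"
    and b: "b \<in> Mn D n" "mat_eval n (monom 1 n) b \<in> Mn P n" "mat_eval n (monom 1 (n - 1)) b \<notin> Mn P n"
    and pq: "p < n" "q < n"
  obtains f g where "f \<in> poly_over D" "g \<in> poly_over D"
    "\<And>i j. i < n \<Longrightarrow> j < n \<Longrightarrow>
      (mat_eval n f C * (mat_eval n (monom 1 (n - 1)) b * mat_eval n g C)) $$ (i, j) -
      (if i = p \<and> j = q then 1 else 0) \<in> P"
proof -
  define N where "N = mat_eval n (monom 1 (n - 1)) b"
  have NM: "N \<in> Mn D n"
    unfolding N_def by (rule mat_eval_Mn[OF X_in b(1)])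
  note Cc = Mn_carrier[OF C(1)] and Nc = Mn_carrier[OF NM]
  obtain k l where kl: "k < n" "l < n" "N $$ (k, l) \<notin> P"
    using b(3) Nc by (auto simp: N_def Mn_def)
  obtain z y where zy: "\<And>i. i < n \<Longrightarrow> z i \<in> D" "\<And>i. i < n \<Longrightarrow> y i \<in> D" "z k \<notin> P" "y l \<notin> P"
    "\<And>i j. i < n \<Longrightarrow> j < n \<Longrightarrow> N $$ (i, j) - z i * y j \<in> P"
    using nilpotent_rank_one[OF n b(1,2) kl[unfolded N_def]] unfolding N_def by metis
  obtain f where f: "f \<in> poly_over D"
    "\<And>r. r < n \<Longrightarrow> (\<Sum>s<n. mat_eval n f C $$ (r, s) * z s) - (if r = p then 1 else 0) \<in> P"
    by (rule irreducible_spans[OF h C, of z k "\<lambda>r. if r = p then 1 else 0"])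
      (use S_zero S_one zy kl in auto)
  have Ct: "transpose_mat C \<in> Mn D n" "char_poly (transpose_mat C) - h \<in> poly_over P"
    using C Cc char_poly_transpose_mat[OF Cc] by (auto simp: Mn_def)
  obtain g where g: "g \<in> poly_over D"
    "\<And>r. r < n \<Longrightarrow> (\<Sum>s<n. mat_eval n g (transpose_mat C) $$ (r, s) * y s) - (if r = q then 1 else 0) \<in> P"
    by (rule irreducible_spans[OF h Ct, of y l "\<lambda>r. if r = q then 1 else 0"])
      (use S_zero S_one zy kl in auto)
  have ftM: "mat_eval n f C \<in> Mn D n" and gtM: "mat_eval n g C \<in> Mn D n"
    using mat_eval_Mn C f g by auto
  note fc = Mn_carrier[OF ftM] and gc = Mn_carrier[OF gtM]
  have g': "(\<Sum>s<n. mat_eval n g C $$ (s, r) * y s) - (if r = q then 1 else 0) \<in> P" if "r < n" for r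
  proof -
    have "(\<Sum>s<n. mat_eval n g (transpose_mat C) $$ (r, s) * y s) = (\<Sum>s<n. mat_eval n g C $$ (s, r) * y s)"
      using that carrier_matD[OF gc] by (intro sum.cong) (auto simp: mat_eval_transpose[OF Cc])
    then show ?thesis
      using g(2)[OF that] by simp
  qed
  show ?thesis
  proof (rule that[OF f(1) g(1)], fold N_def)
    fix i j assume ij: "i < n" "j < n"
    have "(mat_eval n f C * (N * mat_eval n g C)) $$ (i, j) =
        (\<Sum>s<n. \<Sum>t<n. mat_eval n f C $$ (i, s) * (N $$ (s, t) * mat_eval n g C $$ (t, j)))"
      using ij by (simp add: mat_mult_entry[OF fc mult_carrier_mat[OF Nc gc]] mat_mult_entry[OF Nc gc]
          sum_distrib_left del: index_mult_mat(1))
    moreover have "(\<Sum>s<n. mat_eval n f C $$ (i, s) * z s) * (\<Sum>t<n. mat_eval n g C $$ (t, j) * y t) =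
        (\<Sum>s<n. \<Sum>t<n. mat_eval n f C $$ (i, s) * (z s * y t * mat_eval n g C $$ (t, j)))"
      unfolding sum_product by (intro sum.cong) (auto simp: mult_ac)
    ultimately have "(mat_eval n f C * (N * mat_eval n g C)) $$ (i, j) -
        (\<Sum>s<n. mat_eval n f C $$ (i, s) * z s) * (\<Sum>t<n. mat_eval n g C $$ (t, j) * y t) =
        (\<Sum>s<n. \<Sum>t<n. mat_eval n f C $$ (i, s) * ((N $$ (s, t) - z s * y t) * mat_eval n g C $$ (t, j)))"
      by (simp add: sum_subtractf algebra_simps)
    also have "\<dots> \<in> P"
      using ij zy Mn_entry[OF ftM] Mn_entry[OF gtM] by (intro I_sum I_mult I_mult2) auto
    finally have 1: "(mat_eval n f C * (N * mat_eval n g C)) $$ (i, j) -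
        (\<Sum>s<n. mat_eval n f C $$ (i, s) * z s) * (\<Sum>t<n. mat_eval n g C $$ (t, j) * y t) \<in> P" .
    have "(\<Sum>s<n. mat_eval n f C $$ (i, s) * z s) \<in> D"
      using ij zy Mn_entry[OF ftM] by (intro S_sum S_mult) auto
    then have 2: "(\<Sum>s<n. mat_eval n f C $$ (i, s) * z s) * (\<Sum>t<n. mat_eval n g C $$ (t, j) * y t) -
        (if i = p then 1 else 0) * (if j = q then 1 else 0) \<in> P"
      using cong_mult[OF f(2)[OF ij(1)] g'[OF ij(2)]] S_zero S_one by auto
    have "(if i = p then 1 else 0) * (if j = q then 1 else 0) = (if i = p \<and> j = q then 1 else (0::'k))"
      by simp
    then show "(mat_eval n f C * (N * mat_eval n g C)) $$ (i, j) - (if i = p \<and> j = q then 1 else 0) \<in> P"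
      using cong_trans[OF 1 2] by simp
  qed
qed

lemma linear_combination_in:
  fixes m :: nat
  assumes add: "\<And>x y. x \<in> B \<Longrightarrow> y \<in> B \<Longrightarrow> x + y \<in> B"
    and smult: "\<And>c x. c \<in> D \<Longrightarrow> x \<in> B \<Longrightarrow> c \<cdot>\<^sub>m x \<in> B"
    and B: "B \<subseteq> Mn D n" "B \<noteq> {}" and c: "\<And>r. r < m \<Longrightarrow> c r \<in> D" and x: "\<And>r. r < m \<Longrightarrow> x r \<in> B"
  shows "mat n n (\<lambda>(i, j). \<Sum>r<m. c r * x r $$ (i, j)) \<in> B"
  using c x
proof (induction m)
  case 0
  obtain b where b: "b \<in> B"
    using B by blast
  then have "0 \<cdot>\<^sub>m b \<in> B"
    using smult S_zero by blast
  moreover have "0 \<cdot>\<^sub>m b = mat n n (\<lambda>_. 0)"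
    using carrier_matD[OF Mn_carrier[OF subsetD[OF B(1) b]]] by (intro eq_matI) auto
  ultimately show ?case
    by simp
next
  case (Suc m)
  have "mat n n (\<lambda>(i, j). \<Sum>r<m. c r * x r $$ (i, j)) \<in> B"
    by (rule Suc.IH) (use Suc.prems in auto)
  then have "mat n n (\<lambda>(i, j). \<Sum>r<m. c r * x r $$ (i, j)) + c m \<cdot>\<^sub>m x m \<in> B"
    using Suc.prems by (intro add smult) auto
  moreover have "mat n n (\<lambda>(i, j). \<Sum>r<m. c r * x r $$ (i, j)) + c m \<cdot>\<^sub>m x m =
      mat n n (\<lambda>(i, j). \<Sum>r<Suc m. c r * x r $$ (i, j))"
    using carrier_matD[OF Mn_carrier, of "x m" D n] Suc.prems(2)[of m] B by (intro eq_matI) auto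
  ultimately show ?case
    by (simp only:)
qed

text \<open>Cramer's rule for matrices read as vectors of length \<open>n * n\<close>, position
  \<open>(i, j)\<close> becoming \<open>i * n + j\<close>. The coordinate matrix \<open>a\<close> of
  the \<open>x p q\<close> is the identity modulo \<open>P\<close>, so its determinant
  \<open>s\<close> lies outside \<open>P\<close>, and the adjugate expresses \<open>s\<close> times
  any matrix by the \<open>x p q\<close> with coefficients in \<open>D\<close>.\<close>

lemma eliminate_mod:
  assumes n: "n \<ge> 1" and add: "\<And>x y. x \<in> B \<Longrightarrow> y \<in> B \<Longrightarrow> x + y \<in> B"
    and smult: "\<And>c x. c \<in> D \<Longrightarrow> x \<in> B \<Longrightarrow> c \<cdot>\<^sub>m x \<in> B"
    and B: "B \<subseteq> Mn D n"
    and x: "\<And>p q. p < n \<Longrightarrow> q < n \<Longrightarrow> x p q \<in> B"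
    and unit: "\<And>p q i j. p < n \<Longrightarrow> q < n \<Longrightarrow> i < n \<Longrightarrow> j < n \<Longrightarrow>
      x p q $$ (i, j) - (if i = p \<and> j = q then 1 else 0) \<in> P"
  obtains s where "s \<in> D" "s \<notin> P" "\<And>M. M \<in> Mn D n \<Longrightarrow> s \<cdot>\<^sub>m M \<in> B"
proof -
  define N where "N = n * n"
  define y where "y r = x (r div n) (r mod n)" for r
  define a where "a = mat N N (\<lambda>(r, c). y r $$ (c div n, c mod n))"
  have dm: "r div n < n" "r mod n < n" if "r < N" for r
    using that n by (auto simp: N_def less_mult_imp_div_less)
  have yB: "y r \<in> B" if "r < N" for r
    unfolding y_def using dm[OF that] x by blast
  have ac: "a \<in> carrier_mat N N"
    by (simp add: a_def)
  have aD: "a $$ (r, c) \<in> D" if "r < N" "c < N" for r c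
    using that Mn_entry[OF subsetD[OF B yB[OF that(1)]] dm[OF that(2)]] by (simp add: a_def)
  have a1: "a $$ (r, c) - 1\<^sub>m N $$ (r, c) \<in> P" if rc: "r < N" "c < N" for r c
  proof -
    have "(c div n = r div n \<and> c mod n = r mod n) \<longleftrightarrow> r = c"
      by (metis div_mult_mod_eq)
    then show ?thesis
      using unit[OF dm[OF rc(1)] dm[OF rc(2)]] rc by (auto simp: a_def y_def)
  qed
  define s where "s = det a"
  have sD: "s \<in> D"
    unfolding s_def by (rule det_in[OF ac aD])
  have "s - det (1\<^sub>m N) \<in> P"
    unfolding s_def using S_zero S_one by (intro det_cong_mod[OF ac aD _ _ a1]) auto
  then have sP: "s \<notin> P"
    using one_notin I_diff[of s "s - 1"] by auto
  have adj: "adj_mat a \<in> carrier_mat N N" "adj_mat a * a = s \<cdot>\<^sub>m 1\<^sub>m N"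
    using adj_mat[OF ac] by (auto simp: s_def)
  have adjD: "adj_mat a $$ (t, r) \<in> D" if "t < N" "r < N" for t r
    using adj_mat_in[OF ac aD that] .
  show ?thesis
  proof (rule that[OF sD sP])
    fix M assume M: "M \<in> Mn D n"
    define c where "c r = (\<Sum>t<N. M $$ (t div n, t mod n) * adj_mat a $$ (t, r))" for r
    have cD: "c r \<in> D" if "r < N" for r
      unfolding c_def using that adjD Mn_entry[OF M] dm by (intro S_sum S_mult) auto
    have "mat n n (\<lambda>(i, j). \<Sum>r<N. c r * y r $$ (i, j)) \<in> B"
      using x n by (intro linear_combination_in[OF add smult B] cD yB) auto
    moreover have "mat n n (\<lambda>(i, j). \<Sum>r<N. c r * y r $$ (i, j)) = s \<cdot>\<^sub>m M"
    proof (rule eq_matI)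
      fix i j assume "i < dim_row (s \<cdot>\<^sub>m M)" "j < dim_col (s \<cdot>\<^sub>m M)"
      then have ij: "i < n" "j < n"
        using carrier_matD[OF Mn_carrier[OF M]] by auto
      define d where "d = i * n + j"
      have d: "d < N" "d div n = i" "d mod n = j"
      proof -
        have "i * n + j < Suc i * n"
          using ij by simp
        also have "\<dots> \<le> n * n"
          using ij by (intro mult_right_mono) auto
        finally show "d < N"
          by (simp add: d_def N_def)
      qed (use ij in \<open>auto simp: d_def\<close>)
      have "(\<Sum>r<N. c r * y r $$ (i, j)) = (\<Sum>r<N. \<Sum>t<N. M $$ (t div n, t mod n) * (adj_mat a $$ (t, r) * a $$ (r, d)))"
        using d by (intro sum.cong refl) (simp add: c_def a_def sum_distrib_right mult.assoc)
      also have "\<dots> = (\<Sum>t<N. M $$ (t div n, t mod n) * (adj_mat a * a) $$ (t, d))"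
        by (subst sum.swap) (simp add: mat_mult_entry[OF adj(1) ac _ d(1)] sum_distrib_left del: index_mult_mat(1))
      also have "\<dots> = (\<Sum>t<N. if t = d then s * M $$ (i, j) else 0)"
        using d by (intro sum.cong) (auto simp: adj(2))
      also have "\<dots> = s * M $$ (i, j)"
        using d by simp
      finally show "mat n n (\<lambda>(i, j). \<Sum>r<N. c r * y r $$ (i, j)) $$ (i, j) = (s \<cdot>\<^sub>m M) $$ (i, j)"
        using ij carrier_matD[OF Mn_carrier[OF M]] by simp
    qed (use carrier_matD[OF Mn_carrier[OF M]] in auto)
    ultimately show "s \<cdot>\<^sub>m M \<in> B"
      by simp
  qed
qed

end

subsection \<open>Dedekind domains\<close>

lemma subring_ideal_iff:
  assumes "subring_of D"
  shows "subring_ideal D I \<longleftrightarrow> ideal_of D I"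
proof
  assume I: "ideal_of D I"
  have "- x \<in> D" if "x \<in> D" for x
    using assms that unfolding subring_of_def by (metis diff_0)
  then show "subring_ideal D I"
    using assms I by unfold_locales (auto simp: subring_of_def ideal_of_def)
next
  assume "subring_ideal D I"
  then interpret subring_ideal D I .
  show "ideal_of D I"
    using I_subset I_zero I_add I_mult by (auto simp: ideal_of_def)
qed

lemma maximal_inverse:
  assumes D: "subring_of D" and P: "maximal_ideal_of D P" and x: "x \<in> D" "x \<notin> P"
  shows "\<exists>u\<in>D. u * x - 1 \<in> P"
proof -
  interpret subring_ideal D P
    using P subring_ideal_iff[OF D] by (simp add: maximal_ideal_of_def)
  define J where "J = {u * x + m | u m. u \<in> D \<and> m \<in> P}"
  have J: "subring_ideal D J" "P \<subseteq> J" "x \<in> J"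
    unfolding J_def by (rule ideal_adjoin[OF x(1)])+
  then have "J = D"
    using P x subring_ideal_iff[OF D] by (auto simp: maximal_ideal_of_def)
  then have "1 \<in> J"
    using S_one by blast
  then obtain u m where um: "1 = u * x + m" "u \<in> D" "m \<in> P"
    unfolding J_def by blast
  have "u * x - 1 = - m"
    using arg_cong[OF um(1), of "\<lambda>y. u * x - y"] by simp
  then show ?thesis
    using um I_uminus by (intro bexI[of _ u]) auto
qed

lemma maximal_one_notin:
  assumes D: "subring_of D" and P: "maximal_ideal_of D P"
  shows "1 \<notin> P"
proof
  assume "1 \<in> P"
  interpret subring_ideal D P
    using P subring_ideal_iff[OF D] by (simp add: maximal_ideal_of_def)
  have "D \<subseteq> P"
    using I_mult[OF _ \<open>1 \<in> P\<close>] by auto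
  then show False
    using I_subset P by (auto simp: maximal_ideal_of_def)
qed

lemma maximal_prime:
  assumes D: "subring_of D" and P: "maximal_ideal_of D P" and xy: "x \<in> D" "y \<in> D" "x * y \<in> P"
  shows "x \<in> P \<or> y \<in> P"
proof (rule disjCI)
  interpret subring_ideal D P
    using P subring_ideal_iff[OF D] by (simp add: maximal_ideal_of_def)
  assume "y \<notin> P"
  then obtain u where u: "u \<in> D" "u * y - 1 \<in> P"
    using maximal_inverse[OF D P] xy by blast
  have "u * (x * y) - x * (u * y - 1) \<in> P"
    by (rule I_diff[OF I_mult[OF u(1) xy(3)] I_mult[OF xy(1) u(2)]])
  then show "x \<in> P"
    by (simp add: algebra_simps)
qed

lemma ex_residue_field:
  assumes D: "subring_of D" and P: "maximal_ideal_of D P" and fin: "finite_residue_fields D"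
  shows "\<exists>T. residue_field D P T"
proof -
  interpret subring_ideal D P
    using P subring_ideal_iff[OF D] by (simp add: maximal_ideal_of_def)
  define cls where "cls x = {y \<in> D. x - y \<in> P}" for x
  have cls_eq: "cls x = cls y" if "x - y \<in> P" for x y
    using cong_trans[OF that] cong_trans[OF cong_sym[OF that]] unfolding cls_def by blast
  \<comment> \<open>The classes of 0 and 1 receive 0 and 1 as representatives, as
    \<open>residue_field\<close> requires; the two tests do not conflict, since 1 is not in the
    class of 0.\<close>
  define f where "f X = (if X = cls 0 then 0 else if X = cls 1 then 1 else SOME y. y \<in> X)" for X
  have f: "f (cls x) \<in> cls x" if "x \<in> D" for x
  proof -
    have "x \<in> cls x"
      using that I_zero by (simp add: cls_def)
    then have "(SOME y. y \<in> cls x) \<in> cls x"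
      by (rule someI)
    moreover have "0 \<in> cls 0" "1 \<in> cls 1"
      using I_zero S_zero S_one by (auto simp: cls_def)
    ultimately show ?thesis
      by (auto simp: f_def)
  qed
  define T where "T = f ` cls ` D"
  have "residue_field D P T"
  proof unfold_locales
    show "1 \<notin> P"
      by (rule maximal_one_notin[OF D P])
    show "x \<in> P \<or> y \<in> P" if "x \<in> D" "y \<in> D" "x * y \<in> P" for x y
      by (rule maximal_prime[OF D P that])
    show "finite T"
      using fin P by (simp add: T_def finite_residue_fields_def cls_def[abs_def])
    show "T \<subseteq> D"
      using f by (auto simp: T_def cls_def)
    show "\<exists>r\<in>T. x - r \<in> P" if "x \<in> D" for x
      using f[OF that] that by (auto simp: T_def cls_def)
    show "r = r'" if r: "r \<in> T" "r' \<in> T" "r - r' \<in> P" for r r'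
    proof -
      obtain x x' where x: "x \<in> D" "r = f (cls x)" "x' \<in> D" "r' = f (cls x')"
        using r by (auto simp: T_def)
      have "x - r \<in> P" "x' - r' \<in> P"
        using f[OF x(1)] f[OF x(3)] x(2,4) by (auto simp: cls_def)
      then have "cls x = cls x'"
        using cls_eq r(3) by metis
      then show ?thesis
        using x by simp
    qed
    have "1 \<in> cls 1" "1 \<notin> cls 0"
      using maximal_one_notin[OF D P] S_one I_zero I_uminus[of "-1"] by (auto simp: cls_def)
    then have "f (cls 0) = 0" "f (cls 1) = 1"
      by (auto simp: f_def)
    then show "0 \<in> T" "1 \<in> T"
      unfolding T_def using S_zero S_one by (metis image_eqI)+
  qed
  then show ?thesis
    by blast
qed

text \<open>The ideals \<open>J k\<close>, spanned by \<open>c, c z, ..., c z^(k-1)\<close>,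
  increase, and their union is finitely generated. So they become stationary, some
  \<open>c z^k\<close> is a combination of lower ones, and cancelling \<open>c\<close> leaves a
  monic equation for \<open>z\<close>.\<close>

lemma almost_integral:
  assumes D: "subring_of D" and noe: "noetherian_dom D" and ic: "integrally_closed_dom D"
    and c: "c \<noteq> 0" and cz: "\<And>N. c * z ^ N \<in> D"
  shows "z \<in> D"
proof -
  interpret subring_ideal D D
    using D by (simp add: subring_ideal_iff ideal_of_def subring_of_def)
  define J where "J k = {\<Sum>i<k. d i * (c * z ^ i) | d. \<forall>i. d i \<in> D}" for k :: nat
  have J: "subring_ideal D (J k)" for k
  proof (rule subring_ideal_change)
    show "J k \<subseteq> D"
      by (auto simp: J_def intro!: S_sum S_mult[OF _ cz])
    show "0 \<in> J k"
      unfolding J_def using S_zero by (intro CollectI exI[of _ "\<lambda>_. 0"]) simp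
    show "x + y \<in> J k" if xy: "x \<in> J k" "y \<in> J k" for x y
    proof -
      obtain d d' where d: "x = (\<Sum>i<k. d i * (c * z ^ i))" "\<forall>i. d i \<in> D"
        "y = (\<Sum>i<k. d' i * (c * z ^ i))" "\<forall>i. d' i \<in> D"
        using xy by (auto simp: J_def)
      then have "x + y = (\<Sum>i<k. (d i + d' i) * (c * z ^ i))"
        by (simp add: sum.distrib distrib_right)
      then show ?thesis
        unfolding J_def using S_add[OF d(2)[rule_format] d(4)[rule_format]]
        by (intro CollectI exI[of _ "\<lambda>i. d i + d' i"]) simp
    qed
    show "x * y \<in> J k" if xy: "x \<in> D" "y \<in> J k" for x y
    proof -
      obtain d where d: "y = (\<Sum>i<k. d i * (c * z ^ i))" "\<forall>i. d i \<in> D"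
        using xy by (auto simp: J_def)
      then have "x * y = (\<Sum>i<k. (x * d i) * (c * z ^ i))"
        by (simp add: sum_distrib_left mult.assoc)
      then show ?thesis
        unfolding J_def using S_mult[OF xy(1) d(2)[rule_format]]
        by (intro CollectI exI[of _ "\<lambda>i. x * d i"]) simp
    qed
  qed
  have mono: "J k \<subseteq> J l" if "k \<le> l" for k l
  proof
    fix x assume "x \<in> J k"
    then obtain d where d: "x = (\<Sum>i<k. d i * (c * z ^ i))" "\<forall>i. d i \<in> D"
      by (auto simp: J_def)
    have "x = (\<Sum>i<l. (if i < k then d i else 0) * (c * z ^ i))"
      unfolding d(1) using that by (intro sum.mono_neutral_cong_left) auto
    moreover have "\<forall>i. (if i < k then d i else 0) \<in> D"
      using d S_zero by simp
    ultimately show "x \<in> J l"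
      unfolding J_def by (intro CollectI exI[of _ "\<lambda>i. if i < k then d i else 0"]) simp
  qed
  have "ideal_of D (\<Union>k. J k)"
  proof -
    have "subring_ideal D (\<Union>k. J k)"
    proof (rule subring_ideal_change)
      show "(\<Union>k. J k) \<subseteq> D" "0 \<in> (\<Union>k. J k)"
        using subring_ideal.I_subset[OF J] subring_ideal.I_zero[OF J] by blast+
      show "x + y \<in> (\<Union>k. J k)" if xy: "x \<in> (\<Union>k. J k)" "y \<in> (\<Union>k. J k)" for x y
      proof -
        obtain k l where "x \<in> J k" "y \<in> J l"
          using xy by blast
        then have "x \<in> J (max k l)" "y \<in> J (max k l)"
          using mono[of k "max k l"] mono[of l "max k l"] by auto
        then show ?thesis
          using subring_ideal.I_add[OF J] by blast
      qed
      show "x * y \<in> (\<Union>k. J k)" if "x \<in> D" "y \<in> (\<Union>k. J k)" for x y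
        using that subring_ideal.I_mult[OF J] by blast
    qed
    then show ?thesis
      using subring_ideal_iff[OF D] by blast
  qed
  then have "fin_gen_ideal D (\<Union>k. J k)"
    using noe by (simp add: noetherian_dom_def)
  then obtain G where G: "finite G" "G \<subseteq> (\<Union>k. J k)"
    "(\<Union>k. J k) = {\<Sum>s\<in>G. a s * s | a. \<forall>s\<in>G. a s \<in> D}"
    unfolding fin_gen_ideal_def by (elim exE conjE)
  have "\<exists>k. A \<subseteq> J k" if "finite A" "A \<subseteq> (\<Union>k. J k)" for A
    using that
  proof (induction A)
    case (insert x A)
    then obtain k l where "A \<subseteq> J k" "x \<in> J l"
      by auto
    then have "insert x A \<subseteq> J (max k l)"
      using mono[of k "max k l"] mono[of l "max k l"] by auto
    then show ?case by blast
  qed simp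
  then obtain k where k: "G \<subseteq> J k"
    using G(1,2) by blast
  have "(\<Union>k. J k) \<subseteq> J k"
  proof
    fix x assume "x \<in> (\<Union>k. J k)"
    then obtain a where a: "x = (\<Sum>s\<in>G. a s * s)" "\<forall>s\<in>G. a s \<in> D"
      unfolding G(3) by blast
    then show "x \<in> J k"
      using k subring_ideal.I_mult[OF J] by (auto intro!: subring_ideal.I_sum[OF J])
  qed
  moreover have "c * z ^ k \<in> J (Suc k)"
  proof -
    have "c * z ^ k = (\<Sum>i<Suc k. (if i = k then 1 else 0) * (c * z ^ i))"
      by simp
    moreover have "\<forall>i. (if i = k then 1 else 0) \<in> D"
      using S_zero S_one by simp
    ultimately show ?thesis
      unfolding J_def by (intro CollectI exI[of _ "\<lambda>i. if i = k then 1 else 0"]) simp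
  qed
  ultimately have "c * z ^ k \<in> J k"
    by blast
  then obtain d where d: "c * z ^ k = (\<Sum>i<k. d i * (c * z ^ i))" "\<forall>i. d i \<in> D"
    unfolding J_def by blast
  have "c * z ^ k = c * (\<Sum>i<k. d i * z ^ i)"
    unfolding d(1) by (simp add: sum_distrib_left mult_ac)
  then have zk: "z ^ k = (\<Sum>i<k. d i * z ^ i)"
    using c by simp
  define p where "p = monom 1 k - (\<Sum>i<k. monom (d i) i)"
  have cp: "coeff p i = (if i = k then 1 else if i < k then - d i else 0)" for i
    by (auto simp: p_def coeff_sum)
  have "degree p = k"
    by (intro antisym degree_le le_degree) (auto simp: cp)
  then have "lead_coeff p = 1"
    by (simp add: cp)
  moreover have "\<forall>i. coeff p i \<in> D"
    using d S_zero S_one S_uminus by (simp add: cp)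
  moreover have "poly p z = 0"
    by (simp add: p_def poly_sum poly_monom zk)
  ultimately show ?thesis
    using ic by (auto simp: integrally_closed_dom_def)
qed

text \<open>The definition of Dedekind domain provides a nonzero prime ideal, so the zero ideal is
  not maximal and \<open>D\<close> is not a field.\<close>

lemma maximal_nonzero:
  assumes ded: "dedekind_dom D" and P: "maximal_ideal_of D P"
  shows "\<exists>a\<in>P. a \<noteq> 0"
proof (rule ccontr)
  assume P0: "\<not> (\<exists>a\<in>P. a \<noteq> 0)"
  obtain Q where Q: "prime_ideal_of D Q" "Q \<noteq> {0}"
    using ded unfolding dedekind_dom_def by blast
  have "0 \<in> P" "ideal_of D Q" "0 \<in> Q" "Q \<noteq> D"
    using P Q by (auto simp: maximal_ideal_of_def prime_ideal_of_def ideal_of_def)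
  then have "P = {0}" "P \<subseteq> Q"
    using P0 by auto
  then show False
    using P Q \<open>ideal_of D Q\<close> \<open>Q \<noteq> D\<close> unfolding maximal_ideal_of_def by metis
qed

text \<open>Among the ideals \<open>(a : b) = {x. x b \<in> a D}\<close> contained in \<open>P\<close> (with \<open>a \<in> P\<close> fixed and nonzero) a
  maximal one is prime, hence equal to \<open>P\<close>; then \<open>t = b / a\<close>.\<close>
lemma ex_inverse_element:
  assumes ded: "dedekind_dom D" and P: "maximal_ideal_of D P"
  obtains t where "t \<notin> D" "\<And>p. p \<in> P \<Longrightarrow> t * p \<in> D"
proof -
  have D: "subring_of D" and noe: "noetherian_dom D"
    using ded by (auto simp: dedekind_dom_def frac_field_of_def)
  interpret subring_ideal D P
    using P subring_ideal_iff[OF D] by (simp add: maximal_ideal_of_def)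
  obtain a where a: "a \<in> P" "a \<noteq> 0"
    using maximal_nonzero[OF ded P] by blast
  have aD: "a \<in> D"
    using a I_in_S by blast
  define C where "C b = {x \<in> D. x * b / a \<in> D}" for b
  have C: "subring_ideal D (C b)" if b: "b \<in> D" for b
  proof (rule subring_ideal_change)
    show "x + y \<in> C b" if "x \<in> C b" "y \<in> C b" for x y
      using that S_add[of x y] S_add[of "x * b / a" "y * b / a"]
      by (simp add: C_def distrib_right add_divide_distrib)
    show "x * y \<in> C b" if "x \<in> D" "y \<in> C b" for x y
      using that S_mult[of x y] S_mult[of x "y * b / a"] by (simp add: C_def mult.assoc)
  qed (use S_zero in \<open>auto simp: C_def\<close>)
  define \<F> where "\<F> = {C b | b. b \<in> D \<and> C b \<subseteq> P}"
  have "C 1 \<subseteq> P"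
  proof
    fix x assume "x \<in> C 1"
    then have "x / a \<in> D"
      by (simp add: C_def)
    then show "x \<in> P"
      using I_mult[OF _ a(1), of "x / a"] a by simp
  qed
  then have "\<F> \<noteq> {}"
    using S_one by (auto simp: \<F>_def)
  \<comment> \<open>A union of ideals \<open>C b\<close> need not have this form in general. Here it
    is finitely generated, so all generators lie in one member of the chain, which is then the whole
    union.\<close>
  moreover have "\<Union>\<C> \<in> \<F>" if ne: "\<C> \<noteq> {}" and ch: "subset.chain \<F> \<C>" for \<C>
  proof -
    have sub: "\<And>J. J \<in> \<C> \<Longrightarrow> J \<in> \<F>" and lin: "\<And>J J'. J \<in> \<C> \<Longrightarrow> J' \<in> \<C> \<Longrightarrow> J \<subseteq> J' \<or> J' \<subseteq> J"
      using ch by (auto simp: subset_chain_def)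
    have id: "subring_ideal D J" if "J \<in> \<C>" for J
      using sub[OF that] C by (auto simp: \<F>_def)
    have "subring_ideal D (\<Union>\<C>)"
    proof (rule subring_ideal_change)
      show "\<Union>\<C> \<subseteq> D"
        using subring_ideal.I_subset[OF id] by blast
      show "0 \<in> \<Union>\<C>"
        using subring_ideal.I_zero[OF id] ne by blast
      show "x * y \<in> \<Union>\<C>" if "x \<in> D" "y \<in> \<Union>\<C>" for x y
        using subring_ideal.I_mult[OF id] that by blast
      show "x + y \<in> \<Union>\<C>" if xy: "x \<in> \<Union>\<C>" "y \<in> \<Union>\<C>" for x y
      proof -
        obtain J where "J \<in> \<C>" "x \<in> J" "y \<in> J"
          using lin xy by blast
        then show ?thesis
          using subring_ideal.I_add[OF id] by blast
      qed
    qed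
    then have "ideal_of D (\<Union>\<C>)"
      using subring_ideal_iff[OF D] by blast
    then have "fin_gen_ideal D (\<Union>\<C>)"
      using noe by (simp add: noetherian_dom_def)
    then obtain G where G: "finite G" "G \<subseteq> \<Union>\<C>"
      "\<Union>\<C> = {\<Sum>s\<in>G. a s * s | a. \<forall>s\<in>G. a s \<in> D}"
      unfolding fin_gen_ideal_def by (elim exE conjE)
    have "\<exists>J\<in>\<C>. A \<subseteq> J" if "finite A" "A \<subseteq> \<Union>\<C>" for A
      using that
    proof (induction A)
      case (insert x A)
      then obtain J J' where "A \<subseteq> J" "x \<in> J'" "J \<in> \<C>" "J' \<in> \<C>"
        by auto
      then show ?case
        using lin[of J J'] by blast
    qed (use ne in auto)
    then obtain J where J: "J \<in> \<C>" "G \<subseteq> J"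
      using G(1,2) by blast
    have "\<Union>\<C> \<subseteq> J"
    proof
      fix x assume "x \<in> \<Union>\<C>"
      then obtain a where a: "x = (\<Sum>s\<in>G. a s * s)" "\<forall>s\<in>G. a s \<in> D"
        unfolding G(3) by blast
      then show "x \<in> J"
        using J subring_ideal.I_mult[OF id[OF J(1)]] by (auto intro!: subring_ideal.I_sum[OF id[OF J(1)]])
    qed
    then have "\<Union>\<C> = J"
      using J by blast
    then show ?thesis
      using sub J by blast
  qed
  ultimately obtain M where M: "M \<in> \<F>" and max: "\<And>J. J \<in> \<F> \<Longrightarrow> M \<subseteq> J \<Longrightarrow> J = M"
    using subset_Zorn_nonempty[of \<F>] by blast
  then obtain b where b: "b \<in> D" "M = C b" "C b \<subseteq> P"
    by (auto simp: \<F>_def)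
  have bigger: "C (b * x) = C b" if x: "x \<in> D" "C (b * x) \<subseteq> P" for x
  proof -
    have "C b \<subseteq> C (b * x)"
      using x S_mult[of _ x] by (auto simp: C_def mult.assoc[symmetric] times_divide_eq_left[symmetric] simp del: times_divide_eq_left)
    moreover have "C (b * x) \<in> \<F>"
      unfolding \<F>_def using S_mult[OF b(1) x(1)] x(2) by blast
    ultimately show ?thesis
      using max b(2) by blast
  qed
  have one: "1 \<notin> P"
    by (rule maximal_one_notin[OF D P])
  have "prime_ideal_of D (C b)"
    unfolding prime_ideal_of_def
  proof (intro conjI ballI impI)
    show "ideal_of D (C b)"
      using C[OF b(1)] subring_ideal_iff[OF D] by blast
    show "C b \<noteq> D"
      using b one S_one by blast
    fix x y assume x: "x \<in> D" and y: "y \<in> D" and xy: "x * y \<in> C b"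
    show "x \<in> C b \<or> y \<in> C b"
    proof (cases "C (b * x) \<subseteq> P")
      case True
      then have "y \<in> C b"
        using bigger[OF x] xy y by (auto simp: C_def mult_ac)
      then show ?thesis ..
    next
      case False
      then obtain s where s: "s \<in> D" "s * (b * x) / a \<in> D" "s \<notin> P"
        by (auto simp: C_def)
      \<comment> \<open>The roles are exchanged: \<open>x\<close> belongs to
        \<open>C (b * s)\<close> by the choice of \<open>s\<close>, and once this ideal is known to
        lie in \<open>P\<close>, maximality identifies it with \<open>C b\<close>.\<close>
      have "C (b * s) \<subseteq> P"
      proof
        fix r assume r: "r \<in> C (b * s)"
        then have "r * s \<in> C b"
          using s S_mult by (auto simp: C_def mult_ac)
        then show "r \<in> P"
          using b maximal_prime[OF D P _ s(1)] r s by (auto simp: C_def)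
      qed
      then have "x \<in> C b"
        using bigger[OF s(1)] s x by (auto simp: C_def mult_ac)
      then show ?thesis ..
    qed
  qed
  moreover have "a \<in> C b"
    using a aD b by (simp add: C_def)
  ultimately have "maximal_ideal_of D (C b)"
    using ded a unfolding dedekind_dom_def by blast
  then have "P = C b"
    using P b unfolding maximal_ideal_of_def by blast
  show ?thesis
  proof (rule that[of "b / a"])
    show "b / a \<notin> D"
      using b one S_one by (auto simp: C_def)
    show "b / a * p \<in> D" if "p \<in> P" for p
      using that \<open>P = C b\<close> by (simp add: C_def mult.commute)
  qed
qed

text \<open>If \<open>t\<close> mapped \<open>P\<close> into itself, all \<open>a * t ^ N\<close>
  would lie in \<open>D\<close> and \<open>t\<close> would be almost integral. So some
  \<open>p\<close> has \<open>t * p\<close> outside \<open>P\<close>: it acts as a uniformizer with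
  inverse \<open>t\<close> up to a local unit.\<close>

lemma inverse_element_properties:
  assumes ded: "dedekind_dom D" and P: "maximal_ideal_of D P"
    and t: "t \<notin> D" "\<And>p. p \<in> P \<Longrightarrow> t * p \<in> D"
  obtains p where "p \<in> P" "t * p \<in> D" "t * p \<notin> P"
    "\<And>s k. s \<in> D \<Longrightarrow> s \<notin> P \<Longrightarrow> k \<ge> 1 \<Longrightarrow> t ^ k * s \<notin> D"
proof -
  have D: "subring_of D" and noe: "noetherian_dom D" and ic: "integrally_closed_dom D"
    using ded by (auto simp: dedekind_dom_def frac_field_of_def)
  interpret subring_ideal D P
    using P subring_ideal_iff[OF D] by (simp add: maximal_ideal_of_def)
  obtain a where a: "a \<in> P" "a \<noteq> 0"
    using maximal_nonzero[OF ded P] by blast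
  have "\<exists>p\<in>P. t * p \<notin> P"
  proof (rule ccontr)
    assume *: "\<not> (\<exists>p\<in>P. t * p \<notin> P)"
    have "a * t ^ N \<in> P" for N
    proof (induction N)
      case (Suc N)
      then have "t * (a * t ^ N) \<in> P"
        using * by blast
      then show ?case
        by (simp add: mult_ac)
    qed (use a in simp)
    then have "t \<in> D"
      using almost_integral[OF D noe ic a(2)] I_in_S by blast
    then show False
      using t by blast
  qed
  then obtain p where p: "p \<in> P" "t * p \<notin> P"
    by blast
  have tp: "t * p \<in> D"
    using t p by blast
  have pD: "p \<in> D"
    using p I_in_S by blast
  have pw: "(t * p) ^ j \<notin> P" for j
  proof (induction j)
    case 0
    then show ?case
      using maximal_one_notin[OF D P] by simp
  next
    case (Suc j)
    then show ?case
      using maximal_prime[OF D P tp S_power[OF tp], of j] p by auto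
  qed
  show ?thesis
  proof (rule that[OF p(1) tp p(2)])
    fix s :: 'a and k :: nat assume s: "s \<in> D" "s \<notin> P" and k: "k \<ge> 1"
    show "t ^ k * s \<notin> D"
    proof
      assume "t ^ k * s \<in> D"
      \<comment> \<open>All but one of the factors \<open>t\<close> are paired with a
        \<open>p\<close> and become units modulo \<open>P\<close>; a single \<open>t\<close>
        survives, which reduces the claim to \<open>t * s'\<close> with \<open>s'\<close> outside
        \<open>P\<close>.\<close>
      then have "p ^ (k - 1) * (t ^ k * s) \<in> D"
        using S_mult[OF S_power[OF pD]] by blast
      moreover have "t ^ k = t * t ^ (k - 1)"
        using k by (cases k) auto
      define s' where "s' = (t * p) ^ (k - 1) * s"
      ultimately have ts: "t * s' \<in> D"
        using \<open>t ^ k = _\<close> by (simp add: s'_def power_mult_distrib mult_ac)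
      have "s' \<in> D" "s' \<notin> P"
        using S_mult[OF S_power[OF tp] s(1)] maximal_prime[OF D P S_power[OF tp] s(1)] pw s
        by (auto simp: s'_def)
      then obtain u where u: "u \<in> D" "u * s' - 1 \<in> P"
        using maximal_inverse[OF D P] by blast
      \<comment> \<open>This difference is \<open>t\<close> itself, so \<open>t\<close> would lie in
        \<open>D\<close>.\<close>
      have "u * (t * s') - t * (u * s' - 1) \<in> D"
        by (rule S_diff[OF S_mult[OF u(1) ts] t(2)[OF u(2)]])
      then show False
        using t by (simp add: algebra_simps)
    qed
  qed
qed

subsection \<open>Subalgebras of the matrix algebra\<close>

lemma common_denominator:
  assumes "frac_field_of D"
  shows "\<exists>d\<in>D. d \<noteq> 0 \<and> (\<forall>i. d * coeff f i \<in> D)"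
proof (induction f)
  case 0
  then show ?case
    using assms by (auto simp: frac_field_of_def subring_of_def intro!: bexI[of _ 1])
next
  case (pCons c f)
  have mult: "x * y \<in> D" if "x \<in> D" "y \<in> D" for x y
    using assms that by (auto simp: frac_field_of_def subring_of_def)
  obtain d where d: "d \<in> D" "d \<noteq> 0" "\<And>i. d * coeff f i \<in> D"
    using pCons by blast
  obtain a b where ab: "a \<in> D" "b \<in> D" "b \<noteq> 0" "c = a / b"
    using assms unfolding frac_field_of_def by blast
  have "(b * d) * coeff (pCons c f) i \<in> D" for i
  proof (cases i)
    case 0
    then show ?thesis
      using mult[OF d(1) ab(1)] ab by (simp add: mult_ac)
  next
    case (Suc j)
    then show ?thesis
      using mult[OF ab(2) d(3)[of j]] by (simp add: mult.assoc)
  qed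
  then show ?case
    using mult[OF ab(2) d(1)] d ab by (intro bexI[of _ "b * d"]) auto
qed

text \<open>The induction runs over the set \<open>I\<close> of positions in which elements of \<open>B\<close> may be nonzero.\<close>
lemma bounded_denominators:
  assumes D: "subring_of D" and B: "B \<subseteq> Mn D n"
    and add: "\<And>x y. x \<in> B \<Longrightarrow> y \<in> B \<Longrightarrow> x + y \<in> B"
    and smult: "\<And>c x. c \<in> D \<Longrightarrow> x \<in> B \<Longrightarrow> c \<cdot>\<^sub>m x \<in> B"
  obtains c where "c \<in> D" "c \<noteq> 0"
    "\<And>x d. x \<in> Mn D n \<Longrightarrow> d \<in> D \<Longrightarrow> d \<noteq> 0 \<Longrightarrow> d \<cdot>\<^sub>m x \<in> B \<Longrightarrow> c \<cdot>\<^sub>m x \<in> B"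
proof -
  interpret subring_ideal D D
    using D by (simp add: subring_ideal_iff ideal_of_def subring_of_def)
  have "\<exists>c\<in>D. c \<noteq> 0 \<and> (\<forall>x\<in>Mn D n. \<forall>d\<in>D. d \<noteq> 0 \<and> d \<cdot>\<^sub>m x \<in> B \<longrightarrow> c \<cdot>\<^sub>m x \<in> B)"
    if "finite I" "I \<subseteq> {..<n} \<times> {..<n}" "\<And>x i j. x \<in> B \<Longrightarrow> i < n \<Longrightarrow> j < n \<Longrightarrow> (i, j) \<notin> I \<Longrightarrow> x $$ (i, j) = 0"
    for I
    using that B add smult
  proof (induction I arbitrary: B rule: finite_induct)
    case empty
    have "1 \<cdot>\<^sub>m x \<in> B" if x: "x \<in> Mn D n" "d \<noteq> 0" "d \<cdot>\<^sub>m x \<in> B" for x d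
    proof -
      have "x $$ (i, j) = 0" if "i < n" "j < n" for i j
        using empty.prems(2)[OF x(3) that] x that carrier_matD[OF Mn_carrier[OF x(1)]] by simp
      then have "1 \<cdot>\<^sub>m x = d \<cdot>\<^sub>m x"
        using carrier_matD[OF Mn_carrier[OF x(1)]] by (intro eq_matI) auto
      then show ?thesis
        using x by simp
    qed
    then show ?case
      using S_one by (intro bexI[of _ 1]) auto
  next
    case (insert ij I)
    obtain i j where ij: "ij = (i, j)" "i < n" "j < n"
      using insert.prems by auto
    define B0 where "B0 = {x \<in> B. x $$ (i, j) = 0}"
    have dims: "dim_row x = n" "dim_col x = n" if "x \<in> B" for x
      using carrier_matD[OF Mn_carrier] that insert.prems(3) by blast+
    have "\<exists>c\<in>D. c \<noteq> 0 \<and> (\<forall>x\<in>Mn D n. \<forall>d\<in>D. d \<noteq> 0 \<and> d \<cdot>\<^sub>m x \<in> B0 \<longrightarrow> c \<cdot>\<^sub>m x \<in> B0)"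
    proof (rule insert.IH)
      show "x $$ (i', j') = 0" if "x \<in> B0" "i' < n" "j' < n" "(i', j') \<notin> I" for x i' j'
        using that insert.prems(2)[of x i' j'] ij by (cases "(i', j') = ij") (auto simp: B0_def)
    qed (use insert.prems ij dims in \<open>auto simp: B0_def\<close>)
    then obtain c0 where c0: "c0 \<in> D" "c0 \<noteq> 0"
      "\<And>x d. x \<in> Mn D n \<Longrightarrow> d \<in> D \<Longrightarrow> d \<noteq> 0 \<Longrightarrow> d \<cdot>\<^sub>m x \<in> B0 \<Longrightarrow> c0 \<cdot>\<^sub>m x \<in> B0"
      by blast
    show ?case
    proof (cases "\<exists>b\<in>B. b $$ (i, j) \<noteq> 0")
      case False
      then have "B0 = B"
        by (auto simp: B0_def)
      then show ?thesis
        using c0 by blast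
    next
      case True
      then obtain b where b: "b \<in> B" "b $$ (i, j) \<noteq> 0"
        by blast
      define a where "a = b $$ (i, j)"
      have bM: "b \<in> Mn D n"
        using b insert.prems(3) by blast
      have aD: "a \<in> D"
        unfolding a_def using Mn_entry[OF bM] ij by blast
      have "(c0 * a) \<cdot>\<^sub>m x \<in> B" if x: "x \<in> Mn D n" and d: "d \<in> D" "d \<noteq> 0" "d \<cdot>\<^sub>m x \<in> B" for x d
      proof -
        define e where "e = - (x $$ (i, j))"
        have eD: "e \<in> D"
          unfolding e_def using S_uminus Mn_entry[OF x] ij by blast
        \<comment> \<open>The combination is chosen to cancel the entry at \<open>(i, j)\<close>,
          which places \<open>d\<close> times \<open>y\<close> in \<open>B0\<close>. Once
          \<open>c0\<close> has cleared the denominator of \<open>y\<close>, adding the multiple of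
          \<open>b\<close> back leaves \<open>c0 * a\<close> times \<open>x\<close>.\<close>
        define y where "y = a \<cdot>\<^sub>m x + e \<cdot>\<^sub>m b"
        note xd = carrier_matD[OF Mn_carrier[OF x]] and bd = carrier_matD[OF Mn_carrier[OF bM]]
        have yM: "y \<in> Mn D n"
          using Mn_entry[OF x] Mn_entry[OF bM] aD eD Mn_carrier[OF x] Mn_carrier[OF bM]
          by (intro Mn_I) (auto simp: y_def xd bd intro!: S_add S_mult)
        have "a \<cdot>\<^sub>m (d \<cdot>\<^sub>m x) + (d * e) \<cdot>\<^sub>m b \<in> B"
          using insert.prems(4,5) aD eD S_mult[OF d(1) eD] d b by blast
        moreover have "a \<cdot>\<^sub>m (d \<cdot>\<^sub>m x) + (d * e) \<cdot>\<^sub>m b = d \<cdot>\<^sub>m y"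
          unfolding y_def using xd bd by (intro eq_matI) (auto simp: algebra_simps)
        moreover have "(d \<cdot>\<^sub>m y) $$ (i, j) = 0"
          using ij xd bd by (simp add: y_def e_def a_def)
        ultimately have "d \<cdot>\<^sub>m y \<in> B0"
          by (simp add: B0_def)
        then have "c0 \<cdot>\<^sub>m y \<in> B"
          using c0(3)[OF yM d(1,2)] by (simp add: B0_def)
        moreover have "(c0 * (- e)) \<cdot>\<^sub>m b \<in> B"
          by (rule insert.prems(5)[OF S_mult[OF c0(1) S_uminus[OF eD]] b(1)])
        ultimately have "c0 \<cdot>\<^sub>m y + (c0 * (- e)) \<cdot>\<^sub>m b \<in> B"
          by (rule insert.prems(4))
        moreover have "c0 \<cdot>\<^sub>m y + (c0 * (- e)) \<cdot>\<^sub>m b = (c0 * a) \<cdot>\<^sub>m x"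
          unfolding y_def using xd bd by (intro eq_matI) (auto simp: algebra_simps)
        ultimately show ?thesis
          by simp
      qed
      moreover have "c0 * a \<in> D" "c0 * a \<noteq> 0"
        using S_mult[OF c0(1) aD] c0 b by (auto simp: a_def)
      ultimately show ?thesis
        by blast
    qed
  qed
  from this[of "{..<n} \<times> {..<n}"] show ?thesis
    using that by fastforce
qed

section \<open>Subalgebras whose integer-valued polynomials remain integer-valued on all
  matrices\<close>

locale matrix_subalgebra =
  fixes D :: "'k::field set" and n :: nat and B :: "'k mat set"
  assumes ded: "dedekind_dom D" and n: "n \<ge> 1" and B_sub: "B \<subseteq> Mn D n"
    and B_add: "x \<in> B \<Longrightarrow> y \<in> B \<Longrightarrow> x + y \<in> B"
    and B_mult: "x \<in> B \<Longrightarrow> y \<in> B \<Longrightarrow> x * y \<in> B"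
    and B_smult: "c \<in> D \<Longrightarrow> x \<in> B \<Longrightarrow> c \<cdot>\<^sub>m x \<in> B"
    and B_one: "1\<^sub>m n \<in> B"
begin

lemma D: "subring_of D" "frac_field_of D" "noetherian_dom D" "integrally_closed_dom D"
  using ded by (auto simp: dedekind_dom_def frac_field_of_def)

lemma B_carrier: "b \<in> B \<Longrightarrow> b \<in> carrier_mat n n"
  using B_sub Mn_carrier by blast

lemma mat_eval_B: "f \<in> poly_over D \<Longrightarrow> b \<in> B \<Longrightarrow> mat_eval n f b \<in> B"
proof (induction f)
  interpret subring_ideal D D
    using D by (simp add: subring_ideal_iff ideal_of_def subring_of_def)
  case 0
  have "0 \<cdot>\<^sub>m 1\<^sub>m n \<in> B"
    by (rule B_smult[OF S_zero B_one])
  moreover have "(0::'k) \<cdot>\<^sub>m 1\<^sub>m n = 0\<^sub>m n n"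
    by (intro eq_matI) auto
  ultimately show ?case
    by simp
next
  interpret subring_ideal D D
    using D by (simp add: subring_ideal_iff ideal_of_def subring_of_def)
  case (pCons c f)
  then have "c \<in> D" "f \<in> poly_over D"
    by (auto simp: poly_over_pCons)
  then show ?case
    using pCons B_add[OF B_smult[OF _ B_one] B_mult] by (simp add: mat_eval_pCons[OF B_carrier])
qed

text \<open>For every \<open>N\<close> the polynomial \<open>c t\<^sup>N G\<^sup>N\<close> is integer-valued on \<open>B\<close>, hence on all matrices, so
  that \<open>t\<^sup>n det G(M)\<close> is almost integral.\<close>
lemma det_divisible:
  assumes int: "\<And>f. (\<And>b. b \<in> B \<Longrightarrow> mat_eval n f b \<in> B) \<Longrightarrow>
      (\<And>M. M \<in> Mn D n \<Longrightarrow> mat_eval n f M \<in> Mn D n)"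
    and P: "residue_field D P T" and t: "\<And>p. p \<in> P \<Longrightarrow> t * p \<in> D"
    and G: "G \<in> poly_over D" "\<And>b. b \<in> B \<Longrightarrow> mat_eval n G b \<in> Mn P n" and M: "M \<in> Mn D n"
  shows "t ^ n * det (mat_eval n G M) \<in> D"
proof -
  interpret residue_field D P T
    by (rule P)
  obtain c where c: "c \<in> D" "c \<noteq> 0"
    "\<And>x d. x \<in> Mn D n \<Longrightarrow> d \<in> D \<Longrightarrow> d \<noteq> 0 \<Longrightarrow> d \<cdot>\<^sub>m x \<in> B \<Longrightarrow> c \<cdot>\<^sub>m x \<in> B"
    using bounded_denominators[OF D(1) B_sub B_add B_smult] by metis
  obtain a0 b0 where ab: "a0 \<in> D" "b0 \<in> D" "b0 \<noteq> 0" "t = a0 / b0"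
    using D(2) unfolding frac_field_of_def by blast
  note Mc = Mn_carrier[OF M]
  \<comment> \<open>The exponents \<open>n\<close> come from pulling scalars out of an
    \<open>n\<close>-rowed determinant. What matters is that \<open>c ^ n\<close> does not depend on
    \<open>N\<close>.\<close>
  have "c ^ n * (t ^ n * det (mat_eval n G M)) ^ N \<in> D" for N
  proof -
    define F where "F = Polynomial.smult (t ^ N) (G ^ N)"
    have FD: "mat_eval n F b \<in> Mn D n" if b: "b \<in> B" for b
      unfolding F_def
    proof (induction N)
      case 0
      have "Polynomial.smult (t ^ 0) (G ^ 0) = 1"
        by simp
      then show ?case
        using Mn_one mat_eval_1[OF B_carrier[OF b]] by metis
    next
      case (Suc N)
      have "mat_eval n (Polynomial.smult t G) b \<in> Mn D n"
        using Mn_entry[OF G(2)[OF b]] t carrier_matD[OF mat_eval_carrier[OF B_carrier[OF b]]]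
          B_carrier[OF b]
        by (intro Mn_I) (auto simp: mat_eval_smult[OF B_carrier[OF b]])
      moreover have "Polynomial.smult (t ^ Suc N) (G ^ Suc N) =
          Polynomial.smult t G * Polynomial.smult (t ^ N) (G ^ N)"
        by (simp add: mult.commute)
      ultimately show ?case
        using Mn_mult Suc by (metis mat_eval_mult[OF B_carrier[OF b]])
    qed
    have "mat_eval n (Polynomial.smult c F) b \<in> B" if b: "b \<in> B" for b
    proof -
      \<comment> \<open>With \<open>t = a0 / b0\<close>, multiplication by \<open>b0 ^ N\<close>
        makes \<open>F\<close> a polynomial over \<open>D\<close>, whose value at \<open>b\<close>
        stays in \<open>B\<close>. The uniform \<open>c\<close> then replaces this denominator,
        because \<open>F\<close> already takes values in matrices over \<open>D\<close>.\<close>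
      have "Polynomial.smult (b0 ^ N) F = Polynomial.smult (a0 ^ N) (G ^ N)"
        using ab by (simp add: F_def power_mult_distrib[symmetric])
      moreover have "Polynomial.smult (a0 ^ N) (G ^ N) \<in> poly_over D"
        by (intro poly_over_smult S_power X.S_power ab G)
      ultimately have "mat_eval n (Polynomial.smult (b0 ^ N) F) b \<in> B"
        using mat_eval_B b by simp
      then have "b0 ^ N \<cdot>\<^sub>m mat_eval n F b \<in> B"
        by (simp add: mat_eval_smult[OF B_carrier[OF b]])
      then have "c \<cdot>\<^sub>m mat_eval n F b \<in> B"
        using ab by (intro c(3)[OF FD[OF b] S_power[OF ab(2)]]) auto
      then show ?thesis
        by (simp add: mat_eval_smult[OF B_carrier[OF b]])
    qed
    then have "mat_eval n (Polynomial.smult c F) M \<in> Mn D n"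
      by (rule int[OF _ M])
    then have "det (mat_eval n (Polynomial.smult c F) M) \<in> D"
      using Mn_entry by (intro det_in[of _ n]) (auto simp: Mc)
    moreover have "det (mat_eval n (G ^ N) M) = det (mat_eval n G M) ^ N"
      by (induction N) (simp_all add: mat_eval_1[OF Mc] mat_eval_mult[OF Mc]
          det_mult[OF mat_eval_carrier[OF Mc] mat_eval_carrier[OF Mc]])
    ultimately show ?thesis
      using carrier_matD[OF mat_eval_carrier[OF Mc]]
      by (simp add: F_def mat_eval_smult[OF Mc] power_mult_distrib power_mult[symmetric] mult_ac)
  qed
  then show ?thesis
    using almost_integral[OF D(1,3,4), of "c ^ n"] c(2) by simp
qed

lemma full_locally:
  assumes fin: "finite_residue_fields D"
    and int: "\<And>f. (\<And>b. b \<in> B \<Longrightarrow> mat_eval n f b \<in> B) \<Longrightarrow>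
      (\<And>M. M \<in> Mn D n \<Longrightarrow> mat_eval n f M \<in> Mn D n)"
    and P: "maximal_ideal_of D P"
  obtains s where "s \<in> D" "s \<notin> P" "\<And>M. M \<in> Mn D n \<Longrightarrow> s \<cdot>\<^sub>m M \<in> B"
proof -
  obtain T where T: "residue_field D P T"
    using ex_residue_field[OF D(1) P fin] by blast
  interpret residue_field D P T
    by (rule T)
  obtain t where t: "t \<notin> D" "\<And>p. p \<in> P \<Longrightarrow> t * p \<in> D"
    using ex_inverse_element[OF ded P] by metis
  obtain p where p: "p \<in> P" "t * p \<in> D" "t * p \<notin> P"
    and tk: "\<And>s k. s \<in> D \<Longrightarrow> s \<notin> P \<Longrightarrow> k \<ge> 1 \<Longrightarrow> t ^ k * s \<notin> D"
    using inverse_element_properties[OF ded P t] by metis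
  obtain h where h: "irreducible_mod n h"
    using ex_irreducible[OF n] by blast
  have "\<exists>C\<in>B. char_poly C - h \<in> poly_over P"
  proof (rule ccontr)
    assume none: "\<not> ?thesis"
    obtain G M where G: "G \<in> poly_over D" "\<And>b. b \<in> B \<Longrightarrow> mat_eval n G b \<in> Mn P n"
      "M \<in> Mn D n" "det (mat_eval n G M) \<notin> P"
      using separate_irreducible[OF n h B_sub] none by metis
    have "t ^ n * det (mat_eval n G M) \<in> D"
      by (rule det_divisible[OF int T t(2) G(1,2,3)])
    moreover have "det (mat_eval n G M) \<in> D"
      using Mn_entry[OF mat_eval_Mn[OF G(1,3)]] Mn_carrier[OF G(3)] by (intro det_in[of _ n]) auto
    ultimately show False
      using tk G n by blast
  qed
  then obtain C where C: "C \<in> B" "char_poly C - h \<in> poly_over P"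
    by blast
  have "\<exists>b\<in>B. mat_eval n (monom 1 n) b \<in> Mn P n \<and> mat_eval n (monom 1 (n - 1)) b \<notin> Mn P n"
  proof (rule ccontr)
    assume none: "\<not> ?thesis"
    obtain G M s where G: "G \<in> poly_over D" "\<And>b. b \<in> B \<Longrightarrow> mat_eval n G b \<in> Mn P n"
      "M \<in> Mn D n" and s: "s \<in> D" "s \<notin> P" "det (mat_eval n G M) ^ n = p ^ (n * (n - 1)) * s"
      using separate_nilpotent[OF n p(1) B_sub] none by metis
    have "(t ^ n * det (mat_eval n G M)) ^ n \<in> D"
      by (rule S_power[OF det_divisible[OF int T t(2) G]])
    \<comment> \<open>Of the \<open>n * n\<close> factors \<open>t\<close>, only
      \<open>n * (n - 1)\<close> can be paired with a \<open>p\<close>; the \<open>n\<close> left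
      over contradict \<open>tk\<close>.\<close>
    moreover have "(t ^ n * det (mat_eval n G M)) ^ n = t ^ n * ((t * p) ^ (n * (n - 1)) * s)"
    proof -
      have "n * n = n + n * (n - 1)"
        using n by (cases n) auto
      then have "(t ^ n) ^ n = t ^ n * t ^ (n * (n - 1))"
        by (metis power_add power_mult)
      then show ?thesis
        by (simp add: power_mult_distrib s(3))
    qed
    ultimately have "t ^ n * ((t * p) ^ (n * (n - 1)) * s) \<in> D"
      by simp
    moreover have "(t * p) ^ (n * (n - 1)) * s \<notin> P"
      using prime[OF S_power[OF p(2)] s(1)] power_in_I[OF p(2)] p(3) s(2) by blast
    ultimately show False
      using tk[OF S_mult[OF S_power[OF p(2)] s(1)]] n by blast
  qed
  then obtain b where b: "b \<in> B" "mat_eval n (monom 1 n) b \<in> Mn P n"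
    "mat_eval n (monom 1 (n - 1)) b \<notin> Mn P n"
    by blast
  have "\<exists>x\<in>B. \<forall>i<n. \<forall>j<n. x $$ (i, j) - (if i = k \<and> j = l then 1 else 0) \<in> P"
    if kl: "k < n" "l < n" for k l
  proof -
    obtain f g where fg: "f \<in> poly_over D" "g \<in> poly_over D"
      "\<And>i j. i < n \<Longrightarrow> j < n \<Longrightarrow>
        (mat_eval n f C * (mat_eval n (monom 1 (n - 1)) b * mat_eval n g C)) $$ (i, j) -
        (if i = k \<and> j = l then 1 else 0) \<in> P"
      using matrix_unit_mod[OF n h subsetD[OF B_sub C(1)] C(2) subsetD[OF B_sub b(1)] b(2,3) kl] by metis
    have "mat_eval n f C * (mat_eval n (monom 1 (n - 1)) b * mat_eval n g C) \<in> B"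
      by (intro B_mult mat_eval_B X_in fg C b)
    then show ?thesis
      using fg(3) by blast
  qed
  then obtain x where x: "\<And>k l. k < n \<Longrightarrow> l < n \<Longrightarrow> x k l \<in> B"
    "\<And>k l i j. k < n \<Longrightarrow> l < n \<Longrightarrow> i < n \<Longrightarrow> j < n \<Longrightarrow>
      x k l $$ (i, j) - (if i = k \<and> j = l then 1 else 0) \<in> P"
    by metis
  show ?thesis
    by (rule eliminate_mod[where B = B and x = x, OF n _ _ B_sub _ _ that]) (fact B_add B_smult x)+
qed

text \<open>For a fixed \<open>M\<close>, the scalars \<open>d\<close> with \<open>d\<close> times
  \<open>M\<close> in \<open>B\<close> form an ideal. Were it proper, it would lie in a maximal
  ideal, yet \<open>full_locally\<close> provides an element of it outside that ideal. Hence it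
  contains 1.\<close>

theorem full_of_integer_valued:
  assumes fin: "finite_residue_fields D"
    and int: "\<And>f. (\<And>b. b \<in> B \<Longrightarrow> mat_eval n f b \<in> B) \<Longrightarrow>
      (\<And>M. M \<in> Mn D n \<Longrightarrow> mat_eval n f M \<in> Mn D n)"
  shows "B = Mn D n"
proof (rule subset_antisym[OF B_sub subsetI])
  fix M assume M: "M \<in> Mn D n"
  interpret D: subring_ideal D D
    using D by (simp add: subring_ideal_iff ideal_of_def subring_of_def)
  note Md = carrier_matD[OF Mn_carrier[OF M]]
  define J where "J = {d \<in> D. d \<cdot>\<^sub>m M \<in> B}"
  have "subring_ideal D J"
  proof (rule D.subring_ideal_change)
    have "0 \<cdot>\<^sub>m 1\<^sub>m n \<in> B"
      by (rule B_smult[OF D.S_zero B_one])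
    moreover have "0 \<cdot>\<^sub>m 1\<^sub>m n = 0 \<cdot>\<^sub>m M"
      using Md by (intro eq_matI) auto
    ultimately show "0 \<in> J"
      using D.S_zero by (simp add: J_def)
    show "x + y \<in> J" if "x \<in> J" "y \<in> J" for x y
      using that D.S_add[of x y] B_add[of "x \<cdot>\<^sub>m M" "y \<cdot>\<^sub>m M"]
      by (simp add: J_def add_smult_distrib_right_mat[OF Mn_carrier[OF M]])
    show "x * y \<in> J" if "x \<in> D" "y \<in> J" for x y
    proof -
      have "x \<cdot>\<^sub>m (y \<cdot>\<^sub>m M) = (x * y) \<cdot>\<^sub>m M"
        by (intro eq_matI) (auto simp: mult.assoc)
      then show ?thesis
        using that D.S_mult[of x y] B_smult[of x "y \<cdot>\<^sub>m M"] by (simp add: J_def)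
    qed
  qed (auto simp: J_def)
  then interpret J: subring_ideal D J .
  have "1 \<in> J"
  proof (rule ccontr)
    assume "1 \<notin> J"
    then obtain Q where Q: "subring_ideal D Q" "J \<subseteq> Q" "1 \<notin> Q"
      "\<And>x. x \<in> D \<Longrightarrow> x \<notin> Q \<Longrightarrow> \<exists>u\<in>D. u * x - 1 \<in> Q"
      using J.ex_maximal_ideal by metis
    have "maximal_ideal_of D Q"
      unfolding maximal_ideal_of_def
    proof (intro conjI allI impI)
      show "ideal_of D Q"
        using Q subring_ideal_iff[OF D(1)] by blast
      show "Q \<noteq> D"
        using Q D.S_one by blast
      fix K assume K: "ideal_of D K \<and> Q \<subseteq> K"
      interpret K: subring_ideal D K
        using K subring_ideal_iff[OF D(1)] by blast
      show "K = Q \<or> K = D"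
      proof (cases "K \<subseteq> Q")
        case False
        then obtain x where x: "x \<in> K" "x \<notin> Q"
          by blast
        then obtain u where u: "u \<in> D" "u * x - 1 \<in> Q"
          using Q(4) K.I_in_S by blast
        have "u * x - (u * x - 1) \<in> K"
          by (rule K.I_diff[OF K.I_mult[OF u(1) x(1)] subsetD[OF conjunct2[OF K] u(2)]])
        then have "1 \<in> K"
          by simp
        then have "D \<subseteq> K"
          using K.I_mult[of _ 1] by auto
        then show ?thesis
          using K.I_subset by blast
      qed (use K in blast)
    qed
    then obtain s where "s \<in> D" "s \<notin> Q" "s \<cdot>\<^sub>m M \<in> B"
      using full_locally[OF fin int] M by metis
    then show False
      using Q by (auto simp: J_def)
  qed
  moreover have "1 \<cdot>\<^sub>m M = M"
    by (intro eq_matI) auto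
  ultimately show "M \<in> B"
    by (simp add: J_def)
qed

end

subsection \<open>Embeddings and isomorphisms\<close>

text \<open>The coefficients are confined to \<open>D\<close> because \<open>phi\<close> is a
  homomorphism with central values only there; even \<open>phi 0 = 0\<close> has to be derived from
  additivity.\<close>

lemma alg_eval_pCons:
  assumes phi: "D_algebra D phi" and D: "subring_of D" and f: "pCons c f \<in> poly_over D"
  shows "alg_eval phi (pCons c f) a = phi c + a * alg_eval phi f a"
proof -
  interpret subring_ideal D D
    using D by (simp add: subring_ideal_iff ideal_of_def subring_of_def)
  have "phi (0 + 0) = phi 0 + phi 0"
    using phi S_zero unfolding D_algebra_def by blast
  then have phi0: "phi 0 = 0"
    by simp
  show ?thesis
  proof (cases "f = 0")
    case True
    then show ?thesis
      by (simp add: alg_eval_def phi0)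
  next
    case False
    have fD: "coeff f i \<in> D" for i
      using f by (simp add: poly_over_pCons poly_over_coeff)
    have "phi (coeff f i) * (a * a ^ i) = a * (phi (coeff f i) * a ^ i)" for i
      using phi fD[of i] unfolding D_algebra_def by (metis mult.assoc)
    then show ?thesis
      using False by (simp add: alg_eval_def sum.atMost_Suc_shift sum_distrib_left del: sum.atMost_Suc)
  qed
qed

lemma embedding_alg_eval:
  assumes phi: "D_algebra D phi" and D: "subring_of D" and e: "D_alg_embedding D phi n e"
    and g: "g \<in> poly_over D"
  shows "e (alg_eval phi g a) = mat_eval n g (e a)"
proof -
  interpret subring_ideal D D
    using D by (simp add: subring_ideal_iff ideal_of_def subring_of_def)
  have em: "e a \<in> carrier_mat n n" for a
    using e Mn_carrier unfolding D_alg_embedding_def by blast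
  have eh: "e (x + y) = e x + e y" "e (x * y) = e x * e y" "e 1 = 1\<^sub>m n" for x y
    using e unfolding D_alg_embedding_def by auto
  have es: "e (phi d * x) = d \<cdot>\<^sub>m e x" if "d \<in> D" for d x
    using e that unfolding D_alg_embedding_def by blast
  show ?thesis
    using g
  proof (induction g)
    case 0
    have "phi (0 + 0) = phi 0 + phi 0"
      using phi S_zero unfolding D_algebra_def by blast
    then have phi0: "phi 0 = 0"
      by simp
    then have "alg_eval phi 0 a = phi 0 * 1"
      by (simp add: alg_eval_def)
    then have "e (alg_eval phi 0 a) = 0 \<cdot>\<^sub>m 1\<^sub>m n"
      using es[OF S_zero, of 1] eh by simp
    also have "\<dots> = 0\<^sub>m n n"
      by (intro eq_matI) auto
    finally show ?case
      by simp
  next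
    case (pCons c f)
    have "c \<in> D" "f \<in> poly_over D"
      using pCons.prems by (auto simp: poly_over_pCons)
    then have "e (phi c) = c \<cdot>\<^sub>m 1\<^sub>m n" "e (alg_eval phi f a) = mat_eval n f (e a)"
      using es[of c 1] eh(3) pCons.IH by auto
    then show ?case
      by (simp add: alg_eval_pCons[OF phi D pCons.prems] mat_eval_pCons[OF em] eh)
  qed
qed

text \<open>Nonzero scalars cancel in matrices over the field, so the auxiliary denominator in
  \<open>Int_K\<close> disappears, and only the image of the embedding matters. The statement holds
  for any embedding, hence also for a surjective one.\<close>

lemma Int_K_embedding:
  assumes ff: "frac_field_of D" and phi: "D_algebra D phi" and e: "D_alg_embedding D phi n e"
  shows "Int_K D phi = {f. \<forall>a. mat_eval n f (e a) \<in> range e}"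
proof -
  have D: "subring_of D"
    using ff by (simp add: frac_field_of_def)
  have em: "e a \<in> carrier_mat n n" for a
    using e Mn_carrier unfolding D_alg_embedding_def by blast
  have es: "e (phi d * x) = d \<cdot>\<^sub>m e x" if "d \<in> D" for d x
    using e that unfolding D_alg_embedding_def by blast
  have inj: "inj e"
    using e by (simp add: D_alg_embedding_def)
  have cancel: "x = y" if "d \<cdot>\<^sub>m x = d \<cdot>\<^sub>m y" "d \<noteq> 0" "x \<in> carrier_mat n n" "y \<in> carrier_mat n n"
    for d :: 'a and x y
  proof (rule eq_matI)
    fix i j assume "i < dim_row y" "j < dim_col y"
    then have "(d \<cdot>\<^sub>m x) $$ (i, j) = d * x $$ (i, j)" "(d \<cdot>\<^sub>m y) $$ (i, j) = d * y $$ (i, j)"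
      using that(3,4) by auto
    then show "x $$ (i, j) = y $$ (i, j)"
      using that(1,2) by simp
  qed (use that(3,4) in auto)
  have ev: "e (alg_eval phi (Polynomial.smult d f) a) = d \<cdot>\<^sub>m mat_eval n f (e a)"
    if "\<forall>i. d * coeff f i \<in> D" for d f a
    using embedding_alg_eval[OF phi D e, of "Polynomial.smult d f"] that
    by (simp add: poly_over_def mat_eval_smult[OF em])
  show ?thesis
  proof (intro Set.set_eqI iffI)
    fix f assume "f \<in> Int_K D phi"
    then obtain d where d: "d \<in> D" "d \<noteq> 0" "\<forall>i. d * coeff f i \<in> D"
      "\<forall>a. \<exists>b. alg_eval phi (Polynomial.smult d f) a = phi d * b"
      unfolding Int_K_def by blast
    have "mat_eval n f (e a) \<in> range e" for a
    proof -
      obtain b where "alg_eval phi (Polynomial.smult d f) a = phi d * b"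
        using d(4) by blast
      then have "d \<cdot>\<^sub>m mat_eval n f (e a) = d \<cdot>\<^sub>m e b"
        using ev[OF d(3), of a] es[OF d(1), of b] by simp
      then have "mat_eval n f (e a) = e b"
        by (rule cancel) (use d em in auto)
      then show ?thesis
        by simp
    qed
    then show "f \<in> {f. \<forall>a. mat_eval n f (e a) \<in> range e}"
      by simp
  next
    fix f assume f: "f \<in> {f. \<forall>a. mat_eval n f (e a) \<in> range e}"
    obtain d where d: "d \<in> D" "d \<noteq> 0" "\<forall>i. d * coeff f i \<in> D"
      using common_denominator[OF ff] by blast
    have "\<exists>b. alg_eval phi (Polynomial.smult d f) a = phi d * b" for a
    proof -
      obtain b where "mat_eval n f (e a) = e b"
        using f by blast
      then have "e (alg_eval phi (Polynomial.smult d f) a) = e (phi d * b)"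
        using ev[OF d(3), of a] es[OF d(1), of b] by simp
      then show ?thesis
        using inj by (auto simp: inj_def)
    qed
    then show "f \<in> Int_K D phi"
      unfolding Int_K_def using d by blast
  qed
qed

text \<open>Comparing the entries \<open>(i, q)\<close> of \<open>Z * E p q\<close> and
  \<open>E p q * Z\<close> shows that \<open>Z\<close> is diagonal and that each diagonal entry
  equals the one at \<open>q\<close>; the scalar is the case \<open>q = 0\<close>.\<close>

lemma Mn_central:
  assumes n: "n \<ge> 1" and D: "subring_of D" and Z: "Z \<in> Mn D n"
    and com: "\<And>M. M \<in> Mn D n \<Longrightarrow> Z * M = M * Z"
  shows "Z = Z $$ (0, 0) \<cdot>\<^sub>m 1\<^sub>m n"
proof -
  note Zc = Mn_carrier[OF Z]
  define E where "E p q = mat n n (\<lambda>(i, j). if i = p \<and> j = q then 1 else 0 :: 'a)" for p q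
  have Ec: "E p q \<in> carrier_mat n n" for p q
    by (simp add: E_def)
  have E: "E p q \<in> Mn D n" for p q
    using D by (auto simp: E_def Mn_def subring_of_def)
  have key: "Z $$ (i, p) = (if i = p then Z $$ (q, q) else 0)" if "i < n" "p < n" "q < n" for i p q
  proof -
    have "(Z * E p q) $$ (i, q) = (\<Sum>k<n. if k = p then Z $$ (i, k) else 0)"
      unfolding mat_mult_entry[OF Zc Ec that(1,3)] using that by (intro sum.cong) (auto simp: E_def)
    moreover have "(E p q * Z) $$ (i, q) = (\<Sum>k<n. if k = q then (if i = p then Z $$ (q, q) else 0) else 0)"
      unfolding mat_mult_entry[OF Ec Zc that(1,3)] using that by (intro sum.cong) (auto simp: E_def)
    ultimately show ?thesis
      using com[OF E[of p q]] that by simp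
  qed
  show ?thesis
  proof (rule eq_matI)
    fix i j assume "i < dim_row (Z $$ (0, 0) \<cdot>\<^sub>m 1\<^sub>m n)" "j < dim_col (Z $$ (0, 0) \<cdot>\<^sub>m 1\<^sub>m n)"
    then show "Z $$ (i, j) = (Z $$ (0, 0) \<cdot>\<^sub>m 1\<^sub>m n) $$ (i, j)"
      using key[of i j 0] n by (simp only: index_smult_mat index_one_mat) simp
  qed (use Zc in auto)
qed

text \<open>For a nonzero column \<open>v\<close> of \<open>F\<^sub>0\<^sub>0\<close> the vectors \<open>F\<^sub>i\<^sub>0 v\<close> form a basis \<open>V\<close> of common eigenvectors.\<close>
lemma commuting_matrix_units:
  fixes Z :: "'k::field mat"
  assumes n: "n \<ge> 1" and Z: "Z \<in> carrier_mat n n"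
    and F: "\<And>i j. i < n \<Longrightarrow> j < n \<Longrightarrow> F i j \<in> carrier_mat n n"
    and mult: "\<And>i j k l. i < n \<Longrightarrow> j < n \<Longrightarrow> k < n \<Longrightarrow> l < n \<Longrightarrow>
      F i j * F k l = (if j = k then F i l else 0\<^sub>m n n)"
    and nz: "F 0 0 \<noteq> 0\<^sub>m n n"
    and com: "\<And>i j. i < n \<Longrightarrow> j < n \<Longrightarrow> Z * F i j = F i j * Z"
  shows "\<exists>c. Z = c \<cdot>\<^sub>m 1\<^sub>m n"
proof -
  have n0: "0 < n"
    using n by simp
  have "\<exists>r<n. \<exists>c<n. F 0 0 $$ (r, c) \<noteq> 0"
  proof (rule ccontr)
    assume "\<not> ?thesis"
    then have "F 0 0 = 0\<^sub>m n n"
      using carrier_matD[OF F[OF n0 n0]] by (intro eq_matI) auto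
    then show False
      using nz by simp
  qed
  then obtain r0 c0 where rc: "r0 < n" "c0 < n" "F 0 0 $$ (r0, c0) \<noteq> 0"
    by blast
  define V where "V = mat n n (\<lambda>(r, i). F i 0 $$ (r, c0))"
  have V: "V \<in> carrier_mat n n"
    by (simp add: V_def)
  have Ve: "V $$ (r, i) = F i 0 $$ (r, c0)" if "r < n" "i < n" for r i
    using that by (simp add: V_def)
  have apply_comb: "(\<Sum>s<n. A $$ (r, s) * (\<Sum>i<n. F i 0 $$ (s, c0) * w i)) =
      (\<Sum>i<n. (A * F i 0) $$ (r, c0) * w i)"
    if A: "A \<in> carrier_mat n n" and r: "r < n" for A r w
  proof -
    have "(\<Sum>s<n. A $$ (r, s) * (\<Sum>i<n. F i 0 $$ (s, c0) * w i)) =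
        (\<Sum>i<n. \<Sum>s<n. A $$ (r, s) * F i 0 $$ (s, c0) * w i)"
      by (simp add: sum_distrib_left mult.assoc) (rule sum.swap)
    also have "\<dots> = (\<Sum>i<n. (A * F i 0) $$ (r, c0) * w i)"
      using r rc by (intro sum.cong)
        (auto simp: mat_mult_entry[OF A F[OF _ n0]] sum_distrib_right simp del: index_mult_mat(1))
    finally show ?thesis .
  qed
  have F0: "(\<Sum>i<n. (F j k * F i 0) $$ (r, c0) * w i) = F j 0 $$ (r, c0) * w k"
    if "j < n" "k < n" "r < n" for j k r w
  proof -
    have "(\<Sum>i<n. (F j k * F i 0) $$ (r, c0) * w i) = (\<Sum>i<n. if i = k then F j 0 $$ (r, c0) * w k else 0)"
      using that n0 rc by (intro sum.cong refl) (auto simp: mult)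
    then show ?thesis
      using that by simp
  qed
  have "det V \<noteq> 0"
  proof
    assume "det V = 0"
    then obtain w where w: "w \<in> carrier_vec n" "w \<noteq> 0\<^sub>v n" "V *\<^sub>v w = 0\<^sub>v n"
      using det_0_iff_vec_prod_zero_field[OF V] by blast
    have comb: "(\<Sum>i<n. F i 0 $$ (r, c0) * w $ i) = 0" if r: "r < n" for r
    proof -
      have "(V *\<^sub>v w) $ r = (\<Sum>i<n. V $$ (r, i) * w $ i)"
        using r V w(1) by (auto simp: scalar_prod_def atLeast0LessThan)
      then show ?thesis
        using w r by (simp add: Ve)
    qed
    \<comment> \<open>\<open>F 0 j\<close> annihilates every column of \<open>V\<close> except
      column \<open>j\<close>, which it sends to the chosen column of \<open>F 0 0\<close>; so it
      isolates the coefficient \<open>w $ j\<close>.\<close>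
    have "w $ j = 0" if j: "j < n" for j
    proof -
      have "F 0 0 $$ (r0, c0) * w $ j = (\<Sum>s<n. F 0 j $$ (r0, s) * (\<Sum>i<n. F i 0 $$ (s, c0) * w $ i))"
        using apply_comb[OF F[OF n0 j] rc(1)] F0[OF n0 j rc(1)] by simp
      also have "\<dots> = 0"
        by (simp add: comb)
      finally show ?thesis
        using rc by simp
    qed
    then have "w = 0\<^sub>v n"
      using w by (intro eq_vecI) auto
    then show False
      using w by simp
  qed
  define W where "W = (1 / det V) \<cdot>\<^sub>m adj_mat V"
  have W: "W \<in> carrier_mat n n"
    using adj_mat(1)[OF V] by (simp add: W_def)
  have VW: "V * W = 1\<^sub>m n"
  proof -
    have "V * W = (1 / det V) \<cdot>\<^sub>m (det V \<cdot>\<^sub>m 1\<^sub>m n)"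
      unfolding W_def using mult_smult_distrib[OF V adj_mat(1)[OF V]] adj_mat(2)[OF V] by simp
    also have "\<dots> = 1\<^sub>m n"
      using \<open>det V \<noteq> 0\<close> by (intro eq_matI) auto
    finally show ?thesis .
  qed
  define x where "x s = (Z * F 0 0) $$ (s, c0)" for s
  define w where "w i = (\<Sum>s<n. W $$ (i, s) * x s)" for i
  have xw: "x r = (\<Sum>i<n. F i 0 $$ (r, c0) * w i)" if r: "r < n" for r
  proof -
    have "(\<Sum>i<n. F i 0 $$ (r, c0) * w i) = (\<Sum>i<n. \<Sum>s<n. V $$ (r, i) * W $$ (i, s) * x s)"
      using r by (simp add: w_def Ve sum_distrib_left mult.assoc)
    also have "\<dots> = (\<Sum>s<n. (V * W) $$ (r, s) * x s)"
      using r by (subst sum.swap) (simp add: mat_mult_entry[OF V W] sum_distrib_right del: index_mult_mat(1))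
    also have "\<dots> = (\<Sum>s<n. if s = r then x s else 0)"
      using r by (intro sum.cong) (auto simp: VW)
    finally show ?thesis
      using r by simp
  qed
  have ZF: "(Z * F i 0) $$ (r, c0) = (\<Sum>s<n. F i 0 $$ (r, s) * x s)" if i: "i < n" and r: "r < n" for i r
  proof -
    have "Z * F i 0 = Z * (F i 0 * F 0 0)"
      using mult[OF i n0 n0 n0] by simp
    also have "\<dots> = (Z * F i 0) * F 0 0"
      by (rule assoc_mult_mat[symmetric, OF Z F[OF i n0] F[OF n0 n0]])
    also have "\<dots> = (F i 0 * Z) * F 0 0"
      using com[OF i n0] by simp
    also have "\<dots> = F i 0 * (Z * F 0 0)"
      by (rule assoc_mult_mat[OF F[OF i n0] Z F[OF n0 n0]])
    finally show ?thesis
      using r rc mat_mult_entry[OF F[OF i n0] mult_carrier_mat[OF Z F[OF n0 n0]]] by (simp add: x_def del: index_mult_mat(1))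
  qed
  \<comment> \<open>Since \<open>Z\<close> commutes with \<open>F 0 0\<close>, the vector
    \<open>x\<close> is fixed by this idempotent, which annihilates all basis vectors except the one
    of index 0. So \<open>x\<close> is a multiple of that vector.\<close>
  have x0: "x r = F 0 0 $$ (r, c0) * w 0" if r: "r < n" for r
  proof -
    have "x r = (\<Sum>s<n. F 0 0 $$ (r, s) * x s)"
      using ZF[OF n0 r] by (simp add: x_def)
    also have "\<dots> = (\<Sum>s<n. F 0 0 $$ (r, s) * (\<Sum>i<n. F i 0 $$ (s, c0) * w i))"
      by (simp add: xw)
    finally show ?thesis
      using apply_comb[OF F[OF n0 n0] r] F0[OF n0 n0 r] by simp
  qed
  have "Z * V = w 0 \<cdot>\<^sub>m V"
  proof (rule eq_matI)
    fix r i assume "r < dim_row (w 0 \<cdot>\<^sub>m V)" "i < dim_col (w 0 \<cdot>\<^sub>m V)"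
    then have r: "r < n" and i: "i < n"
      using carrier_matD[OF V] by auto
    have "(Z * V) $$ (r, i) = (\<Sum>s<n. Z $$ (r, s) * F i 0 $$ (s, c0))"
      using r i by (simp add: mat_mult_entry[OF Z V] Ve del: index_mult_mat(1))
    also have "\<dots> = (Z * F i 0) $$ (r, c0)"
      using r rc by (simp add: mat_mult_entry[OF Z F[OF i n0]] del: index_mult_mat(1))
    also have "\<dots> = (\<Sum>s<n. F i 0 $$ (r, s) * F 0 0 $$ (s, c0)) * w 0"
      using ZF[OF i r] by (simp add: x0 sum_distrib_right mult.assoc)
    also have "\<dots> = (F i 0 * F 0 0) $$ (r, c0) * w 0"
      using r rc by (simp add: mat_mult_entry[OF F[OF i n0] F[OF n0 n0]] del: index_mult_mat(1))
    also have "\<dots> = (w 0 \<cdot>\<^sub>m V) $$ (r, i)"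
      using r i mult[OF i n0 n0 n0] carrier_matD[OF V] by (simp add: Ve mult.commute)
    finally show "(Z * V) $$ (r, i) = (w 0 \<cdot>\<^sub>m V) $$ (r, i)" .
  qed (use Z V in auto)
  then have "Z * V * W = w 0 \<cdot>\<^sub>m (V * W)"
    using mult_smult_assoc_mat[OF V W] by simp
  moreover have "Z * V * W = Z"
    using assoc_mult_mat[OF Z V W] VW right_mult_one_mat[OF Z] by simp
  ultimately show ?thesis
    using VW by auto
qed

text \<open>A ring isomorphism matches the centres of both sides, which are copies of \<open>D\<close>; correcting it by
  the induced automorphism of \<open>D\<close> makes it linear.\<close>
lemma ring_iso_imp_linear_iso:
  fixes D :: "'k::field set" and phi :: "'k \<Rightarrow> 'a::ring_1" and h :: "'a \<Rightarrow> 'k mat"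
  assumes D: "subring_of D" and phi: "D_algebra D phi" and inj_phi: "inj_on phi D" and n: "n \<ge> 1"
    and e: "D_alg_embedding D phi n e" and h: "ring_iso_Mn D n h"
  obtains h' where "D_alg_embedding D phi n h'" "range h' = Mn D n"
proof -
  interpret subring_ideal D D
    using D by (simp add: subring_ideal_iff ideal_of_def subring_of_def)
  have hM: "h a \<in> Mn D n" and hc: "h a \<in> carrier_mat n n" for a
    using h Mn_carrier unfolding ring_iso_Mn_def bij_betw_def by blast+
  have h_inj: "h a = h b \<Longrightarrow> a = b" for a b
    using h unfolding ring_iso_Mn_def bij_betw_def inj_on_def by blast
  have h_surj: "\<exists>a. h a = M" if "M \<in> Mn D n" for M
    using h that unfolding ring_iso_Mn_def bij_betw_def by (metis imageE)
  have hh: "h (a + b) = h a + h b" "h (a * b) = h a * h b" "h 1 = 1\<^sub>m n" for a b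
    using h unfolding ring_iso_Mn_def by auto
  have central: "phi d * a = a * phi d" if "d \<in> D" for d a
    using phi that unfolding D_algebra_def by blast
  have ph: "phi (x + y) = phi x + phi y" "phi (x * y) = phi x * phi y" "phi 1 = 1" if "x \<in> D" "y \<in> D" for x y
    using phi that unfolding D_algebra_def by blast+
  have ec: "e a \<in> carrier_mat n n" and eM: "e a \<in> Mn D n" for a
    using e Mn_carrier unfolding D_alg_embedding_def by blast+
  have eh: "e (x + y) = e x + e y" "e (x * y) = e x * e y" "e 1 = 1\<^sub>m n" for x y
    using e unfolding D_alg_embedding_def by auto
  have es: "e (phi d * x) = d \<cdot>\<^sub>m e x" if "d \<in> D" for d x
    using e that unfolding D_alg_embedding_def by blast
  have e_inj: "e a = e b \<Longrightarrow> a = b" for a b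
    using e unfolding D_alg_embedding_def inj_def by blast
  have zero_im: "f 0 = 0\<^sub>m n n" if f: "\<And>a b. f (a + b) = f a + f b" "f 0 \<in> carrier_mat n n"
    for f :: "'a \<Rightarrow> 'k mat"
  proof (rule eq_matI)
    fix i j assume ij: "i < dim_row (0\<^sub>m n n :: 'k mat)" "j < dim_col (0\<^sub>m n n :: 'k mat)"
    have "f 0 = f 0 + f 0"
      using f(1)[of 0 0] by simp
    then have "f 0 $$ (i, j) = (f 0 + f 0) $$ (i, j)"
      by (rule arg_cong)
    also have "\<dots> = f 0 $$ (i, j) + f 0 $$ (i, j)"
      using ij f(2) by (intro index_add_mat) auto
    finally have "f 0 $$ (i, j) = 0"
      by (simp only: add_cancel_right_right)
    then show "f 0 $$ (i, j) = 0\<^sub>m n n $$ (i, j)"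
      using ij by simp
  qed (use f in auto)
  have h0: "h 0 = 0\<^sub>m n n" and e0: "e 0 = 0\<^sub>m n n"
    using zero_im[of h] zero_im[of e] hh(1) eh(1) hc ec by auto
  have \<sigma>: "\<exists>c\<in>D. h (phi d) = c \<cdot>\<^sub>m 1\<^sub>m n" if d: "d \<in> D" for d
  proof -
    have "h (phi d) * M = M * h (phi d)" if M: "M \<in> Mn D n" for M
      using h_surj[OF M] central[OF d] hh(2) by metis
    then have "h (phi d) = h (phi d) $$ (0, 0) \<cdot>\<^sub>m 1\<^sub>m n"
      by (rule Mn_central[OF n D hM])
    moreover have "h (phi d) $$ (0, 0) \<in> D"
      using Mn_entry[OF hM] n by simp
    ultimately show ?thesis
      by blast
  qed
  define E where "E p q = mat n n (\<lambda>(i, j). if i = p \<and> j = q then 1 else 0 :: 'k)" for p q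
  have EM: "E p q \<in> Mn D n" for p q
    using S_zero S_one by (auto simp: E_def Mn_def)
  have EE: "E i j * E k l = (if j = k then E i l else 0\<^sub>m n n)" if ijkl: "i < n" "j < n" "k < n" "l < n" for i j k l
  proof (rule eq_matI)
    fix r s assume "r < dim_row (if j = k then E i l else 0\<^sub>m n n)" "s < dim_col (if j = k then E i l else 0\<^sub>m n n)"
    then have rs: "r < n" "s < n"
      by (auto simp: E_def split: if_splits)
    have "(E i j * E k l) $$ (r, s) = (\<Sum>t<n. E i j $$ (r, t) * E k l $$ (t, s))"
      by (rule mat_mult_entry[OF Mn_carrier[OF EM] Mn_carrier[OF EM] rs])
    also have "\<dots> = (\<Sum>t<n. if t = j then (if r = i \<and> j = k \<and> s = l then 1 else 0) else 0)"
      using rs by (intro sum.cong) (auto simp: E_def)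
    finally show "(E i j * E k l) $$ (r, s) = (if j = k then E i l else 0\<^sub>m n n) $$ (r, s)"
      using rs ijkl by (auto simp: E_def)
  qed (auto simp: E_def)
  have "\<exists>g. \<forall>p q. h (g p q) = E p q"
    using h_surj[OF EM] by metis
  then obtain g where g: "\<And>p q. h (g p q) = E p q"
    by blast
  have gg: "g i j * g k l = (if j = k then g i l else 0)" if "i < n" "j < n" "k < n" "l < n" for i j k l
    by (rule h_inj) (simp add: hh g EE[OF that] h0)
  have \<tau>_ex: "\<exists>l\<in>D. h (phi l) = d \<cdot>\<^sub>m 1\<^sub>m n" if d: "d \<in> D" for d
  proof -
    have dM: "d \<cdot>\<^sub>m 1\<^sub>m n \<in> Mn D n"
      using d S_zero by (auto simp: Mn_def)
    then obtain z where z: "h z = d \<cdot>\<^sub>m 1\<^sub>m n"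
      using h_surj by blast
    have zc: "z * a = a * z" for a
    proof (rule h_inj)
      have "(d \<cdot>\<^sub>m 1\<^sub>m n) * h a = h a * (d \<cdot>\<^sub>m 1\<^sub>m n)"
        using mult_smult_assoc_mat[OF one_carrier_mat hc, of d a] mult_smult_distrib[OF hc one_carrier_mat, of a d]
          left_mult_one_mat[OF hc] right_mult_one_mat[OF hc] by simp
      then show "h (z * a) = h (a * z)"
        by (simp add: hh z)
    qed
    \<comment> \<open>The matrix units are pulled back through \<open>h\<close> and pushed forward
      through \<open>e\<close>. The image of \<open>e\<close> need not be all of
      \<open>Mn D n\<close>, but it contains this second system of matrix units, and commuting with
      it suffices to make \<open>e z\<close> scalar.\<close>
    have "\<exists>c. e z = c \<cdot>\<^sub>m 1\<^sub>m n"
    proof (rule commuting_matrix_units[OF n ec, of "\<lambda>i j. e (g i j)"])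
      show "e (g i j) * e (g k l) = (if j = k then e (g i l) else 0\<^sub>m n n)" if "i < n" "j < n" "k < n" "l < n" for i j k l
        using gg[OF that] e0 by (simp flip: eh(2))
      show "e z * e (g i j) = e (g i j) * e z" for i j
        using zc by (simp flip: eh(2))
      show "e (g 0 0) \<noteq> 0\<^sub>m n n"
      proof
        assume "e (g 0 0) = 0\<^sub>m n n"
        then have "g 0 0 = 0"
          using e_inj e0 by simp
        then have "E 0 0 $$ (0, 0) = (0\<^sub>m n n :: 'k mat) $$ (0, 0)"
          using g[of 0 0] h0 by simp
        then show False
          using n by (simp add: E_def)
      qed
    qed (simp add: ec)
    then obtain c where c: "e z = c \<cdot>\<^sub>m 1\<^sub>m n"
      by blast
    have cD: "c \<in> D"
      using Mn_entry[OF eM, of 0 0 z] n by (simp add: c)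
    have "e (phi c * 1) = e z"
      using es[OF cD, of 1] eh(3) c by metis
    then have "z = phi c"
      using e_inj by fastforce
    then show ?thesis
      using z cD by blast
  qed
  \<comment> \<open>\<open>h\<close> carries \<open>phi d\<close> to a scalar matrix;
    \<open>\<tau>\<close> inverts the resulting map on \<open>D\<close>, and injectivity of
    \<open>phi\<close> makes its value unique.\<close>
  define \<tau> where "\<tau> d = (SOME l. l \<in> D \<and> h (phi l) = d \<cdot>\<^sub>m 1\<^sub>m n)" for d
  have \<tau>: "\<tau> d \<in> D" "h (phi (\<tau> d)) = d \<cdot>\<^sub>m 1\<^sub>m n" if "d \<in> D" for d
    using someI_ex[of "\<lambda>l. l \<in> D \<and> h (phi l) = d \<cdot>\<^sub>m 1\<^sub>m n"] \<tau>_ex[OF that] unfolding \<tau>_def by blast+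
  have \<tau>_eq: "\<tau> d = l" if "d \<in> D" "l \<in> D" "h (phi l) = d \<cdot>\<^sub>m 1\<^sub>m n" for d l
    using \<tau>[OF that(1)] that h_inj inj_phi unfolding inj_on_def by metis
  have one_smult: "x \<cdot>\<^sub>m 1\<^sub>m n + y \<cdot>\<^sub>m 1\<^sub>m n = (x + y) \<cdot>\<^sub>m 1\<^sub>m n"
    "(x \<cdot>\<^sub>m 1\<^sub>m n) * (y \<cdot>\<^sub>m 1\<^sub>m n) = (x * y) \<cdot>\<^sub>m 1\<^sub>m n" for x y :: 'k
  proof -
    show "x \<cdot>\<^sub>m 1\<^sub>m n + y \<cdot>\<^sub>m 1\<^sub>m n = (x + y) \<cdot>\<^sub>m 1\<^sub>m n"
      by (intro eq_matI) auto
    have "(x \<cdot>\<^sub>m 1\<^sub>m n) * (y \<cdot>\<^sub>m 1\<^sub>m n) = x \<cdot>\<^sub>m (1\<^sub>m n * (y \<cdot>\<^sub>m 1\<^sub>m n))"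
      by (rule mult_smult_assoc_mat) auto
    also have "\<dots> = x \<cdot>\<^sub>m (y \<cdot>\<^sub>m 1\<^sub>m n)"
      by (subst left_mult_one_mat) auto
    also have "\<dots> = (x * y) \<cdot>\<^sub>m 1\<^sub>m n"
      by (intro eq_matI) auto
    finally show "(x \<cdot>\<^sub>m 1\<^sub>m n) * (y \<cdot>\<^sub>m 1\<^sub>m n) = (x * y) \<cdot>\<^sub>m 1\<^sub>m n" .
  qed
  have \<tau>_add: "\<tau> (x + y) = \<tau> x + \<tau> y" and \<tau>_mult: "\<tau> (x * y) = \<tau> x * \<tau> y"
    if xy: "x \<in> D" "y \<in> D" for x y
  proof -
    show "\<tau> (x + y) = \<tau> x + \<tau> y"
      by (rule \<tau>_eq) (use xy \<tau> S_add in \<open>simp_all add: ph hh one_smult\<close>)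
    show "\<tau> (x * y) = \<tau> x * \<tau> y"
      by (rule \<tau>_eq) (use xy \<tau> S_mult in \<open>simp_all add: ph hh one_smult\<close>)
  qed
  have \<tau>1: "\<tau> 1 = 1"
    by (rule \<tau>_eq) (use S_one in \<open>auto simp: ph(3)[OF S_one S_one] hh\<close>)
  have "\<tau> (0 + 0) = \<tau> 0 + \<tau> 0"
    by (rule \<tau>_add[OF S_zero S_zero])
  then have \<tau>0: "\<tau> 0 = 0"
    by (simp only: add_0_left add_cancel_right_right)
  have \<tau>_sum: "\<tau> (sum f A) = (\<Sum>x\<in>A. \<tau> (f x))" if "\<And>x. x \<in> A \<Longrightarrow> f x \<in> D" for f :: "nat \<Rightarrow> 'k" and A
    using that by (induction A rule: infinite_finite_induct) (auto simp: \<tau>0 \<tau>_add S_sum)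
  have \<tau>_inj: "x = y" if "x \<in> D" "y \<in> D" "\<tau> x = \<tau> y" for x y
  proof -
    have "x \<cdot>\<^sub>m 1\<^sub>m n = y \<cdot>\<^sub>m 1\<^sub>m n"
      using \<tau>(2)[OF that(1)] \<tau>(2)[OF that(2)] that(3) by simp
    then have "(x \<cdot>\<^sub>m 1\<^sub>m n) $$ (0, 0) = (y \<cdot>\<^sub>m 1\<^sub>m n) $$ (0, 0)"
      by simp
    then show ?thesis
      using n by simp
  qed
  have \<tau>_surj: "\<exists>c\<in>D. \<tau> c = d \<and> h (phi d) = c \<cdot>\<^sub>m 1\<^sub>m n" if "d \<in> D" for d
    using \<sigma>[OF that] \<tau>_eq that by blast
  \<comment> \<open>If \<open>h\<close> multiplies by \<open>c\<close> where \<open>A\<close>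
    multiplies by \<open>phi d\<close>, then \<open>\<tau> c = d\<close>. Applying
    \<open>\<tau>\<close> to every entry therefore turns the twisted scalar back into
    \<open>d\<close>.\<close>
  define h' where "h' a = map_mat \<tau> (h a)" for a
  have hd: "dim_row (h a) = n" "dim_col (h a) = n" for a
    using carrier_matD[OF hc] by auto
  have he: "h a $$ (i, j) \<in> D" if "i < n" "j < n" for a i j
    using Mn_entry[OF hM that] .
  have h'c: "h' a \<in> carrier_mat n n" for a
    using hc by (simp add: h'_def)
  have h'e: "h' a $$ (i, j) = \<tau> (h a $$ (i, j))" if "i < n" "j < n" for a i j
    using that by (simp add: h'_def hd)
  have h'M: "h' a \<in> Mn D n" for a
    using h'c \<tau>(1)[OF he] by (intro Mn_I) (auto simp: h'e)
  have "D_alg_embedding D phi n h'"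
    unfolding D_alg_embedding_def
  proof (intro conjI allI ballI)
    show "inj h'"
    proof (rule injI)
      fix a b assume ab: "h' a = h' b"
      have "h a $$ (i, j) = h b $$ (i, j)" if "i < n" "j < n" for i j
        using \<tau>_inj[OF he he] that h'e[OF that, of a] h'e[OF that, of b] ab by simp
      then have "h a = h b"
        by (intro eq_matI) (auto simp: hd)
      then show "a = b"
        by (rule h_inj)
    qed
    show "h' a \<in> Mn D n" for a
      by (rule h'M)
    show "h' (a + b) = h' a + h' b" for a b
      by (intro eq_matI) (auto simp: h'_def hh hd \<tau>_add[OF he he])
    show "h' (a * b) = h' a * h' b" for a b
    proof (rule eq_matI)
      fix i j assume "i < dim_row (h' a * h' b)" "j < dim_col (h' a * h' b)"
      then have ij: "i < n" "j < n"
        by (auto simp: h'_def hd)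
      have "h' (a * b) $$ (i, j) = \<tau> (\<Sum>k<n. h a $$ (i, k) * h b $$ (k, j))"
        using ij by (simp add: h'e hh mat_mult_entry[OF hc hc] del: index_mult_mat(1))
      also have "\<dots> = (\<Sum>k<n. h' a $$ (i, k) * h' b $$ (k, j))"
        using ij he by (subst \<tau>_sum) (auto simp: h'e \<tau>_mult intro!: S_mult sum.cong)
      finally show "h' (a * b) $$ (i, j) = (h' a * h' b) $$ (i, j)"
        using ij by (simp add: mat_mult_entry[OF h'c h'c] del: index_mult_mat(1))
    qed (auto simp: h'_def hd)
    show "h' 1 = 1\<^sub>m n"
      by (intro eq_matI) (auto simp: h'_def hh \<tau>0 \<tau>1)
    show "h' (phi d * a) = d \<cdot>\<^sub>m h' a" if d: "d \<in> D" for d a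
    proof -
      obtain c where c: "c \<in> D" "\<tau> c = d" "h (phi d) = c \<cdot>\<^sub>m 1\<^sub>m n"
        using \<tau>_surj[OF d] by blast
      have "h (phi d * a) = c \<cdot>\<^sub>m h a"
        using mult_smult_assoc_mat[OF one_carrier_mat hc, of c a] left_mult_one_mat[OF hc]
        by (simp add: hh c)
      then show ?thesis
        using c he by (intro eq_matI) (auto simp: h'_def hd \<tau>_mult)
    qed
  qed
  moreover have "range h' = Mn D n"
  proof (intro subset_antisym subsetI)
    fix M assume M: "M \<in> Mn D n"
    define c where "c d = (SOME c. c \<in> D \<and> \<tau> c = d)" for d
    have c: "c d \<in> D \<and> \<tau> (c d) = d" if "d \<in> D" for d
      unfolding c_def by (rule someI_ex) (use \<tau>_surj[OF that] in blast)
    have "map_mat c M \<in> Mn D n"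
      using M c by (auto simp: Mn_def)
    then obtain a where a: "h a = map_mat c M"
      using h_surj by blast
    have "h' a = M"
      using c Mn_entry[OF M] carrier_matD[OF Mn_carrier[OF M]] by (intro eq_matI) (auto simp: h'_def a)
    then show "M \<in> range h'"
      by blast
  qed (use h'M in auto)
  ultimately show ?thesis
    using that by blast
qed

theorem mainTheorem6:
  fixes D :: "'k::field set" and phi :: "'k \<Rightarrow> 'a::ring_1" and n :: nat
  assumes "dedekind_dom D" and "finite_residue_fields D"
    and "standard_assumptions D phi" and "fin_gen_module D phi"
    and "n \<ge> 1" and "\<exists>e. D_alg_embedding D phi n e"
  shows "Int_K D phi = Int_K_Mn D n \<longleftrightarrow> (\<exists>h :: 'a \<Rightarrow> 'k mat. ring_iso_Mn D n h)"
proof -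
  obtain e where e: "D_alg_embedding D phi n e"
    using assms(6) by blast
  have ff: "frac_field_of D" and D: "subring_of D"
    using assms(1) by (auto simp: dedekind_dom_def frac_field_of_def)
  have phi: "D_algebra D phi" and inj_phi: "inj_on phi D"
    using assms(3) by (auto simp: standard_assumptions_def)
  have eM: "range e \<subseteq> Mn D n" and e_inj: "inj e"
    and eh: "\<And>x y. e (x + y) = e x + e y" "\<And>x y. e (x * y) = e x * e y" "e 1 = 1\<^sub>m n"
    and es: "\<And>d x. d \<in> D \<Longrightarrow> e (phi d * x) = d \<cdot>\<^sub>m e x"
    using e unfolding D_alg_embedding_def by auto
  show ?thesis
  proof
    assume eq: "Int_K D phi = Int_K_Mn D n"
    interpret matrix_subalgebra D n "range e"
    proof
      show "x + y \<in> range e" if "x \<in> range e" "y \<in> range e" for x y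
        using that by (auto simp flip: eh(1))
      show "x * y \<in> range e" if "x \<in> range e" "y \<in> range e" for x y
        using that by (auto simp flip: eh(2))
      show "c \<cdot>\<^sub>m x \<in> range e" if "c \<in> D" "x \<in> range e" for c x
        using that by (auto simp flip: es)
      show "1\<^sub>m n \<in> range e"
        using eh(3) by (metis rangeI)
    qed (use assms(1,5) eM in auto)
    have "mat_eval n f M \<in> Mn D n"
      if f: "\<And>b. b \<in> range e \<Longrightarrow> mat_eval n f b \<in> range e" and M: "M \<in> Mn D n" for f M
    proof -
      have "f \<in> Int_K D phi"
        unfolding Int_K_embedding[OF ff phi e] using f by blast
      then show ?thesis
        using eq M by (simp add: Int_K_Mn_def)
    qed
    then have "range e = Mn D n"
      by (rule full_of_integer_valued[OF assms(2)])
    then have "ring_iso_Mn D n e"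
      using e_inj eh by (simp add: ring_iso_Mn_def bij_betw_def)
    then show "\<exists>h :: 'a \<Rightarrow> 'k mat. ring_iso_Mn D n h"
      by blast
  next
    assume "\<exists>h :: 'a \<Rightarrow> 'k mat. ring_iso_Mn D n h"
    then obtain h' where h': "D_alg_embedding D phi n h'" "range h' = Mn D n"
      using ring_iso_imp_linear_iso[OF D phi inj_phi assms(5) e] by metis
    \<comment> \<open>With \<open>h'\<close> surjective and linear, integer-valuedness on
      \<open>A\<close> and on all matrices over \<open>D\<close> becomes one and the same
      condition.\<close>
    have "(\<forall>a. mat_eval n f (h' a) \<in> range h') \<longleftrightarrow> (\<forall>M\<in>range h'. mat_eval n f M \<in> range h')" for f
      by blast
    then show "Int_K D phi = Int_K_Mn D n"
      unfolding Int_K_embedding[OF ff phi h'(1)] Int_K_Mn_def h'(2)[symmetric] by simp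
  qed
qed


end
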